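(* Let $d\ge2$, $k\ge1$, let $\Pi_1,\dots,\Pi_k$ be i.i.d. uniformly distributed random $d\times d$ permutation matrices, and let $X=\sum_{i=1}^k(\Pi_i+\Pi_i^* )$. Let $X^\perp$ be the restriction of $X$ to $1^\perp$, where $1\in\mathbb{R}^d$ is the vector all of whose entries are one. Then for every $a>0$ there is a constant $C>0$ depending only on $a$ such that $$\|X^\perp\|\le\bigg(1+C\frac{(\log d)^{\frac34}}{d^{\frac14}}+C\frac{(\log d)^{\frac23}}{k^{\frac16}}+C\frac{\log d}{k^{\frac12}}\bigg)2\sqrt{2k}$$ with probability at least $1-d^{-a}$. In particular, the second largest eigenvalue $\lambda_2(X)$ satisfies $\lambda_2(X)\le(1+o(1))\,2\sqrt{2k-1}$ with probability $1-o(1)$ whenever $d,k\to\infty$ with $(\log d)^4=o(k)$.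
   Context: $X$ is the adjacency matrix of a (not necessarily simple) random $2k$-regular graph on $d$ vertices (the permutation model); $1$ is an eigenvector of $X$ with eigenvalue $2k$, so $X$ maps $1^\perp$ to itself. $\|\cdot\|$ is the operator norm; eigenvalues are counted in decreasing order with multiplicity. The constant $C$ does not depend on $d,k$. *)

theory Defs
  imports
    "HOL-Probability.Probability"
    "HOL-Library.Landau_Symbols"
    "Jordan_Normal_Form.Char_Poly"
begin

definition perm_matrix :: "nat \<Rightarrow> (nat \<Rightarrow> nat) \<Rightarrow> real mat" where
  "perm_matrix d \<pi> = mat d d (\<lambda>(r, c). if r = \<pi> c then 1 else 0)"

definition perm_matrices :: "nat \<Rightarrow> real mat set" where
  "perm_matrices d = perm_matrix d ` {\<pi>. \<pi> permutes {..<d}}"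

text \<open>
  The joint law of \<open>k\<close> independent random matrices, indexed by \<open>{1..k}\<close>, each uniformly
  distributed on the \<open>d \<times> d\<close> permutation matrices. The value \<open>0\<^sub>m d d\<close> is the dummy taken at
  indices outside \<open>{1..k}\<close>.
\<close>
definition iid_perm_matrices :: "nat \<Rightarrow> nat \<Rightarrow> (nat \<Rightarrow> real mat) pmf" where
  "iid_perm_matrices d k = Pi_pmf {1..k} (0\<^sub>m d d) (\<lambda>_. pmf_of_set (perm_matrices d))"

text \<open>
  The finite sum of matrices is taken entrywise, since \<^typ>\<open>real mat\<close> has no zero element common
  to all dimensions. As the matrices are real, the adjoint is the transpose.
\<close>
definition perm_model :: "nat \<Rightarrow> nat \<Rightarrow> (nat \<Rightarrow> real mat) \<Rightarrow> real mat" where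
  "perm_model d k P = mat d d (\<lambda>ij. \<Sum>i\<in>{1..k}. (P i + (P i)\<^sup>T) $$ ij)"

definition vec_norm2 :: "real vec \<Rightarrow> real" where
  "vec_norm2 v = sqrt (v \<bullet> v)"

definition ones_vec :: "nat \<Rightarrow> real vec" where
  "ones_vec d = vec d (\<lambda>_. 1)"

definition orth_complement :: "nat \<Rightarrow> real vec \<Rightarrow> real vec set" where
  "orth_complement d u = {v \<in> carrier_vec d. v \<bullet> u = 0}"

definition opnorm_on :: "real vec set \<Rightarrow> real mat \<Rightarrow> real" where
  "opnorm_on V A = (SUP v\<in>{v \<in> V. vec_norm2 v \<le> 1}. vec_norm2 (A *\<^sub>v v))"

definition norm_perp :: "nat \<Rightarrow> real mat \<Rightarrow> real" where
  "norm_perp d A = opnorm_on (orth_complement d (ones_vec d)) A"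

text \<open>
  The real eigenvalues in decreasing order, with algebraic multiplicity. For a symmetric real
  \<open>d \<times> d\<close> matrix this list has length \<open>d\<close>.
\<close>
definition eigenvalues_desc :: "real mat \<Rightarrow> real list" where
  "eigenvalues_desc A = rev (sorted_list_of_multiset (proots (char_poly A)))"

definition second_eigenvalue :: "real mat \<Rightarrow> real" where
  "second_eigenvalue A = eigenvalues_desc A ! 1"

end

theory Submission
  imports Defs "HOL-Real_Asymp.Real_Asymp"
begin

text \<open>
  The restriction of \<open>X\<close> to the complement of the all-ones vector is a sum of \<open>k\<close> independent
  centred matrices \<open>S\<^sub>i = \<Pi>\<^sub>i + \<Pi>\<^sub>i\<^sup>T - 2J/d\<close>, where \<open>J\<close> is the all-ones matrix. A permutation matrix has,
  after centring, the same covariance as \<open>P G P / sqrt (d - 1)\<close>, where \<open>P = I - J/d\<close> and \<open>G\<close> has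
  independent random signs as entries. Replacing the \<open>S\<^sub>i\<close> one at a time by the corresponding sign
  matrices \<open>T\<^sub>i\<close> (Lindeberg) therefore changes \<open>E tr X\<^sup>2\<^sup>p\<close> only through words with at least three
  letters \<open>S\<^sub>i\<close> or \<open>T\<^sub>i\<close>, and these are bounded by Hoelder's inequality for traces. In terms of the
  cubed Schatten norm each replacement costs \<open>O(p\<^sup>2)\<close>, which is where \<open>k\<^sup>1\<^sup>/\<^sup>3 (log d)\<^sup>2\<^sup>/\<^sup>3\<close> comes from.

  For the sign model, integration by parts is an inequality between polynomials with nonnegative
  coefficients, so the mixed moments of traces satisfy the loop equations of the Gaussian
  orthogonal ensemble as inequalities; a supersolution made of Catalan numbers gives the sharp
  constant \<open>2 sqrt (2k)\<close>. Markov's inequality with \<open>p\<close> of order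
  \<open>max (log d) (min ((log d)\<^sup>1\<^sup>/\<^sup>3 k\<^sup>1\<^sup>/\<^sup>6) ((d log d)\<^sup>1\<^sup>/\<^sup>4))\<close> yields the norm bound. Finally
  \<open>\<lambda>\<^sub>2(X)\<close> is at most the norm on the complement, because the characteristic polynomial of \<open>X\<close> splits
  off the root \<open>2k\<close> belonging to the all-ones vector.
\<close>

section \<open>Words of symmetric matrices and Hoelder's inequality for traces\<close>

text \<open>The order p must reach log d to absorb the dimension factor, while every comparison
  loses more as p grows. On the scale of the cubed norm the relative losses are (log d)/p from the
  dimension and the tail, p^2/d from the corrections to the loop equations, p^2/sqrt k from the k
  replacements, and p^3/k^(3/2) from the demand that a single summand be at most 1/p of the whole.
  Balancing (log d)/p against the other losses gives the three error terms. Hoelder's inequality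
  carries the analytic work: it bounds the words left over by a replacement, shows that dropping a
  centred summand or compressing by a projection does not increase a Schatten norm, and, applied
  with a rank one matrix, passes from the moment to the operator norm without a spectral theorem.
  Signs in place of Gaussians keep everything on a finite uniform space, where expectations are
  finite sums and symmetries are involutions. The obstacle in the sign model is that the loop
  equations couple products of traces, in which traces of odd powers do not average out; the
  supersolution therefore has to give odd powers a weight of their own.\<close>

type_synonym rmat = "nat \<Rightarrow> nat \<Rightarrow> real"

text \<open>Matrices are total functions on index pairs, and the dimension \<open>d\<close> enters
  only as the range of summation. In return an identity such as
  \<open>mprod d [A] i j = A i j\<close> holds only for \<open>j < d\<close>.\<close>

fun mprod :: "nat \<Rightarrow> rmat list \<Rightarrow> rmat" where
  "mprod d [] i j = (if i = j then 1 else 0)"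
| "mprod d (A # As) i j = (\<Sum>l<d. A i l * mprod d As l j)"

definition trw :: "nat \<Rightarrow> rmat list \<Rightarrow> real" where
  "trw d As = (\<Sum>i<d. mprod d As i i)"

definition symm :: "rmat \<Rightarrow> bool" where
  "symm A \<longleftrightarrow> (\<forall>i j. A i j = A j i)"

lemma mprod_append:
  assumes "i < d"
  shows "mprod d (xs @ ys) i j = (\<Sum>l<d. mprod d xs i l * mprod d ys l j)"
  using assms
proof (induction xs arbitrary: i)
  case Nil
  have "(\<Sum>l<d. (if i = l then 1 else 0) * mprod d ys l j) = (\<Sum>l<d. if l = i then mprod d ys l j else 0)"
    by (rule sum.cong) auto
  then show ?case using Nil by simp
next
  case (Cons A xs)
  have "mprod d ((A # xs) @ ys) i j = (\<Sum>l<d. A i l * (\<Sum>m<d. mprod d xs l m * mprod d ys m j))"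
    using Cons by simp
  also have "\<dots> = (\<Sum>m<d. (\<Sum>l<d. A i l * mprod d xs l m) * mprod d ys m j)"
    by (simp add: sum_distrib_left sum_distrib_right mult.assoc) (rule sum.swap)
  finally show ?case by simp
qed

lemma trw_append:
  "trw d (xs @ ys) = (\<Sum>i<d. \<Sum>l<d. mprod d xs i l * mprod d ys l i)"
  unfolding trw_def by (rule sum.cong) (auto simp: mprod_append)

lemma trw_append_commute: "trw d (xs @ ys) = trw d (ys @ xs)"
  unfolding trw_append by (subst sum.swap) (simp add: mult.commute)

lemma mprod_rev:
  assumes "\<And>A. A \<in> set xs \<Longrightarrow> symm A" "i < d" "j < d"
  shows "mprod d (rev xs) i j = mprod d xs j i"
  using assms
proof (induction xs arbitrary: i j)
  case (Cons A xs)
  have "mprod d (rev (A # xs)) i j = (\<Sum>l<d. mprod d (rev xs) i l * mprod d [A] l j)"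
    using Cons.prems by (simp add: mprod_append)
  also have "\<dots> = (\<Sum>l<d. mprod d xs l i * A j l)"
  proof (rule sum.cong)
    fix l assume l: "l \<in> {..<d}"
    have "mprod d [A] l j = (\<Sum>m<d. if m = j then A l m else 0)" by (simp add: if_distrib cong: if_cong)
    also have "\<dots> = A l j" using Cons.prems by simp
    finally show "mprod d (rev xs) i l * mprod d [A] l j = mprod d xs l i * A j l"
      using Cons l by (simp add: symm_def)
  qed simp
  also have "\<dots> = mprod d (A # xs) j i" by (simp add: mult.commute)
  finally show ?case .
qed auto

text \<open>Reversing a word of symmetric matrices transposes its product, so this is the trace of a
  matrix times its transpose.\<close>

lemma trw_palindrome:
  assumes "\<And>A. A \<in> set xs \<Longrightarrow> symm A"
  shows "trw d (xs @ rev xs) = (\<Sum>i<d. \<Sum>l<d. (mprod d xs i l)\<^sup>2)"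
  unfolding trw_append by (intro sum.cong refl) (use assms in \<open>auto simp: mprod_rev power2_eq_square\<close>)

text \<open>These three properties are all that the proof of Hoelder's inequality uses. They hold
  for a trace and survive averaging, so one proof serves both expected traces of random words and,
  over a one-point space, ordinary traces.\<close>

locale word_trace =
  fixes \<phi> :: "'a list \<Rightarrow> real" and L :: "'a set"
  assumes cyclic: "set xs \<subseteq> L \<Longrightarrow> set ys \<subseteq> L \<Longrightarrow> \<phi> (xs @ ys) = \<phi> (ys @ xs)"
    and palindrome_nonneg: "set xs \<subseteq> L \<Longrightarrow> \<phi> (xs @ rev xs) \<ge> 0"
    and reflect: "set xs \<subseteq> L \<Longrightarrow> set ys \<subseteq> L \<Longrightarrow>
      (\<phi> (xs @ ys))\<^sup>2 \<le> \<phi> (xs @ rev xs) * \<phi> (rev ys @ ys)"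
begin

lemma replicate_even_nonneg: "x \<in> L \<Longrightarrow> \<phi> (replicate (2 * p) x) \<ge> 0"
  using palindrome_nonneg[of "replicate p x"] by (simp add: replicate_add mult_2 set_replicate_conv_if)

text \<open>
  Reflecting a maximiser of \<open>R\<close> by Cauchy-Schwarz gives again a maximiser, and after a rotation
  this doubles a run of equal letters; so some constant word is a maximiser. The \<open>\<epsilon>\<close> keeps the
  denominators positive.
\<close>
lemma holder_aux:
  assumes L: "set xs \<subseteq> L" and len: "length xs = 2 * p" and p: "p \<ge> 1" and \<epsilon>: "\<epsilon> > 0"
  shows "\<bar>\<phi> xs\<bar> ^ (2 * p) \<le> prod_list (map (\<lambda>x. \<phi> (replicate (2 * p) x) + \<epsilon>) xs)"
proof -
  define w where "w x = \<phi> (replicate (2 * p) x) + \<epsilon>" for x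
  define W where "W ys = prod_list (map w ys)" for ys
  \<comment> \<open>\<open>R\<close> is the ratio of the two sides of the claim. It suffices that
    its maximum \<open>M\<close> over the finitely many words of this length in the letters of
    \<open>xs\<close> is at most 1.\<close>
  define R where "R ys = \<bar>\<phi> ys\<bar> ^ (2 * p) / W ys" for ys
  define K where "K = {ys. set ys \<subseteq> set xs \<and> length ys = 2 * p}"
  have wpos: "w x > 0" if "x \<in> set xs" for x
    using replicate_even_nonneg[of x p] that L \<epsilon> by (auto simp: w_def intro: add_nonneg_pos)
  have Wpos: "W ys > 0" if "set ys \<subseteq> set xs" for ys
    using that wpos unfolding W_def by (induction ys) auto
  have Wapp: "W (us @ vs) = W us * W vs" for us vs by (simp add: W_def)
  have Wrev: "W (rev us) = W us" for us by (induction us) (auto simp: W_def)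
  have finK: "finite K" unfolding K_def by (rule finite_lists_length_eq) simp
  have xsK: "xs \<in> K" using len by (simp add: K_def)
  define M where "M = Max (R ` K)"
  have R_le: "R ys \<le> M" if "ys \<in> K" for ys unfolding M_def using finK that by auto
  have R_nonneg: "R ys \<ge> 0" if "ys \<in> K" for ys
    unfolding R_def using Wpos[of ys] that by (auto simp: K_def intro!: divide_nonneg_pos)
  have "M \<in> R ` K" unfolding M_def by (rule Max_in) (use finK xsK in auto)
  then obtain ys0 where ys0: "ys0 \<in> K" "R ys0 = M" by auto
  have rot: "R (us @ vs) = R (vs @ us)" if "us @ vs \<in> K" for us vs
    using that L unfolding R_def K_def by (subst cyclic) (auto simp: Wapp mult.commute)
  \<comment> \<open>The weight \<open>W\<close> is multiplicative and blind to reversal, so the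
    squared weight of \<open>us @ vs\<close> is the product of the weights of the two palindromes.
    Cauchy-Schwarz then bounds the squared ratio by the product of two ratios, one of which is at
    most \<open>M\<close>.\<close>
  have refl_max: "R (us @ rev us) = M"
    if *: "us @ vs \<in> K" "length us = p" "R (us @ vs) = M" and Mpos: "M > 0" for us vs
  proof -
    have sub: "set us \<subseteq> L" "set vs \<subseteq> L" "set us \<subseteq> set xs" "set vs \<subseteq> set xs" "length vs = p"
      using * L by (auto simp: K_def)
    have K1: "us @ rev us \<in> K" "rev vs @ vs \<in> K" using * sub by (auto simp: K_def)
    have "M\<^sup>2 = ((\<phi> (us @ vs))\<^sup>2) ^ (2 * p) / (W us * W vs)\<^sup>2"
      by (simp add: *(3)[symmetric] R_def Wapp power_divide power_even_abs mult.commute flip: power_mult)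
    also have "\<dots> \<le> (\<phi> (us @ rev us) * \<phi> (rev vs @ vs)) ^ (2 * p) / (W us * W vs)\<^sup>2"
      by (intro divide_right_mono power_mono reflect sub) auto
    also have "\<dots> = R (us @ rev us) * R (rev vs @ vs)"
      by (simp add: R_def Wapp Wrev power_mult_distrib power2_eq_square abs_mult power_even_abs)
    also have "\<dots> \<le> R (us @ rev us) * M"
      by (intro mult_left_mono R_le R_nonneg K1)
    finally have "M \<le> R (us @ rev us)" using Mpos by (simp add: power2_eq_square)
    then show ?thesis using R_le[OF K1(1)] by simp
  qed
  have "M \<le> 1"
  proof (cases "M > 0")
    case True
    \<comment> \<open>A run of length p is enough: it fills the first half of the word, and one more
      reflection makes the whole word constant.\<close>
    have run: "\<exists>x zs. replicate (min (2 ^ j) p) x @ zs \<in> K \<and> R (replicate (min (2 ^ j) p) x @ zs) = M" for j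
    proof (induction j)
      case 0
      have "ys0 \<noteq> []" using ys0 p by (auto simp: K_def)
      then obtain x zs where "ys0 = x # zs" by (cases ys0) auto
      then have "ys0 = replicate (min (2 ^ 0) p) x @ zs" using p by simp
      then show ?case using ys0 by metis
    next
      case (Suc j)
      define n where "n = min (2 ^ j) p"
      obtain x zs where h: "replicate n x @ zs \<in> K" "R (replicate n x @ zs) = M"
        using Suc unfolding n_def by blast
      have np: "n \<le> p" by (simp add: n_def)
      have lz: "length zs = 2 * p - n" using h np by (auto simp: K_def)
      \<comment> \<open>The cut is chosen so that after rotating \<open>z2\<close> to the front the
        run ends exactly in the middle of the word; reflecting the left half then doubles
        it.\<close>
      define z1 z2 where "z1 = take p zs" and "z2 = drop p zs"
      have z: "zs = z1 @ z2" "length z1 = p" "length z2 = p - n"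
        using lz np by (auto simp: z1_def z2_def)
      define us where "us = z2 @ replicate n x"
      have lus: "length us = p" using z np by (simp add: us_def)
      have e: "(replicate n x @ z1) @ z2 \<in> K" "R ((replicate n x @ z1) @ z2) = M"
        using h z by auto
      have "us @ z1 \<in> K" using e by (auto simp: K_def us_def)
      moreover have "R (us @ z1) = M" using e rot[OF e(1)] by (simp add: us_def)
      ultimately have r: "R (us @ rev us) = M" using refl_max[OF _ lus _ True] by blast
      have uK: "us @ rev us \<in> K" using e lus by (auto simp: K_def us_def)
      have eq: "us @ rev us = z2 @ (replicate (2 * n) x @ rev z2)"
        by (simp add: us_def mult_2 replicate_add)
      have r2: "R ((replicate (2 * n) x @ rev z2) @ z2) = M"
        using rot[of z2 "replicate (2 * n) x @ rev z2"] uK r eq by simp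
      have K2: "(replicate (2 * n) x @ rev z2) @ z2 \<in> K" using uK eq by (auto simp: K_def)
      have "min (2 ^ Suc j) p \<le> 2 * n" by (simp add: n_def)
      then have "replicate (2 * n) x = replicate (min (2 ^ Suc j) p) x @ replicate (2 * n - min (2 ^ Suc j) p) x"
        by (simp flip: replicate_add)
      then show ?case using r2 K2 by (metis append.assoc)
    qed
    have "min (2 ^ p) p = p" by (simp add: min_absorb2 less_imp_le)
    then obtain x zs where h: "replicate p x @ zs \<in> K" "R (replicate p x @ zs) = M"
      using run[of p] by auto
    have "R (replicate p x @ rev (replicate p x)) = M" by (rule refl_max[OF h(1) _ h(2) True]) simp
    then have M: "R (replicate (2 * p) x) = M" by (simp add: mult_2 replicate_add)
    have x: "x \<in> set xs" using h p by (auto simp: K_def)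
    have N0: "\<phi> (replicate (2 * p) x) \<ge> 0" using replicate_even_nonneg x L by auto
    have "W (replicate (2 * p) x) = w x ^ (2 * p)" by (simp add: W_def prod_list_replicate)
    moreover have "\<bar>\<phi> (replicate (2 * p) x)\<bar> ^ (2 * p) \<le> w x ^ (2 * p)"
      using N0 \<epsilon> by (intro power_mono) (auto simp: w_def)
    ultimately show ?thesis using M wpos[OF x] by (auto simp: R_def divide_le_eq)
  qed simp
  then have "R xs \<le> 1" using R_le[OF xsK] by simp
  then show ?thesis using Wpos[of xs] by (simp add: R_def W_def w_def[abs_def] divide_le_eq)
qed

lemma holder:
  assumes L: "set xs \<subseteq> L" and len: "length xs = 2 * p" and p: "p \<ge> 1"
  shows "\<bar>\<phi> xs\<bar> ^ (2 * p) \<le> prod_list (map (\<lambda>x. \<phi> (replicate (2 * p) x)) xs)"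
proof -
  have "((\<lambda>\<epsilon>. prod_list (map (\<lambda>x. \<phi> (replicate (2 * p) x) + \<epsilon>) zs)) \<longlongrightarrow>
      prod_list (map (\<lambda>x. \<phi> (replicate (2 * p) x) + 0) zs)) (at_right 0)" for zs
  proof (induction zs)
    case (Cons a zs)
    have "((\<lambda>\<epsilon>. \<phi> (replicate (2 * p) a) + \<epsilon>) \<longlongrightarrow> \<phi> (replicate (2 * p) a) + 0) (at_right 0)"
      by (intro tendsto_intros)
    from tendsto_mult[OF this Cons] show ?case by simp
  qed simp
  then have "((\<lambda>\<epsilon>. prod_list (map (\<lambda>x. \<phi> (replicate (2 * p) x) + \<epsilon>) xs)) \<longlongrightarrow>
      prod_list (map (\<lambda>x. \<phi> (replicate (2 * p) x)) xs)) (at_right 0)" by simp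
  moreover have "\<forall>\<^sub>F \<epsilon> in at_right 0. \<bar>\<phi> xs\<bar> ^ (2 * p) \<le> prod_list (map (\<lambda>x. \<phi> (replicate (2 * p) x) + \<epsilon>) xs)"
    using holder_aux[OF assms] by (auto simp: eventually_at_right_less eventually_at_filter)
  ultimately show ?thesis by (intro tendsto_lowerbound) auto
qed

text \<open>Here \<open>b x\<close> bounds the Schatten norm of order 2p of the letter
  \<open>x\<close>. After taking the root a word is bounded by a product over its letters, and such
  products can be summed over all words.\<close>

lemma holder_bound:
  assumes L: "set xs \<subseteq> L" and len: "length xs = 2 * p" and p: "p \<ge> 1"
    and b: "\<And>x. x \<in> set xs \<Longrightarrow> b x \<ge> 0 \<and> \<phi> (replicate (2 * p) x) \<le> b x ^ (2 * p)"
  shows "\<bar>\<phi> xs\<bar> \<le> prod_list (map b xs)"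
proof -
  have *: "prod_list (map (\<lambda>x. \<phi> (replicate (2 * p) x)) zs) \<le> prod_list (map b zs) ^ (2 * p)
     \<and> prod_list (map b zs) \<ge> 0 \<and> prod_list (map (\<lambda>x. \<phi> (replicate (2 * p) x)) zs) \<ge> 0"
    if "set zs \<subseteq> set xs" for zs
    using that
  proof (induction zs)
    case (Cons z zs)
    then have "z \<in> L" using L by auto
    then have "\<phi> (replicate (2 * p) z) \<ge> 0" by (rule replicate_even_nonneg)
    then show ?case using Cons b[of z] by (auto simp: power_mult_distrib intro!: mult_mono)
  qed simp
  have "\<bar>\<phi> xs\<bar> ^ (2 * p) \<le> prod_list (map b xs) ^ (2 * p)"
    using holder[OF L len p] *[of xs] by simp
  then show ?thesis using *[of xs] p by (simp add: power_mono_iff)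
qed

end

section \<open>Expected traces of words of random matrices\<close>

definition avg :: "'w set \<Rightarrow> ('w \<Rightarrow> real) \<Rightarrow> real" where
  "avg \<Omega> f = (\<Sum>\<omega>\<in>\<Omega>. f \<omega>) / real (card \<Omega>)"

definition etr :: "'w set \<Rightarrow> nat \<Rightarrow> ('w \<Rightarrow> rmat) list \<Rightarrow> real" where
  "etr \<Omega> d As = avg \<Omega> (\<lambda>\<omega>. trw d (map (\<lambda>A. A \<omega>) As))"

text \<open>The expected trace of a concatenation is, up to the factor 1/card \<Omega>, the inner
  product of the entries of the two halves, indexed jointly by outcome, row and column;
  \<open>reflect\<close> is Cauchy-Schwarz for this inner product.\<close>

lemma word_trace_etr:
  "word_trace (etr \<Omega> d) {A. \<forall>\<omega>\<in>\<Omega>. symm (A \<omega>)}"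
proof
  fix xs ys :: "('a \<Rightarrow> rmat) list"
  show "etr \<Omega> d (xs @ ys) = etr \<Omega> d (ys @ xs)"
    by (simp add: etr_def trw_append_commute)
  assume xs: "set xs \<subseteq> {A. \<forall>\<omega>\<in>\<Omega>. symm (A \<omega>)}" 
  have 1: "etr \<Omega> d (xs @ rev xs) = (\<Sum>\<omega>\<in>\<Omega>. \<Sum>i<d. \<Sum>l<d. (mprod d (map (\<lambda>A. A \<omega>) xs) i l)\<^sup>2) / real (card \<Omega>)"
    unfolding etr_def avg_def using xs
    by (intro arg_cong2[of _ _ _ _ "(/)"] sum.cong refl) (simp only: map_append rev_map[symmetric], subst trw_palindrome, auto)
  show "etr \<Omega> d (xs @ rev xs) \<ge> 0" unfolding 1 by (intro divide_nonneg_nonneg sum_nonneg) auto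
  assume ys: "set ys \<subseteq> {A. \<forall>\<omega>\<in>\<Omega>. symm (A \<omega>)}" 
  have 2: "etr \<Omega> d (rev ys @ ys) = (\<Sum>\<omega>\<in>\<Omega>. \<Sum>i<d. \<Sum>l<d. (mprod d (map (\<lambda>A. A \<omega>) ys) l i)\<^sup>2) / real (card \<Omega>)"
  proof -
    have "trw d (map (\<lambda>A. A \<omega>) (rev ys @ ys)) = (\<Sum>i<d. \<Sum>l<d. (mprod d (map (\<lambda>A. A \<omega>) ys) l i)\<^sup>2)" if "\<omega> \<in> \<Omega>" for \<omega>
    proof -
      have "trw d (map (\<lambda>A. A \<omega>) (rev ys @ ys)) = trw d (map (\<lambda>A. A \<omega>) ys @ rev (map (\<lambda>A. A \<omega>) ys))"
        by (simp add: trw_append_commute rev_map)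
      also have "\<dots> = (\<Sum>i<d. \<Sum>l<d. (mprod d (map (\<lambda>A. A \<omega>) ys) i l)\<^sup>2)"
        using ys that by (intro trw_palindrome) auto
      finally show ?thesis by (subst (asm) sum.swap)
    qed
    then show ?thesis by (simp add: etr_def avg_def)
  qed
  define S where "S = \<Omega> \<times> {..<d} \<times> {..<d}"
  define a where "a = (\<lambda>(\<omega>, i, l). mprod d (map (\<lambda>A. A \<omega>) xs) i l)"
  define b where "b = (\<lambda>(\<omega>, i, l). mprod d (map (\<lambda>A. A \<omega>) ys) l i)"
  have 3: "etr \<Omega> d (xs @ ys) = (\<Sum>s\<in>S. a s * b s) / real (card \<Omega>)"
    by (simp add: etr_def avg_def trw_append S_def a_def b_def sum.cartesian_product split_def)
  have 4: "etr \<Omega> d (xs @ rev xs) = (\<Sum>s\<in>S. (a s)\<^sup>2) / real (card \<Omega>)"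
    by (simp add: 1 S_def a_def sum.cartesian_product split_def)
  have 5: "etr \<Omega> d (rev ys @ ys) = (\<Sum>s\<in>S. (b s)\<^sup>2) / real (card \<Omega>)"
    by (simp add: 2 S_def b_def sum.cartesian_product split_def)
  have "(\<Sum>s\<in>S. a s * b s)\<^sup>2 \<le> (\<Sum>s\<in>S. (a s)\<^sup>2) * (\<Sum>s\<in>S. (b s)\<^sup>2)"
    by (rule Cauchy_Schwarz_ineq_sum)
  then show "(etr \<Omega> d (xs @ ys))\<^sup>2 \<le> etr \<Omega> d (xs @ rev xs) * etr \<Omega> d (rev ys @ ys)"
    unfolding 3 4 5 by (simp add: power_divide power2_eq_square divide_right_mono)
qed

section \<open>The sample space and Wick's inequality for signs\<close>

type_synonym outcome = "(nat \<Rightarrow> nat \<Rightarrow> nat) \<times> (nat \<Rightarrow> rmat)"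

definition perms :: "nat \<Rightarrow> (nat \<Rightarrow> nat) set" where
  "perms d = {\<pi>. \<pi> permutes {..<d}}"

definition sign_matrices :: "nat \<Rightarrow> rmat set" where
  "sign_matrices d = ({..<d} \<rightarrow>\<^sub>E ({..<d} \<rightarrow>\<^sub>E {-1, 1}))"

text \<open>
  The permutations and the signs live on one finite uniform space; component \<open>i\<close> of each is the
  randomness of slot \<open>i\<close>.
\<close>
definition sample_space :: "nat \<Rightarrow> nat \<Rightarrow> outcome set" where
  "sample_space d k = ({1..k} \<rightarrow>\<^sub>E perms d) \<times> ({1..k} \<rightarrow>\<^sub>E sign_matrices d)"

lemma avg_cong: "(\<And>\<omega>. \<omega> \<in> \<Omega> \<Longrightarrow> f \<omega> = g \<omega>) \<Longrightarrow> avg \<Omega> f = avg \<Omega> g"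
  by (simp add: avg_def)

lemma avg_mono: "(\<And>\<omega>. \<omega> \<in> \<Omega> \<Longrightarrow> f \<omega> \<le> g \<omega>) \<Longrightarrow> avg \<Omega> f \<le> avg \<Omega> g"
  by (simp add: avg_def divide_right_mono sum_mono)

lemma avg_nonneg: "(\<And>\<omega>. \<omega> \<in> \<Omega> \<Longrightarrow> f \<omega> \<ge> 0) \<Longrightarrow> avg \<Omega> f \<ge> 0"
  by (simp add: avg_def sum_nonneg)

lemma avg_add: "avg \<Omega> (\<lambda>\<omega>. f \<omega> + g \<omega>) = avg \<Omega> f + avg \<Omega> g"
  by (simp add: avg_def sum.distrib add_divide_distrib)

lemma avg_diff: "avg \<Omega> (\<lambda>\<omega>. f \<omega> - g \<omega>) = avg \<Omega> f - avg \<Omega> g"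
  by (simp add: avg_def sum_subtractf diff_divide_distrib)

lemma avg_minus: "avg \<Omega> (\<lambda>\<omega>. - f \<omega>) = - avg \<Omega> f"
  by (simp add: avg_def sum_negf)

lemma avg_cmult: "avg \<Omega> (\<lambda>\<omega>. c * f \<omega>) = c * avg \<Omega> f"
  by (simp add: avg_def sum_distrib_left)

lemma avg_sum: "avg \<Omega> (\<lambda>\<omega>. \<Sum>x\<in>A. f x \<omega>) = (\<Sum>x\<in>A. avg \<Omega> (f x))"
  unfolding avg_def by (subst sum.swap) (simp add: sum_divide_distrib)

lemma avg_const: "finite \<Omega> \<Longrightarrow> \<Omega> \<noteq> {} \<Longrightarrow> avg \<Omega> (\<lambda>_. c) = c"
  by (simp add: avg_def)

text \<open>Distributional symmetries enter only as involutions of the sample space: flipping one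
  sign, or composing one permutation with a transposition. They take the place of independence
  arguments.\<close>

lemma avg_involution:
  assumes "\<And>\<omega>. \<omega> \<in> \<Omega> \<Longrightarrow> f \<omega> \<in> \<Omega>" "\<And>\<omega>. \<omega> \<in> \<Omega> \<Longrightarrow> f (f \<omega>) = \<omega>"
  shows "avg \<Omega> (\<lambda>\<omega>. g (f \<omega>)) = avg \<Omega> g"
  unfolding avg_def using assms
  by (intro arg_cong2[of _ _ _ _ "(/)"] sum.reindex_bij_witness[of _ f f]) auto

lemma sample_space_finite: "finite (sample_space d k)"
  unfolding sample_space_def perms_def sign_matrices_def
  by (intro finite_cartesian_product finite_PiE) (auto intro: finite_permutations)

lemma sample_space_nonempty: "sample_space d k \<noteq> {}"
proof -
  have "id \<in> perms d" by (simp add: perms_def permutes_id)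
  then show ?thesis by (auto simp: sample_space_def sign_matrices_def PiE_eq_empty_iff)
qed

type_synonym sign_var = "nat \<times> nat \<times> nat"

definition sign_vars :: "nat \<Rightarrow> nat \<Rightarrow> sign_var set" where
  "sign_vars d k = {1..k} \<times> {..<d} \<times> {..<d}"

fun sgv :: "sign_var \<Rightarrow> outcome \<Rightarrow> real" where
  "sgv (i, a, b) \<omega> = snd \<omega> i a b"

fun flip :: "sign_var \<Rightarrow> outcome \<Rightarrow> outcome" where
  "flip (i, a, b) (\<pi>, \<epsilon>) = (\<pi>, \<epsilon>(i := (\<epsilon> i)(a := (\<epsilon> i a)(b := - \<epsilon> i a b))))"

lemma flip_flip: "flip v (flip v \<omega>) = \<omega>"
  by (cases v; cases \<omega>) (auto simp: fun_eq_iff)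

lemma flip_in_space:
  assumes "v \<in> sign_vars d k" "\<omega> \<in> sample_space d k"
  shows "flip v \<omega> \<in> sample_space d k"
proof -
  obtain i a b where v: "v = (i, a, b)" by (cases v)
  obtain \<pi> \<epsilon> where w: "\<omega> = (\<pi>, \<epsilon>)" by (cases \<omega>)
  have iab: "i \<in> {1..k}" "a \<in> {..<d}" "b \<in> {..<d}" using assms v by (auto simp: sign_vars_def)
  have \<epsilon>: "\<epsilon> \<in> {1..k} \<rightarrow>\<^sub>E sign_matrices d" using assms w by (simp add: sample_space_def)
  have \<epsilon>i: "\<epsilon> i \<in> {..<d} \<rightarrow>\<^sub>E ({..<d} \<rightarrow>\<^sub>E {-1, 1})" using PiE_mem[OF \<epsilon> iab(1)] by (simp add: sign_matrices_def)
  have \<epsilon>ia: "\<epsilon> i a \<in> {..<d} \<rightarrow>\<^sub>E {-1, 1}" using \<epsilon>i iab by auto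
  have "\<epsilon> i a b \<in> {-1, 1}" using \<epsilon>ia iab(3) by (rule PiE_mem)
  then have "- \<epsilon> i a b \<in> {-1, 1}" by auto
  then have "(\<epsilon> i a)(b := - \<epsilon> i a b) \<in> {..<d} \<rightarrow>\<^sub>E {-1, 1}"
    using \<epsilon>ia iab by (auto simp: PiE_iff extensional_def)
  then have "(\<epsilon> i)(a := (\<epsilon> i a)(b := - \<epsilon> i a b)) \<in> sign_matrices d"
    using \<epsilon>i iab unfolding sign_matrices_def by (auto simp: PiE_iff extensional_def)
  then show ?thesis using \<epsilon> iab assms unfolding v w sample_space_def
    by (auto simp: PiE_iff extensional_def)
qed

lemma avg_flip:
  assumes "v \<in> sign_vars d k"
  shows "avg (sample_space d k) (\<lambda>\<omega>. g (flip v \<omega>)) = avg (sample_space d k) g"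
  by (rule avg_involution) (use assms in \<open>auto simp: flip_in_space flip_flip\<close>)

lemma sgv_flip: "sgv u (flip v \<omega>) = (if u = v then - sgv u \<omega> else sgv u \<omega>)"
  by (cases u; cases v; cases \<omega>) auto

lemma sgv_square:
  assumes "v \<in> sign_vars d k" "\<omega> \<in> sample_space d k"
  shows "sgv v \<omega> * sgv v \<omega> = 1"
proof -
  obtain i a b where v: "v = (i, a, b)" by (cases v)
  have iab: "i \<in> {1..k}" "a \<in> {..<d}" "b \<in> {..<d}" using assms v by (auto simp: sign_vars_def)
  have "snd \<omega> \<in> {1..k} \<rightarrow>\<^sub>E sign_matrices d" using assms by (auto simp: sample_space_def)
  then have "snd \<omega> i \<in> {..<d} \<rightarrow>\<^sub>E ({..<d} \<rightarrow>\<^sub>E {-1, 1})"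
    using PiE_mem[OF _ iab(1), of "snd \<omega>" "\<lambda>_. sign_matrices d"] unfolding sign_matrices_def by blast
  then have "snd \<omega> i a \<in> {..<d} \<rightarrow>\<^sub>E {-1, 1}" using iab by auto
  then have "snd \<omega> i a b \<in> {-1, 1}" using iab(3) by (rule PiE_mem)
  then show ?thesis by (auto simp: v)
qed

section \<open>Monomials and linear forms in the signs\<close>

definition smon :: "sign_var list \<Rightarrow> outcome \<Rightarrow> real" where
  "smon w \<omega> = prod_list (map (\<lambda>v. sgv v \<omega>) w)"

lemma smon_simps [simp]: "smon [] \<omega> = 1" "smon (v # w) \<omega> = sgv v \<omega> * smon w \<omega>"
  "smon (w1 @ w2) \<omega> = smon w1 \<omega> * smon w2 \<omega>"
  by (simp_all add: smon_def)

text \<open>The derivative is formal: it has one term per occurrence of \<open>v\<close>, without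
  first reducing squares of signs to 1. The resulting surplus of terms is what turns integration by
  parts into an inequality.\<close>

fun smon_deriv :: "sign_var \<Rightarrow> sign_var list \<Rightarrow> outcome \<Rightarrow> real" where
  "smon_deriv v [] \<omega> = 0"
| "smon_deriv v (u # w) \<omega> = (if u = v then smon w \<omega> else 0) + sgv u \<omega> * smon_deriv v w \<omega>"

text \<open>Linear forms are used because an entry of the symmetrised sign matrix is a sum of two
  signs for each slot.\<close>

definition form_val :: "sign_var set \<Rightarrow> (sign_var \<Rightarrow> real) \<Rightarrow> outcome \<Rightarrow> real" where
  "form_val V \<alpha> \<omega> = (\<Sum>v\<in>V. \<alpha> v * sgv v \<omega>)"

fun form_prod :: "sign_var set \<Rightarrow> (sign_var \<Rightarrow> real) list \<Rightarrow> outcome \<Rightarrow> real" where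
  "form_prod V [] \<omega> = 1"
| "form_prod V (\<alpha> # fs) \<omega> = form_val V \<alpha> \<omega> * form_prod V fs \<omega>"

fun form_deriv :: "sign_var set \<Rightarrow> sign_var \<Rightarrow> (sign_var \<Rightarrow> real) list \<Rightarrow> outcome \<Rightarrow> real" where
  "form_deriv V v [] \<omega> = 0"
| "form_deriv V v (\<alpha> # fs) \<omega> = \<alpha> v * form_prod V fs \<omega> + form_val V \<alpha> \<omega> * form_deriv V v fs \<omega>"

context
  fixes d k :: nat
begin

abbreviation "E \<equiv> avg (sample_space d k)"
abbreviation "V \<equiv> sign_vars d k"

lemma finite_V: "finite V" by (simp add: sign_vars_def)

lemma E_smon_notin:
  assumes "v \<in> V" "v \<notin> set w"
  shows "E (\<lambda>\<omega>. sgv v \<omega> * smon w \<omega>) = 0"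
proof -
  have "smon w (flip v \<omega>) = smon w \<omega>" for \<omega> :: "outcome"
    using assms(2) by (induction w) (auto simp: sgv_flip)
  then have "E (\<lambda>\<omega>. sgv v \<omega> * smon w \<omega>) = E (\<lambda>\<omega>. - (sgv v \<omega> * smon w \<omega>))"
    by (subst avg_flip[OF assms(1), symmetric]) (simp add: sgv_flip)
  then show ?thesis by (simp add: avg_minus)
qed

lemma E_smon_in:
  assumes "v \<in> V"
  shows "E (\<lambda>\<omega>. sgv v \<omega> * smon (w1 @ v # w2) \<omega>) = E (smon (w1 @ w2))"
proof (rule avg_cong)
  fix \<omega> assume "\<omega> \<in> sample_space d k"
  from sgv_square[OF assms this]
  show "sgv v \<omega> * smon (w1 @ v # w2) \<omega> = smon (w1 @ w2) \<omega>" by (simp add: algebra_simps)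
qed

text \<open>Equal signs cancel in pairs, and a sign that occurs only once makes the mean vanish; so
  the mean is 0 or 1.\<close>

lemma E_smon_nonneg: "set w \<subseteq> V \<Longrightarrow> E (smon w) \<ge> 0"
proof (induction w rule: length_induct)
  case (1 w)
  show ?case
  proof (cases w)
    case (Cons v w')
    then have v: "v \<in> V" using 1 by auto
    show ?thesis
    proof (cases "v \<in> set w'")
      case True
      then obtain w1 w2 where w': "w' = w1 @ v # w2" by (meson split_list)
      have "smon w = (\<lambda>\<omega>. sgv v \<omega> * smon (w1 @ v # w2) \<omega>)" by (simp add: Cons w' smon_def fun_eq_iff)
      then have "E (smon w) = E (smon (w1 @ w2))" using E_smon_in[OF v, of w1 w2] by (simp only:)
      also have "\<dots> \<ge> 0" by (rule 1(1)[rule_format]) (use 1(2) Cons w' in auto)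
      finally show ?thesis .
    next
      case False
      then show ?thesis using E_smon_notin[OF v, of w'] Cons by (simp add: smon_def)
    qed
  qed (simp add: smon_def avg_nonneg)
qed

lemma smon_deriv_append:
  "smon_deriv v (w1 @ w2) \<omega> = smon_deriv v w1 \<omega> * smon w2 \<omega> + smon w1 \<omega> * smon_deriv v w2 \<omega>"
  by (induction w1) (auto simp: algebra_simps)

lemma E_smon_deriv_nonneg:
  "set x \<subseteq> V \<Longrightarrow> set w \<subseteq> V \<Longrightarrow> E (\<lambda>\<omega>. smon x \<omega> * smon_deriv v w \<omega>) \<ge> 0"
proof (induction w arbitrary: x)
  case (Cons u w)
  have "E (\<lambda>\<omega>. smon x \<omega> * smon_deriv v (u # w) \<omega>)
      = (if u = v then E (smon (x @ w)) else 0) + E (\<lambda>\<omega>. smon (x @ [u]) \<omega> * smon_deriv v w \<omega>)"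
    by (auto simp: avg_add[symmetric] algebra_simps intro!: avg_cong)
  then show ?case using Cons.IH[of "x @ [u]"] Cons.prems E_smon_nonneg[of "x @ w"] by auto
qed (simp add: avg_nonneg)

lemma smon_deriv_notin: "v \<notin> set w \<Longrightarrow> smon_deriv v w \<omega> = 0"
  by (induction w) auto

text \<open>If \<open>v\<close> occurs in \<open>w\<close>, the square of a sign being 1 makes the
  left side equal to a single term of the derivative; the other terms have nonnegative mean. If
  \<open>v\<close> does not occur, both sides vanish.\<close>

lemma smon_wick:
  assumes "v \<in> V" "set w \<subseteq> V"
  shows "E (\<lambda>\<omega>. sgv v \<omega> * smon w \<omega>) \<le> E (smon_deriv v w)"
proof (cases "v \<in> set w")
  case True
  then obtain w1 w2 where w: "w = w1 @ v # w2" by (meson split_list)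
  have "E (smon_deriv v w) = E (\<lambda>\<omega>. smon (v # w2) \<omega> * smon_deriv v w1 \<omega>) + E (smon (w1 @ w2))
      + E (\<lambda>\<omega>. smon (w1 @ [v]) \<omega> * smon_deriv v w2 \<omega>)"
    by (auto simp: w smon_deriv_append avg_add[symmetric] algebra_simps intro!: avg_cong)
  moreover have "E (\<lambda>\<omega>. smon (v # w2) \<omega> * smon_deriv v w1 \<omega>) \<ge> 0"
    by (rule E_smon_deriv_nonneg) (use assms w in auto)
  moreover have "E (\<lambda>\<omega>. smon (w1 @ [v]) \<omega> * smon_deriv v w2 \<omega>) \<ge> 0"
    by (rule E_smon_deriv_nonneg) (use assms w in auto)
  ultimately show ?thesis using E_smon_in[OF assms(1), of w1 w2] w by simp
next
  case False
  then show ?thesis using E_smon_notin[OF assms(1) False] by (simp add: smon_deriv_notin avg_nonneg)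
qed

text \<open>One linear form at a time is expanded into signs. The monomial \<open>w\<close> collects
  the signs already expanded, so the induction ends at the inequality for monomials.\<close>

lemma form_wick_aux:
  assumes "v \<in> V" "set w \<subseteq> V" "\<And>\<alpha> u. \<alpha> \<in> set fs \<Longrightarrow> u \<in> V \<Longrightarrow> \<alpha> u \<ge> 0"
  shows "E (\<lambda>\<omega>. sgv v \<omega> * form_prod V fs \<omega> * smon w \<omega>)
     \<le> E (\<lambda>\<omega>. form_deriv V v fs \<omega> * smon w \<omega> + form_prod V fs \<omega> * smon_deriv v w \<omega>)"
  using assms
proof (induction fs arbitrary: w)
  case Nil
  then show ?case using smon_wick by simp
next
  case (Cons \<alpha> fs)
  have "E (\<lambda>\<omega>. sgv v \<omega> * form_prod V (\<alpha> # fs) \<omega> * smon w \<omega>)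
     = (\<Sum>u\<in>V. \<alpha> u * E (\<lambda>\<omega>. sgv v \<omega> * form_prod V fs \<omega> * smon (u # w) \<omega>))"
    unfolding avg_cmult[symmetric] avg_sum[symmetric]
    by (rule avg_cong) (simp add: form_val_def sum_distrib_left sum_distrib_right algebra_simps)
  also have "\<dots> \<le> (\<Sum>u\<in>V. \<alpha> u * E (\<lambda>\<omega>. form_deriv V v fs \<omega> * smon (u # w) \<omega>
        + form_prod V fs \<omega> * smon_deriv v (u # w) \<omega>))"
    using Cons by (intro sum_mono mult_left_mono Cons.IH) auto
  also have "\<dots> = E (\<lambda>\<omega>. form_deriv V v (\<alpha> # fs) \<omega> * smon w \<omega> + form_prod V (\<alpha> # fs) \<omega> * smon_deriv v w \<omega>)"
    unfolding avg_cmult[symmetric] avg_sum[symmetric]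
  proof (rule avg_cong)
    fix \<omega> :: "outcome"
    have 1: "(\<Sum>u\<in>V. \<alpha> u * (form_prod V fs \<omega> * (if u = v then smon w \<omega> else 0)))
        = (\<Sum>u\<in>V. if u = v then \<alpha> u * form_prod V fs \<omega> * smon w \<omega> else 0)"
      by (rule sum.cong) auto
    have "(\<Sum>u\<in>V. \<alpha> u * (form_deriv V v fs \<omega> * smon (u # w) \<omega> + form_prod V fs \<omega> * smon_deriv v (u # w) \<omega>))
      = (\<Sum>u\<in>V. (\<alpha> u * sgv u \<omega>) * (form_deriv V v fs \<omega> * smon w \<omega> + form_prod V fs \<omega> * smon_deriv v w \<omega>)
          + \<alpha> u * (form_prod V fs \<omega> * (if u = v then smon w \<omega> else 0)))"
      by (rule sum.cong) (auto simp: algebra_simps)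
    also have "\<dots> = form_val V \<alpha> \<omega> * (form_deriv V v fs \<omega> * smon w \<omega> + form_prod V fs \<omega> * smon_deriv v w \<omega>)
          + \<alpha> v * form_prod V fs \<omega> * smon w \<omega>"
      unfolding sum.distrib 1 using Cons.prems(1) by (simp add: form_val_def sum_distrib_right finite_V)
    finally show "(\<Sum>u\<in>V. \<alpha> u * (form_deriv V v fs \<omega> * smon (u # w) \<omega> + form_prod V fs \<omega> * smon_deriv v (u # w) \<omega>))
      = form_deriv V v (\<alpha> # fs) \<omega> * smon w \<omega> + form_prod V (\<alpha> # fs) \<omega> * smon_deriv v w \<omega>"
      by (simp add: algebra_simps)
  qed
  finally show ?case .
qed

text \<open>
  Gaussian integration by parts becomes an inequality for signs, valid because all coefficients
  are nonnegative.
\<close>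
lemma form_wick:
  assumes "v \<in> V" "\<And>\<alpha> u. \<alpha> \<in> set fs \<Longrightarrow> u \<in> V \<Longrightarrow> \<alpha> u \<ge> 0"
  shows "E (\<lambda>\<omega>. sgv v \<omega> * form_prod V fs \<omega>) \<le> E (form_deriv V v fs)"
  using form_wick_aux[of v "[]" fs] assms by simp

end

section \<open>Recursion for mixed moments of traces\<close>

text \<open>The coefficients of an entry of \<open>sign_sum I\<close> as a linear form in the signs.
  On the diagonal both terms apply, giving the coefficient 2.\<close>

definition entry_form :: "nat set \<Rightarrow> nat \<Rightarrow> nat \<Rightarrow> sign_var \<Rightarrow> real" where
  "entry_form I a b = (\<lambda>(i, x, y). if i \<in> I then of_bool (a = x \<and> b = y) + of_bool (b = x \<and> a = y) else 0)"

definition sign_sum :: "nat set \<Rightarrow> outcome \<Rightarrow> rmat" where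
  "sign_sum I \<omega> a b = (\<Sum>i\<in>I. snd \<omega> i a b + snd \<omega> i b a)"

lemma symm_sign_sum: "symm (sign_sum I \<omega>)"
  by (simp add: symm_def sign_sum_def add.commute)

fun mon :: "(nat \<times> nat) list \<Rightarrow> rmat \<Rightarrow> real" where
  "mon [] H = 1"
| "mon ((c, e) # es) H = H c e * mon es H"

fun mon_deriv :: "nat \<Rightarrow> nat \<Rightarrow> (nat \<times> nat) list \<Rightarrow> rmat \<Rightarrow> real" where
  "mon_deriv a b [] H = 0"
| "mon_deriv a b ((c, e) # es) H =
     (of_bool (c = a \<and> e = b) + of_bool (c = b \<and> e = a)) * mon es H + H c e * mon_deriv a b es H"

context
  fixes d k :: nat and I :: "nat set"
  assumes I: "I \<subseteq> {1..k}"
begin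

lemma sum_entry_form:
  assumes "a < d" "b < d"
  shows "(\<Sum>v\<in>sign_vars d k. entry_form I a b v * f v) = (\<Sum>i\<in>I. f (i, a, b) + f (i, b, a))"
proof -
  have "(\<Sum>v\<in>sign_vars d k. entry_form I a b v * f v)
      = (\<Sum>i\<in>{1..k}. \<Sum>x<d. \<Sum>y<d. entry_form I a b (i, x, y) * f (i, x, y))"
    unfolding sign_vars_def by (simp add: sum.cartesian_product split_def)
  also have "\<dots> = (\<Sum>i\<in>{1..k}. if i \<in> I then f (i, a, b) + f (i, b, a) else 0)"
  proof (rule sum.cong)
    fix i
    have 1: "(\<Sum>x<d. \<Sum>y<d. of_bool (s = x \<and> t = y) * f (i, x, y)) = f (i, s, t)" if "s < d" "t < d" for s t
    proof -
      have "(\<Sum>x<d. \<Sum>y<d. of_bool (s = x \<and> t = y) * f (i, x, y))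
         = (\<Sum>x<d. if x = s then (\<Sum>y<d. if y = t then f (i, x, y) else 0) else 0)"
        by (intro sum.cong refl) (auto intro!: sum.cong)
      then show ?thesis using that by simp
    qed
    show "(\<Sum>x<d. \<Sum>y<d. entry_form I a b (i, x, y) * f (i, x, y)) = (if i \<in> I then f (i, a, b) + f (i, b, a) else 0)"
      using 1[of a b] 1[of b a] assms by (auto simp: entry_form_def distrib_right sum.distrib)
  qed simp
  also have "\<dots> = (\<Sum>i\<in>I. f (i, a, b) + f (i, b, a))"
    using I by (simp add: sum.If_cases Int_absorb1)
  finally show ?thesis .
qed

lemma form_val_entry:
  "a < d \<Longrightarrow> b < d \<Longrightarrow> form_val (sign_vars d k) (entry_form I a b) \<omega> = sign_sum I \<omega> a b"
  unfolding form_val_def by (simp add: sum_entry_form sign_sum_def)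

lemma form_prod_entries:
  "\<forall>(c, e)\<in>set es. c < d \<and> e < d \<Longrightarrow>
   form_prod (sign_vars d k) (map (\<lambda>(c, e). entry_form I c e) es) \<omega> = mon es (sign_sum I \<omega>)"
  by (induction es) (auto simp: form_val_entry)

lemma sum_form_deriv:
  assumes "a < d" "b < d" "\<forall>(c, e)\<in>set es. c < d \<and> e < d"
  shows "(\<Sum>v\<in>sign_vars d k. entry_form I a b v * form_deriv (sign_vars d k) v (map (\<lambda>(c, e). entry_form I c e) es) \<omega>)
     = 2 * real (card I) * mon_deriv a b es (sign_sum I \<omega>)"
  using assms(3)
proof (induction es)
  case (Cons ce es)
  obtain c e where ce: "ce = (c, e)" by (cases ce)
  have "(\<Sum>v\<in>sign_vars d k. entry_form I a b v * entry_form I c e v)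
       = 2 * real (card I) * (of_bool (c = a \<and> e = b) + of_bool (c = b \<and> e = a))"
  proof -
    let ?X = "of_bool (c = a \<and> e = b) + of_bool (c = b \<and> e = a) :: real"
    have "entry_form I c e (i, a, b) = ?X" "entry_form I c e (i, b, a) = ?X" if "i \<in> I" for i
      unfolding entry_form_def using that by (simp_all add: conj_commute)
    then have "(\<Sum>i\<in>I. entry_form I c e (i, a, b) + entry_form I c e (i, b, a)) = (\<Sum>i\<in>I. 2 * ?X)"
      by (intro sum.cong refl) (simp only: mult_2)
    then show ?thesis by (simp only: sum_entry_form[OF assms(1,2)] sum_constant)
  qed
  note 1 = this
  let ?D = "\<lambda>v. form_deriv (sign_vars d k) v (map (\<lambda>(c, e). entry_form I c e) es) \<omega>"
  have ih: "(\<Sum>v\<in>sign_vars d k. entry_form I a b v * ?D v) = 2 * real (card I) * mon_deriv a b es (sign_sum I \<omega>)"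
    using Cons by auto
  have m: "form_prod (sign_vars d k) (map (\<lambda>(c, e). entry_form I c e) es) \<omega> = mon es (sign_sum I \<omega>)"
    using Cons.prems by (intro form_prod_entries) auto
  have v: "form_val (sign_vars d k) (entry_form I c e) \<omega> = sign_sum I \<omega> c e"
    using Cons.prems ce by (intro form_val_entry) auto
  have "(\<Sum>v\<in>sign_vars d k. entry_form I a b v * form_deriv (sign_vars d k) v (map (\<lambda>(c, e). entry_form I c e) (ce # es)) \<omega>)
     = (\<Sum>v\<in>sign_vars d k. entry_form I a b v * entry_form I c e v) * mon es (sign_sum I \<omega>)
       + sign_sum I \<omega> c e * (\<Sum>v\<in>sign_vars d k. entry_form I a b v * ?D v)"
    by (simp add: ce m v distrib_left sum.distrib sum_distrib_left sum_distrib_right mult_ac)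
  then show ?case unfolding 1 ih by (simp add: ce distrib_left mult_ac)
qed simp

text \<open>The entries have the covariance of the Gaussian orthogonal ensemble, 2 card I times a
  sum of two Kronecker products, with doubled variance on the diagonal. \<open>mon_deriv\<close>
  contains the two Kronecker products, and the remaining factor is 2 card I.\<close>

lemma mon_wick:
  assumes "a < d" "b < d" "\<forall>(c, e)\<in>set es. c < d \<and> e < d"
  shows "E d k (\<lambda>\<omega>. sign_sum I \<omega> a b * mon es (sign_sum I \<omega>))
     \<le> 2 * real (card I) * E d k (\<lambda>\<omega>. mon_deriv a b es (sign_sum I \<omega>))"
proof -
  let ?V = "sign_vars d k"
  let ?fs = "map (\<lambda>(c, e). entry_form I c e) es"
  have "E d k (\<lambda>\<omega>. sign_sum I \<omega> a b * mon es (sign_sum I \<omega>))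
     = (\<Sum>v\<in>?V. entry_form I a b v * E d k (\<lambda>\<omega>. sgv v \<omega> * form_prod ?V ?fs \<omega>))"
    unfolding avg_cmult[symmetric] avg_sum[symmetric] form_prod_entries[OF assms(3)]
    by (rule avg_cong) (simp add: form_val_entry[symmetric] assms form_val_def sum_distrib_right mult.assoc)
  also have "\<dots> \<le> (\<Sum>v\<in>?V. entry_form I a b v * E d k (form_deriv ?V v ?fs))"
    by (intro sum_mono mult_left_mono form_wick) (auto simp: entry_form_def)
  also have "\<dots> = 2 * real (card I) * E d k (\<lambda>\<omega>. mon_deriv a b es (sign_sum I \<omega>))"
    unfolding avg_cmult[symmetric] avg_sum[symmetric]
    by (simp add: sum_form_deriv[OF assms])
  finally show ?thesis .
qed

end

text \<open>
  \<open>\<Phi>\<close> is a polynomial in the entries with nonnegative coefficients, and \<open>D a b\<close> is its formal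
  derivative in the direction of the symmetric matrix with ones at \<open>(a, b)\<close> and \<open>(b, a)\<close>.
\<close>
definition pos_poly :: "nat \<Rightarrow> (rmat \<Rightarrow> real) \<Rightarrow> (nat \<Rightarrow> nat \<Rightarrow> rmat \<Rightarrow> real) \<Rightarrow> bool" where
  "pos_poly d \<Phi> D \<longleftrightarrow> (\<exists>ms. (\<forall>m\<in>set ms. \<forall>(c, e)\<in>set m. c < d \<and> e < d) \<and>
     (\<forall>H. \<Phi> H = (\<Sum>m\<leftarrow>ms. mon m H)) \<and> (\<forall>a b H. D a b H = (\<Sum>m\<leftarrow>ms. mon_deriv a b m H)))"

lemma avg_sum_list: "avg \<Omega> (\<lambda>\<omega>. \<Sum>m\<leftarrow>ms. f m \<omega>) = (\<Sum>m\<leftarrow>ms. avg \<Omega> (f m))"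
  by (induction ms) (auto simp: avg_add, simp add: avg_def)

lemma pos_poly_wick:
  assumes "pos_poly d \<Phi> D" "a < d" "b < d" "I \<subseteq> {1..k}"
  shows "E d k (\<lambda>\<omega>. sign_sum I \<omega> a b * \<Phi> (sign_sum I \<omega>)) \<le> 2 * real (card I) * E d k (\<lambda>\<omega>. D a b (sign_sum I \<omega>))"
proof -
  obtain ms where ms: "\<forall>m\<in>set ms. \<forall>(c, e)\<in>set m. c < d \<and> e < d"
     "\<And>H. \<Phi> H = (\<Sum>m\<leftarrow>ms. mon m H)" "\<And>a b H. D a b H = (\<Sum>m\<leftarrow>ms. mon_deriv a b m H)"
    using assms(1) unfolding pos_poly_def by blast
  have "E d k (\<lambda>\<omega>. sign_sum I \<omega> a b * \<Phi> (sign_sum I \<omega>))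
     = (\<Sum>m\<leftarrow>ms. E d k (\<lambda>\<omega>. sign_sum I \<omega> a b * mon m (sign_sum I \<omega>)))"
    by (simp add: ms sum_list_const_mult[symmetric] avg_sum_list)
  also have "\<dots> \<le> (\<Sum>m\<leftarrow>ms. 2 * real (card I) * E d k (\<lambda>\<omega>. mon_deriv a b m (sign_sum I \<omega>)))"
    using ms(1) assms by (intro sum_list_mono mon_wick) auto
  also have "\<dots> = 2 * real (card I) * E d k (\<lambda>\<omega>. D a b (sign_sum I \<omega>))"
    by (simp add: ms avg_sum_list sum_list_const_mult)
  finally show ?thesis .
qed

lemma mon_append: "mon (m1 @ m2) H = mon m1 H * mon m2 H"
  by (induction m1) auto

lemma mon_deriv_append: "mon_deriv a b (m1 @ m2) H = mon_deriv a b m1 H * mon m2 H + mon m1 H * mon_deriv a b m2 H"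
  by (induction m1) (auto simp: mon_append algebra_simps)

lemma pos_poly_zero: "pos_poly d (\<lambda>H. 0) (\<lambda>a b H. 0)"
  unfolding pos_poly_def by (rule exI[of _ "[]"]) auto

lemma pos_poly_one: "pos_poly d (\<lambda>H. 1) (\<lambda>a b H. 0)"
  unfolding pos_poly_def by (rule exI[of _ "[[]]"]) auto

lemma pos_poly_entry:
  "c < d \<Longrightarrow> e < d \<Longrightarrow> pos_poly d (\<lambda>H. H c e) (\<lambda>a b H. of_bool (c = a \<and> e = b) + of_bool (c = b \<and> e = a))"
  unfolding pos_poly_def by (rule exI[of _ "[[(c, e)]]"]) auto

lemma pos_poly_add:
  assumes "pos_poly d f Df" "pos_poly d g Dg"
  shows "pos_poly d (\<lambda>H. f H + g H) (\<lambda>a b H. Df a b H + Dg a b H)"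
proof -
  from assms obtain ms ms' where
    "\<forall>m\<in>set ms. \<forall>(c, e)\<in>set m. c < d \<and> e < d" "\<forall>H. f H = (\<Sum>m\<leftarrow>ms. mon m H)"
    "\<forall>a b H. Df a b H = (\<Sum>m\<leftarrow>ms. mon_deriv a b m H)"
    "\<forall>m\<in>set ms'. \<forall>(c, e)\<in>set m. c < d \<and> e < d" "\<forall>H. g H = (\<Sum>m\<leftarrow>ms'. mon m H)"
    "\<forall>a b H. Dg a b H = (\<Sum>m\<leftarrow>ms'. mon_deriv a b m H)" unfolding pos_poly_def by blast
  then show ?thesis unfolding pos_poly_def by (intro exI[of _ "ms @ ms'"]) auto
qed

lemma sum_list_product_append:
  fixes f g :: "'a \<Rightarrow> real"
  shows "(\<Sum>x\<leftarrow>xs. f x) * (\<Sum>y\<leftarrow>ys. g y) = (\<Sum>(x, y)\<leftarrow>List.product xs ys. f x * g y)"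
  by (induction xs) (auto simp: distrib_right sum_list_const_mult o_def)

lemma pos_poly_mult:
  assumes "pos_poly d f Df" "pos_poly d g Dg"
  shows "pos_poly d (\<lambda>H. f H * g H) (\<lambda>a b H. Df a b H * g H + f H * Dg a b H)"
proof -
  from assms obtain ms ms' where *:
    "\<forall>m\<in>set ms. \<forall>(c, e)\<in>set m. c < d \<and> e < d" "\<And>H. f H = (\<Sum>m\<leftarrow>ms. mon m H)"
    "\<And>a b H. Df a b H = (\<Sum>m\<leftarrow>ms. mon_deriv a b m H)"
    "\<forall>m\<in>set ms'. \<forall>(c, e)\<in>set m. c < d \<and> e < d" "\<And>H. g H = (\<Sum>m\<leftarrow>ms'. mon m H)"
    "\<And>a b H. Dg a b H = (\<Sum>m\<leftarrow>ms'. mon_deriv a b m H)" unfolding pos_poly_def by blast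
  show ?thesis unfolding pos_poly_def
  proof (intro exI[of _ "map (\<lambda>(x, y). x @ y) (List.product ms ms')"] conjI allI)
    show "\<forall>m\<in>set (map (\<lambda>(x, y). x @ y) (List.product ms ms')). \<forall>(c, e)\<in>set m. c < d \<and> e < d"
      using *(1,4) by fastforce
    show "f H * g H = (\<Sum>m\<leftarrow>map (\<lambda>(x, y). x @ y) (List.product ms ms'). mon m H)" for H
      by (simp add: * sum_list_product_append o_def split_def mon_append)
    show "Df a b H * g H + f H * Dg a b H = (\<Sum>m\<leftarrow>map (\<lambda>(x, y). x @ y) (List.product ms ms'). mon_deriv a b m H)" for a b H
      by (simp add: * sum_list_product_append o_def split_def mon_deriv_append sum_list_addf)
  qed
qed

lemma pos_poly_sum:
  fixes n :: nat
  assumes "\<And>l. l < n \<Longrightarrow> pos_poly d (f l) (Df l)"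
  shows "pos_poly d (\<lambda>H. \<Sum>l<n. f l H) (\<lambda>a b H. \<Sum>l<n. Df l a b H)"
  using assms
proof (induction n)
  case 0
  then show ?case using pos_poly_zero by simp
next
  case (Suc n)
  then show ?case using pos_poly_add[of d "\<lambda>H. \<Sum>l<n. f l H" "\<lambda>a b H. \<Sum>l<n. Df l a b H" "f n" "Df n"]
    by simp
qed

section \<open>Traces of powers as polynomials in the entries, and their derivatives\<close>

abbreviation mpow :: "nat \<Rightarrow> nat \<Rightarrow> rmat \<Rightarrow> rmat" where
  "mpow d n H \<equiv> mprod d (replicate n H)"

fun mpow_deriv :: "nat \<Rightarrow> nat \<Rightarrow> nat \<Rightarrow> nat \<Rightarrow> nat \<Rightarrow> nat \<Rightarrow> rmat \<Rightarrow> real" where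
  "mpow_deriv d 0 x y a b H = 0"
| "mpow_deriv d (Suc n) x y a b H =
     (\<Sum>l<d. (of_bool (x = a \<and> l = b) + of_bool (x = b \<and> l = a)) * mpow d n H l y + H x l * mpow_deriv d n l y a b H)"

lemma pos_poly_mpow: "x < d \<Longrightarrow> y < d \<Longrightarrow> pos_poly d (\<lambda>H. mpow d n H x y) (mpow_deriv d n x y)"
proof (induction n arbitrary: x)
  case 0
  have "mpow_deriv d 0 x y = (\<lambda>a b H. 0)" by (simp add: fun_eq_iff)
  then show ?case by (cases "x = y") (auto intro: pos_poly_zero pos_poly_one)
next
  case (Suc n)
  have "pos_poly d (\<lambda>H. \<Sum>l<d. H x l * mpow d n H l y)
     (\<lambda>a b H. \<Sum>l<d. (of_bool (x = a \<and> l = b) + of_bool (x = b \<and> l = a)) * mpow d n H l y + H x l * mpow_deriv d n l y a b H)"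
    by (intro pos_poly_sum pos_poly_mult[OF pos_poly_entry Suc.IH] Suc.prems)
  then show ?case by (simp cong: if_cong add: fun_eq_iff)
qed

text \<open>Product rule: the factor at position \<open>u\<close> is replaced by the direction
  matrix, whose two nonzero entries give the two terms.\<close>

lemma mpow_deriv_eq:
  assumes "x < d" "a < d" "b < d"
  shows "mpow_deriv d n x y a b H =
    (\<Sum>u<n. mpow d u H x a * mpow d (n - 1 - u) H b y + mpow d u H x b * mpow d (n - 1 - u) H a y)"
  using assms(1)
proof (induction n arbitrary: x)
  case (Suc n)
  have 1: "(\<Sum>l<d. of_bool (x = s \<and> l = t) * mpow d n H l y) = of_bool (x = s) * mpow d n H t y" if "t < d" for s t
  proof -
    have "(\<Sum>l<d. of_bool (x = s \<and> l = t) * mpow d n H l y) = (\<Sum>l<d. if l = t then of_bool (x = s) * mpow d n H l y else 0)"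
      by (rule sum.cong) auto
    then show ?thesis using that by simp
  qed
  have "(\<Sum>l<d. H x l * mpow_deriv d n l y a b H) = (\<Sum>l<d. \<Sum>u<n. H x l * mpow d u H l a * mpow d (n - 1 - u) H b y
     + H x l * mpow d u H l b * mpow d (n - 1 - u) H a y)"
    by (rule sum.cong) (auto simp: Suc.IH sum_distrib_left algebra_simps)
  also have "\<dots> = (\<Sum>u<n. mpow d (Suc u) H x a * mpow d (n - 1 - u) H b y + mpow d (Suc u) H x b * mpow d (n - 1 - u) H a y)"
    by (subst sum.swap) (simp add: sum.distrib sum_distrib_right)
  finally show ?case
    using 1[of b a] 1[of a b] assms
    by (simp add: sum.distrib distrib_right sum.lessThan_Suc_shift del: sum.lessThan_Suc)
qed simp

definition ptr :: "nat \<Rightarrow> nat \<Rightarrow> rmat \<Rightarrow> real" where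
  "ptr d l H = trw d (replicate l H)"

definition ptr_prod :: "nat \<Rightarrow> nat list \<Rightarrow> rmat \<Rightarrow> real" where
  "ptr_prod d ls H = prod_list (map (\<lambda>l. ptr d l H) ls)"

definition ptr_deriv :: "nat \<Rightarrow> nat \<Rightarrow> nat \<Rightarrow> nat \<Rightarrow> rmat \<Rightarrow> real" where
  "ptr_deriv d l a b H = (\<Sum>x<d. mpow_deriv d l x x a b H)"

fun ptr_prod_deriv :: "nat \<Rightarrow> nat list \<Rightarrow> nat \<Rightarrow> nat \<Rightarrow> rmat \<Rightarrow> real" where
  "ptr_prod_deriv d [] a b H = 0"
| "ptr_prod_deriv d (l # ls) a b H = ptr_deriv d l a b H * ptr_prod d ls H + ptr d l H * ptr_prod_deriv d ls a b H"

lemma pos_poly_ptr_prod: "pos_poly d (ptr_prod d ls) (ptr_prod_deriv d ls)"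
proof (induction ls)
  case Nil
  have "ptr_prod_deriv d [] = (\<lambda>a b H. 0)" by (simp add: fun_eq_iff)
  then show ?case using pos_poly_one by (simp add: ptr_prod_def[abs_def])
next
  case (Cons l ls)
  have "pos_poly d (ptr d l) (ptr_deriv d l)"
    unfolding ptr_def[abs_def] trw_def ptr_deriv_def[abs_def] by (intro pos_poly_sum pos_poly_mpow)
  from pos_poly_mult[OF this Cons] show ?case by (simp add: ptr_prod_def[abs_def])
qed

lemma mpow_symm: "symm H \<Longrightarrow> a < d \<Longrightarrow> b < d \<Longrightarrow> mpow d n H a b = mpow d n H b a"
  using mprod_rev[of "replicate n H" a d b] by auto

lemma mpow_add: "i < d \<Longrightarrow> (\<Sum>l<d. mpow d m H i l * mpow d n H l j) = mpow d (m + n) H i j"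
  by (simp add: replicate_add mprod_append)

text \<open>By cyclicity all \<open>l\<close> positions contribute equally, and by symmetry of
  \<open>H\<close> so do the two entries of the direction matrix.\<close>

lemma ptr_deriv_eq:
  assumes "symm H" "a < d" "b < d"
  shows "ptr_deriv d l a b H = 2 * real l * mpow d (l - 1) H a b"
proof -
  have "ptr_deriv d l a b H = (\<Sum>u<l. \<Sum>x<d. mpow d (l - 1 - u) H b x * mpow d u H x a + mpow d (l - 1 - u) H a x * mpow d u H x b)"
    unfolding ptr_deriv_def by (subst sum.swap) (auto intro!: sum.cong simp: mpow_deriv_eq assms mult.commute)
  also have "\<dots> = (\<Sum>u<l. mpow d (l - 1) H b a + mpow d (l - 1) H a b)"
    by (rule sum.cong) (auto simp: sum.distrib mpow_add assms)
  finally show ?thesis by (simp add: mpow_symm[OF assms(1), of b d a] assms)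
qed

lemma ptr_add: "ptr d (m + n) H = (\<Sum>a<d. \<Sum>b<d. mpow d m H a b * mpow d n H b a)"
  by (simp add: ptr_def replicate_add trw_append)

text \<open>The merging terms of the loop equation: differentiating the j-th trace joins it to the
  open power of order n. If that trace has order 0, the factor \<open>real (ls ! j)\<close> removes
  the term in which the subtraction is truncated.\<close>

lemma ptr_prod_deriv_sum:
  assumes "symm H"
  shows "(\<Sum>a<d. \<Sum>b<d. mpow d n H b a * ptr_prod_deriv d ls a b H) =
     (\<Sum>j<length ls. 2 * real (ls ! j) * ptr_prod d ((n + ls ! j - 1) # take j ls @ drop (Suc j) ls) H)"
proof (induction ls)
  case (Cons l ls)
  have 1: "(\<Sum>a<d. \<Sum>b<d. mpow d n H b a * ptr_deriv d l a b H) = 2 * real l * ptr d (n + l - 1) H"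
  proof (cases "l = 0")
    case True
    then show ?thesis by (simp add: ptr_deriv_def)
  next
    case False
    have "(\<Sum>a<d. \<Sum>b<d. mpow d n H b a * ptr_deriv d l a b H)
       = 2 * real l * (\<Sum>a<d. \<Sum>b<d. mpow d (l - 1) H a b * mpow d n H b a)"
      by (simp add: sum_distrib_left ptr_deriv_eq assms mult_ac)
    then show ?thesis using False by (simp add: ptr_add[symmetric] add.commute)
  qed
  have "(\<Sum>a<d. \<Sum>b<d. mpow d n H b a * ptr_prod_deriv d (l # ls) a b H)
     = (\<Sum>a<d. \<Sum>b<d. mpow d n H b a * ptr_deriv d l a b H) * ptr_prod d ls H
       + ptr d l H * (\<Sum>a<d. \<Sum>b<d. mpow d n H b a * ptr_prod_deriv d ls a b H)"
    by (simp add: sum_distrib_left sum_distrib_right sum.distrib algebra_simps)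
  then show ?case unfolding 1 Cons
    by (simp add: sum.lessThan_Suc_shift sum_distrib_left ptr_prod_def mult_ac del: sum.lessThan_Suc)
qed simp

lemma sum_rotate:
  "(\<Sum>a\<in>A. \<Sum>b\<in>B. \<Sum>c\<in>C. f a b c) = (\<Sum>c\<in>C. \<Sum>a\<in>A. \<Sum>b\<in>B. f a b c)"
proof -
  have "(\<Sum>a\<in>A. \<Sum>b\<in>B. \<Sum>c\<in>C. f a b c) = (\<Sum>a\<in>A. \<Sum>c\<in>C. \<Sum>b\<in>B. f a b c)"
    by (intro sum.cong refl sum.swap)
  also have "\<dots> = (\<Sum>c\<in>C. \<Sum>a\<in>A. \<Sum>b\<in>B. f a b c)" by (rule sum.swap)
  finally show ?thesis .
qed

text \<open>The direction matrix has two entries. One splits the open power into two traces; the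
  other, typical of real symmetric matrices, runs through one part backwards and leaves a single
  trace.\<close>

lemma mpow_deriv_trace:
  assumes "symm H"
  shows "(\<Sum>a<d. \<Sum>b<d. mpow_deriv d n b a a b H) = real n * ptr d (n - 1) H + (\<Sum>u<n. ptr d u H * ptr d (n - 1 - u) H)"
proof -
  have "(\<Sum>a<d. \<Sum>b<d. mpow_deriv d n b a a b H)
     = (\<Sum>a<d. \<Sum>b<d. \<Sum>u<n. mpow d u H a b * mpow d (n - 1 - u) H b a + mpow d u H b b * mpow d (n - 1 - u) H a a)"
    by (intro sum.cong refl) (auto simp: mpow_deriv_eq mpow_symm[OF assms])
  also have "\<dots> = (\<Sum>u<n. \<Sum>a<d. \<Sum>b<d. mpow d u H a b * mpow d (n - 1 - u) H b a + mpow d u H b b * mpow d (n - 1 - u) H a a)"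
    by (rule sum_rotate)
  also have "\<dots> = (\<Sum>u<n. ptr d (n - 1) H + ptr d u H * ptr d (n - 1 - u) H)"
  proof (rule sum.cong)
    fix u assume "u \<in> {..<n}"
    then have "u + (n - 1 - u) = n - 1" by auto
    then have "ptr d (n - 1) H = (\<Sum>a<d. \<Sum>b<d. mpow d u H a b * mpow d (n - 1 - u) H b a)"
      by (metis ptr_add)
    then show "(\<Sum>a<d. \<Sum>b<d. mpow d u H a b * mpow d (n - 1 - u) H b a + mpow d u H b b * mpow d (n - 1 - u) H a a)
       = ptr d (n - 1) H + ptr d u H * ptr d (n - 1 - u) H"
      by (simp add: sum.distrib ptr_def trw_def sum_product, subst sum.swap, simp)
  qed simp
  finally show ?thesis by (simp add: sum.distrib)
qed

definition mtr :: "nat \<Rightarrow> nat \<Rightarrow> nat set \<Rightarrow> nat list \<Rightarrow> real" where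
  "mtr d k I ls = E d k (\<lambda>\<omega>. ptr_prod d ls (sign_sum I \<omega>))"

text \<open>One factor of the leading trace is integrated by parts. The derivative falls on the rest
  of that trace, which gives the splitting and the reversing terms, or on another trace, which gives
  the merging terms.\<close>

lemma mtr_recursion:
  assumes I: "I \<subseteq> {1..k}"
  shows "mtr d k I (Suc n # ls) \<le> 2 * real (card I) *
    ((\<Sum>u<n. mtr d k I (u # (n - 1 - u) # ls)) + real n * mtr d k I ((n - 1) # ls)
      + (\<Sum>j<length ls. 2 * real (ls ! j) * mtr d k I ((n + ls ! j - 1) # take j ls @ drop (Suc j) ls)))"
proof -
  let ?H = "\<lambda>\<omega>. sign_sum I \<omega>"
  have "mtr d k I (Suc n # ls) = (\<Sum>a<d. \<Sum>b<d. E d k (\<lambda>\<omega>. ?H \<omega> a b * (mpow d n (?H \<omega>) b a * ptr_prod d ls (?H \<omega>))))"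
    unfolding mtr_def avg_sum[symmetric]
    by (rule avg_cong) (simp add: ptr_prod_def ptr_def trw_def sum_distrib_right mult.assoc)
  also have "\<dots> \<le> (\<Sum>a<d. \<Sum>b<d. 2 * real (card I) * E d k (\<lambda>\<omega>.
      mpow_deriv d n b a a b (?H \<omega>) * ptr_prod d ls (?H \<omega>) + mpow d n (?H \<omega>) b a * ptr_prod_deriv d ls a b (?H \<omega>)))"
    by (intro sum_mono pos_poly_wick[OF pos_poly_mult[OF pos_poly_mpow pos_poly_ptr_prod]] I) auto
  also have "\<dots> = 2 * real (card I) * E d k (\<lambda>\<omega>. (\<Sum>a<d. \<Sum>b<d. mpow_deriv d n b a a b (?H \<omega>)) * ptr_prod d ls (?H \<omega>)
      + (\<Sum>a<d. \<Sum>b<d. mpow d n (?H \<omega>) b a * ptr_prod_deriv d ls a b (?H \<omega>)))"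
    unfolding sum_distrib_left[symmetric] avg_sum[symmetric]
    by (simp add: sum.distrib sum_distrib_right)
  also have "\<dots> = 2 * real (card I) *
    ((\<Sum>u<n. mtr d k I (u # (n - 1 - u) # ls)) + real n * mtr d k I ((n - 1) # ls)
      + (\<Sum>j<length ls. 2 * real (ls ! j) * mtr d k I ((n + ls ! j - 1) # take j ls @ drop (Suc j) ls)))"
    unfolding mpow_deriv_trace[OF symm_sign_sum] ptr_prod_deriv_sum[OF symm_sign_sum] mtr_def
      avg_cmult[symmetric] avg_sum[symmetric] avg_add[symmetric]
    by (rule avg_cong) (simp add: ptr_prod_def algebra_simps sum_distrib_right sum_distrib_left)
  finally show ?thesis .
qed

section \<open>The moment bound for the sign model\<close>

text \<open>
  \<open>cat_weight q\<close> is the Catalan number of index \<open>q\<close> divided by \<open>4 ^ q\<close>.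
\<close>
primrec cat_weight :: "nat \<Rightarrow> real" where
  "cat_weight 0 = 1"
| "cat_weight (Suc q) = cat_weight q * (2 * real q + 1) / (2 * real q + 4)"

lemma cat_weight_rec: "(2 * real q + 4) * cat_weight (Suc q) = (2 * real q + 1) * cat_weight q"
  by (simp add: field_simps)

declare cat_weight.simps(2) [simp del]

lemma cat_weight_pos: "cat_weight q > 0"
  by (induction q) (auto simp: cat_weight.simps(2))

lemma cat_weight_antimono: "q \<le> r \<Longrightarrow> cat_weight r \<le> cat_weight q"
proof (induction r rule: dec_induct)
  case (step r)
  have "cat_weight (Suc r) \<le> cat_weight r * 1"
    unfolding cat_weight.simps(2) times_divide_eq_right[symmetric]
    by (intro mult_left_mono) (use cat_weight_pos[of r] in auto)
  then show ?case using step by simp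
qed simp

lemma cat_weight_le_1: "cat_weight q \<le> 1"
  using cat_weight_antimono[of 0 q] by simp

text \<open>A crude bound, the true decay being of order q^(-3/2). It turns an absolute error into
  an error relative to a Catalan weight, at the price of a factor quadratic in the order.\<close>

lemma cat_weight_lower: "1 \<le> (real q + 1)\<^sup>2 * cat_weight q"
proof (induction q)
  case (Suc q)
  have "(real q + 1)\<^sup>2 * (2 * real q + 4) \<le> (real q + 2)\<^sup>2 * (2 * real q + 1)"
    by (simp add: power2_eq_square algebra_simps)
  then have "(real q + 1)\<^sup>2 \<le> (real q + 2)\<^sup>2 * (2 * real q + 1) / (2 * real q + 4)"
    by (simp add: field_simps)
  then have "(real q + 1)\<^sup>2 * cat_weight q \<le> ((real q + 2)\<^sup>2 * (2 * real q + 1) / (2 * real q + 4)) * cat_weight q"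
    using cat_weight_pos[of q] by (intro mult_right_mono) auto
  also have "\<dots> = (real (Suc q) + 1)\<^sup>2 * cat_weight (Suc q)" by (simp add: cat_weight.simps(2) add.commute)
  finally show ?case using Suc by linarith
qed simp

text \<open>The number 2 is the value of the Catalan generating function at 1/4.\<close>

lemma cat_weight_sum: "(\<Sum>u\<le>n. cat_weight u) = 2 - (2 * real n + 1) * cat_weight n"
proof (induction n)
  case (Suc n)
  then show ?case using cat_weight_rec[of n] by (simp add: algebra_simps)
qed simp

lemma cat_weight_sum_le: "(\<Sum>u<n. cat_weight u) \<le> 2"
proof (cases n)
  case (Suc m)
  then show ?thesis using cat_weight_sum[of m] cat_weight_pos[of m] by (simp add: lessThan_Suc_atMost)
qed simp

text \<open>Segner's recursion, scaled, and derived from the ratio of consecutive weights. By the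
  symmetry between u and m - u a factor 2u + c inside the convolution may be replaced by m + c. With
  c = 2 the ratio formula turns the shifted sum at n + 1 into the sum at n.\<close>

lemma cat_weight_convolution: "(\<Sum>u\<le>n. cat_weight u * cat_weight (n - u)) = 4 * cat_weight (Suc n)"
proof (induction n)
  case 0
  then show ?case by (simp add: cat_weight.simps(2))
next
  case (Suc n)
  let ?A = "\<lambda>n. \<Sum>u\<le>n. cat_weight u * cat_weight (n - u)"
  have symw: "(\<Sum>u\<le>m. (2 * real u + c) * (cat_weight u * cat_weight (m - u))) = (real m + c) * ?A m" for m c
  proof -
    have "(\<Sum>u\<le>m. (2 * real u + c) * (cat_weight u * cat_weight (m - u)))
       = (\<Sum>u\<le>m. (2 * real (m - u) + c) * (cat_weight (m - u) * cat_weight u))"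
      by (rule sum.reindex_bij_witness[of _ "\<lambda>u. m - u" "\<lambda>u. m - u"]) auto
    then have "2 * (\<Sum>u\<le>m. (2 * real u + c) * (cat_weight u * cat_weight (m - u)))
       = (\<Sum>u\<le>m. (2 * real u + c) * (cat_weight u * cat_weight (m - u)) + (2 * real (m - u) + c) * (cat_weight (m - u) * cat_weight u))"
      by (simp add: sum.distrib)
    also have "\<dots> = (\<Sum>u\<le>m. 2 * (real m + c) * (cat_weight u * cat_weight (m - u)))"
      by (rule sum.cong) (auto simp: of_nat_diff algebra_simps)
    also have "\<dots> = 2 * ((real m + c) * ?A m)" by (simp add: sum_distrib_left algebra_simps)
    finally show ?thesis by simp
  qed
  have "(real (Suc n) + 2) * ?A (Suc n) = (\<Sum>u\<le>Suc n. (2 * real u + 2) * (cat_weight u * cat_weight (Suc n - u)))"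
    by (simp only: symw)
  also have "\<dots> = 2 * cat_weight (Suc n) + (\<Sum>u\<le>n. (2 * real (Suc u) + 2) * (cat_weight (Suc u) * cat_weight (n - u)))"
    by (subst sum.atMost_Suc_shift) simp
  also have "(\<Sum>u\<le>n. (2 * real (Suc u) + 2) * (cat_weight (Suc u) * cat_weight (n - u)))
      = (\<Sum>u\<le>n. (2 * real u + 1) * (cat_weight u * cat_weight (n - u)))"
  proof (rule sum.cong)
    fix u
    show "(2 * real (Suc u) + 2) * (cat_weight (Suc u) * cat_weight (n - u)) = (2 * real u + 1) * (cat_weight u * cat_weight (n - u))"
      using cat_weight_rec[of u] by (simp add: mult.assoc[symmetric] add.commute)
  qed simp
  also have "\<dots> = (real n + 1) * (4 * cat_weight (Suc n))" by (simp only: symw Suc)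
  also have "2 * cat_weight (Suc n) + (real n + 1) * (4 * cat_weight (Suc n)) = 2 * ((2 * real (Suc n) + 1) * cat_weight (Suc n))"
    by (simp add: algebra_simps)
  also have "\<dots> = (real (Suc n) + 2) * (4 * cat_weight (Suc (Suc n)))"
    using cat_weight_rec[of "Suc n"] by (simp add: algebra_simps)
  finally show ?case by (simp del: sum.atMost_Suc)
qed

text \<open>
  The weight \<open>\<theta>\<close> of odd traces has to balance two errors: splitting an even trace into two odd ones
  costs \<open>\<theta>\<^sup>2\<close>, merging two odd traces costs \<open>1 / \<theta>\<^sup>2\<close>.
\<close>
definition trace_weight :: "real \<Rightarrow> nat \<Rightarrow> real" where
  "trace_weight \<theta> l = (if even l then cat_weight (l div 2) else \<theta>)"

lemma sum_even_odd: "(\<Sum>u<2 * m. f u) = (\<Sum>u<m. f (2 * u) + f (2 * u + 1 :: nat) :: real)"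
  by (induction m) auto

text \<open>The supersolution property: inserting the weights into the right side of the loop
  equation reproduces the weight of the leading trace with the factor 4, up to a relative error of
  order (p + 1)^2/d. The errors add up to at most 33 times (p + 1)^2/d for even \<open>n\<close> and
  31 times for odd \<open>n\<close>, below the allowed 4 * 9.\<close>

lemma trace_weight_step:
  fixes d p n :: nat and ms :: "nat list"
  assumes d: "d \<ge> 1" and p: "p + 1 \<le> 7 * d" and \<theta>: "\<theta> > 0" "\<theta>\<^sup>2 * (real d * (real p + 1)) = 1"
    and len: "Suc n + sum_list ms \<le> 2 * p"
  shows "(\<Sum>u<n. trace_weight \<theta> u * trace_weight \<theta> (n - 1 - u)) + real n / real d * trace_weight \<theta> (n - 1)
     + (\<Sum>m\<leftarrow>ms. 2 * real m / (real d)\<^sup>2 * (trace_weight \<theta> (n + m - 1) / trace_weight \<theta> m))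
     \<le> 4 * (1 + 9 * (real p + 1)\<^sup>2 / real d) * trace_weight \<theta> (Suc n)"
proof -
  define q where "q = real p + 1"
  have q2: "q \<ge> 2" using len by (simp add: q_def)
  have d0: "real d > 0" using d by simp
  have q7: "q \<le> 7 * real d" using p by (simp add: q_def flip: of_nat_Suc)
  \<comment> \<open>\<open>B\<close> bounds the loss of a merger. For even \<open>n\<close> the
    leading trace has odd order and weight \<open>\<theta>\<close> only, so merging it with another
    odd trace costs the inverse square of \<open>\<theta>\<close>, which is d q. All other mergers
    cost at most q^2, by the lower bound on the Catalan weights.\<close>
  define B where "B = (if even n then q\<^sup>2 + real d * q else q\<^sup>2)"
  have B0: "B \<ge> 0" using q2 by (simp add: B_def)
  have wpos: "trace_weight \<theta> m > 0" for m using \<theta> cat_weight_pos by (simp add: trace_weight_def)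
  have low: "1 \<le> q\<^sup>2 * cat_weight r" if "r \<le> p" for r
  proof -
    have "(real r + 1)\<^sup>2 * cat_weight r \<le> q\<^sup>2 * cat_weight r"
      using that cat_weight_pos[of r] by (intro mult_right_mono power_mono) (auto simp: q_def)
    then show ?thesis using cat_weight_lower[of r] by linarith
  qed
  have merge1: "trace_weight \<theta> (n + m - 1) / trace_weight \<theta> m \<le> B * trace_weight \<theta> (Suc n)" if m: "m \<ge> 1" "m \<in> set ms" for m
  proof -
    have mle: "m \<le> sum_list ms" using m by (simp add: member_le_sum_list)
    consider (a) "odd n" "even m" | (b) "odd n" "odd m" | (c) "even n" "even m" | (e) "even n" "odd m" by blast
    then show ?thesis
    proof cases
      case a
      then obtain r s where rs: "n = 2 * r + 1" "m = 2 * s" by (auto elim!: oddE evenE)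
      have s: "s \<ge> 1" "s \<le> p" using rs m mle len by auto
      have e: "n + m - 1 = 2 * (r + s)" using rs by simp
      have "cat_weight (r + s) * 1 \<le> cat_weight (Suc r) * (q\<^sup>2 * cat_weight s)"
        using s low[OF s(2)] cat_weight_pos[of "r + s"] cat_weight_pos[of "Suc r"]
        by (intro mult_mono cat_weight_antimono) auto
      then show ?thesis unfolding e unfolding trace_weight_def B_def using rs cat_weight_pos[of s]
        by (simp add: field_simps)
    next
      case b
      then obtain r s where rs: "n = 2 * r + 1" "m = 2 * s + 1" by (auto elim!: oddE)
      have e: "n + m - 1 = 2 * (r + s) + 1" using rs by simp
      have "Suc r \<le> p" using rs len by auto
      then show ?thesis unfolding e unfolding trace_weight_def B_def using rs \<theta> low by simp
    next
      case c
      then obtain r s where rs: "n = 2 * r" "m = 2 * s" by (auto elim!: evenE)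
      have s: "s \<ge> 1" "s \<le> p" using rs m mle len by auto
      then have e: "n + m - 1 = 2 * (r + s - 1) + 1" using rs by simp
      have "\<theta> \<le> \<theta> * (q\<^sup>2 * cat_weight s)" using low[OF s(2)] \<theta> by simp
      also have "\<dots> \<le> (q\<^sup>2 + real d * q) * \<theta> * cat_weight s"
        using \<theta> d0 q2 cat_weight_pos[of s] by (simp add: algebra_simps)
      finally show ?thesis unfolding e unfolding trace_weight_def B_def using rs cat_weight_pos[of s]
        by (simp add: field_simps)
    next
      case e
      then obtain r s where rs: "n = 2 * r" "m = 2 * s + 1" by (auto elim!: evenE oddE)
      have e': "n + m - 1 = 2 * (r + s)" using rs by simp
      have "cat_weight (r + s) \<le> \<theta>\<^sup>2 * (real d * q)" using cat_weight_le_1 \<theta> by (simp add: q_def)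
      also have "\<dots> \<le> \<theta>\<^sup>2 * (q\<^sup>2 + real d * q)" by (intro mult_left_mono) auto
      finally show ?thesis unfolding e' unfolding trace_weight_def B_def using rs \<theta>
        by (simp add: field_simps power2_eq_square)
    qed
  qed
  have "(\<Sum>m\<leftarrow>ms. 2 * real m / (real d)\<^sup>2 * (trace_weight \<theta> (n + m - 1) / trace_weight \<theta> m))
     \<le> (\<Sum>m\<leftarrow>ms. 2 * real m / (real d)\<^sup>2 * (B * trace_weight \<theta> (Suc n)))"
  proof (rule sum_list_mono)
    fix m assume "m \<in> set ms"
    then show "2 * real m / (real d)\<^sup>2 * (trace_weight \<theta> (n + m - 1) / trace_weight \<theta> m)
       \<le> 2 * real m / (real d)\<^sup>2 * (B * trace_weight \<theta> (Suc n))"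
    proof (cases "m = 0")
      case False
      then show ?thesis using \<open>m \<in> set ms\<close> by (intro mult_left_mono merge1) auto
    qed simp
  qed
  also have "\<dots> = real (sum_list ms) * (2 / (real d)\<^sup>2 * (B * trace_weight \<theta> (Suc n)))"
    by (induction ms) (auto simp: algebra_simps add_divide_distrib)
  also have "\<dots> \<le> (2 * q) * (2 / (real d)\<^sup>2 * (B * trace_weight \<theta> (Suc n)))"
    using len B0 wpos[of "Suc n"] d0 by (intro mult_right_mono) (auto simp: q_def)
  finally have merge: "(\<Sum>m\<leftarrow>ms. 2 * real m / (real d)\<^sup>2 * (trace_weight \<theta> (n + m - 1) / trace_weight \<theta> m))
     \<le> 4 * q * B / (real d)\<^sup>2 * trace_weight \<theta> (Suc n)" by (simp add: mult_ac)
  have q3: "4 * q * q\<^sup>2 / (real d)\<^sup>2 \<le> 28 * q\<^sup>2 / real d"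
  proof -
    have "4 * q * q\<^sup>2 \<le> 4 * (7 * real d) * q\<^sup>2" using q7 by (intro mult_right_mono) auto
    then have "4 * q * q\<^sup>2 / (real d)\<^sup>2 \<le> 4 * (7 * real d) * q\<^sup>2 / (real d)\<^sup>2" by (rule divide_right_mono) simp
    also have "\<dots> = 28 * q\<^sup>2 / real d" using d0 by (simp add: power2_eq_square)
    finally show ?thesis .
  qed
  have qq: "2 * q \<le> q\<^sup>2" using q2 by (simp add: power2_eq_square)
  show ?thesis
  proof (cases "even n")
    \<comment> \<open>Each splitting now consists of one even and one odd trace, so the two sums of
      Catalan weights, at most 2 each, give the main term 4 \<open>\<theta>\<close> exactly.\<close>
    case True
    then obtain r where r: "n = 2 * r" by (auto elim!: evenE)
    have "(\<Sum>u<n. trace_weight \<theta> u * trace_weight \<theta> (n - 1 - u)) = (\<Sum>u<r. \<theta> * cat_weight u + \<theta> * cat_weight (r - 1 - u))"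
      unfolding r sum_even_odd
    proof (rule sum.cong)
      fix u assume u: "u \<in> {..<r}"
      have "2 * r - 1 - 2 * u = 2 * (r - 1 - u) + 1" "2 * r - 1 - (2 * u + 1) = 2 * (r - 1 - u)" using u by auto
      then show "trace_weight \<theta> (2 * u) * trace_weight \<theta> (2 * r - 1 - 2 * u) +
         trace_weight \<theta> (2 * u + 1) * trace_weight \<theta> (2 * r - 1 - (2 * u + 1)) = \<theta> * cat_weight u + \<theta> * cat_weight (r - 1 - u)"
        by (simp only: trace_weight_def) simp
    qed simp
    also have "\<dots> = \<theta> * (\<Sum>u<r. cat_weight u) + \<theta> * (\<Sum>u<r. cat_weight (r - 1 - u))"
      by (simp add: sum.distrib sum_distrib_left)
    also have "(\<Sum>u<r. cat_weight (r - 1 - u)) = (\<Sum>u<r. cat_weight u)"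
      using sum.nat_diff_reindex[of cat_weight r] by simp
    also have "\<theta> * (\<Sum>u<r. cat_weight u) + \<theta> * (\<Sum>u<r. cat_weight u) \<le> \<theta> * 2 + \<theta> * 2"
      using \<theta> cat_weight_sum_le[of r] by (intro add_mono mult_left_mono) auto
    finally have 1: "(\<Sum>u<n. trace_weight \<theta> u * trace_weight \<theta> (n - 1 - u)) \<le> 4 * \<theta>" by simp
    have 2: "real n / real d * trace_weight \<theta> (n - 1) \<le> q\<^sup>2 / real d * \<theta>"
    proof (cases "r = 0")
      case False
      then have "odd (n - 1)" using r by auto
      moreover have "real n \<le> q\<^sup>2" using len qq by (simp add: q_def)
      ultimately show ?thesis using \<theta> by (auto simp: trace_weight_def intro!: mult_right_mono divide_right_mono)
    qed (use r \<theta> in auto)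
    have 3: "4 * q * B / (real d)\<^sup>2 \<le> 32 * q\<^sup>2 / real d"
    proof -
      have "4 * q * B / (real d)\<^sup>2 = 4 * q * q\<^sup>2 / (real d)\<^sup>2 + 4 * q\<^sup>2 / real d"
        using True d0 by (simp add: B_def power2_eq_square field_simps)
      then show ?thesis using q3 by simp
    qed
    have t: "trace_weight \<theta> (Suc n) = \<theta>" using True by (simp add: trace_weight_def)
    have "4 * q * B / (real d)\<^sup>2 * \<theta> \<le> 32 * q\<^sup>2 / real d * \<theta>" using 3 \<theta> by (intro mult_right_mono) auto
    moreover have "0 \<le> q\<^sup>2 / real d * \<theta>" using \<theta> by simp
    moreover have "4 * (1 + 9 * q\<^sup>2 / real d) * \<theta> = 4 * \<theta> + 36 * (q\<^sup>2 / real d * \<theta>)"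
      "32 * q\<^sup>2 / real d * \<theta> = 32 * (q\<^sup>2 / real d * \<theta>)" by (simp_all add: algebra_simps)
    ultimately show ?thesis using 1 2 merge unfolding t q_def[symmetric] by linarith
  next
    \<comment> \<open>Even-even splittings give the Catalan convolution, hence exactly the main
      term. Odd-odd splittings give r times the square of \<open>\<theta>\<close>, at most
      1/d.\<close>
    case False
    then obtain r where r: "n = 2 * r + 1" by (auto elim!: oddE)
    have rp: "Suc r \<le> p" using len r by auto
    have "(\<Sum>u<n. trace_weight \<theta> u * trace_weight \<theta> (n - 1 - u))
       = cat_weight r * cat_weight 0 + (\<Sum>u<r. cat_weight u * cat_weight (r - u) + \<theta> * \<theta>)"
    proof -
      have "(\<Sum>u<2 * r. trace_weight \<theta> u * trace_weight \<theta> (n - 1 - u)) = (\<Sum>u<r. cat_weight u * cat_weight (r - u) + \<theta> * \<theta>)"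
        unfolding sum_even_odd
      proof (rule sum.cong)
        fix u assume u: "u \<in> {..<r}"
        have "n - 1 - 2 * u = 2 * (r - u)" "n - 1 - (2 * u + 1) = 2 * (r - u - 1) + 1" using u r by auto
        then show "trace_weight \<theta> (2 * u) * trace_weight \<theta> (n - 1 - 2 * u) +
         trace_weight \<theta> (2 * u + 1) * trace_weight \<theta> (n - 1 - (2 * u + 1)) = cat_weight u * cat_weight (r - u) + \<theta> * \<theta>"
          by (simp only: trace_weight_def) simp
      qed simp
      then show ?thesis unfolding r by (simp add: trace_weight_def)
    qed
    also have "\<dots> = (\<Sum>u\<le>r. cat_weight u * cat_weight (r - u)) + real r * \<theta>\<^sup>2"
      by (simp add: sum.distrib power2_eq_square lessThan_Suc_atMost[symmetric])
    also have "\<dots> = 4 * cat_weight (Suc r) + real r * \<theta>\<^sup>2" by (simp only: cat_weight_convolution)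
    finally have 1: "(\<Sum>u<n. trace_weight \<theta> u * trace_weight \<theta> (n - 1 - u)) = 4 * cat_weight (Suc r) + real r * \<theta>\<^sup>2" .
    have th: "\<theta>\<^sup>2 = 1 / (real d * q)" by (subst eq_divide_eq) (use \<theta>(2) d0 q2 in \<open>auto simp: q_def\<close>)
    have "real r * \<theta>\<^sup>2 \<le> q * (1 / (real d * q))" unfolding th using rp d0 q2 by (intro mult_right_mono) (auto simp: q_def)
    also have "\<dots> = 1 / real d * 1" using q2 by simp
    also have "\<dots> \<le> 1 / real d * (q\<^sup>2 * cat_weight (Suc r))" by (intro mult_left_mono low rp) auto
    finally have 2: "real r * \<theta>\<^sup>2 \<le> q\<^sup>2 / real d * cat_weight (Suc r)" by simp
    have "real n * cat_weight r = (2 * real r + 4) * cat_weight (Suc r)" using cat_weight_rec[of r] r by simp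
    also have "\<dots> \<le> (2 * q\<^sup>2) * cat_weight (Suc r)"
      using cat_weight_pos[of "Suc r"] rp qq q2 by (intro mult_right_mono) (auto simp: q_def)
    finally have "real n * cat_weight r / real d \<le> 2 * q\<^sup>2 * cat_weight (Suc r) / real d" by (rule divide_right_mono) simp
    then have 3: "real n / real d * trace_weight \<theta> (n - 1) \<le> 2 * q\<^sup>2 / real d * cat_weight (Suc r)"
      using r by (simp add: trace_weight_def)
    have t: "trace_weight \<theta> (Suc n) = cat_weight (Suc r)" using r by (simp add: trace_weight_def)
    have "4 * q * B / (real d)\<^sup>2 * cat_weight (Suc r) \<le> 28 * q\<^sup>2 / real d * cat_weight (Suc r)"
      using q3 cat_weight_pos[of "Suc r"] False by (intro mult_right_mono) (auto simp: B_def)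
    moreover have "0 \<le> q\<^sup>2 / real d * cat_weight (Suc r)" using cat_weight_pos[of "Suc r"] by simp
    moreover have "4 * (1 + 9 * q\<^sup>2 / real d) * cat_weight (Suc r) = 4 * cat_weight (Suc r) + 36 * (q\<^sup>2 / real d * cat_weight (Suc r))"
      "28 * q\<^sup>2 / real d * cat_weight (Suc r) = 28 * (q\<^sup>2 / real d * cat_weight (Suc r))"
      "2 * q\<^sup>2 / real d * cat_weight (Suc r) = 2 * (q\<^sup>2 / real d * cat_weight (Suc r))" by (simp_all add: algebra_simps)
    ultimately show ?thesis using 1 2 3 merge unfolding t q_def[symmetric] by linarith
  qed
qed

text \<open>All products of traces are bounded at once, since the recursion does not close on single
  traces. The induction is on total degree plus number of traces: a splitting adds one trace but
  lowers the degree by two. The square of \<open>\<sigma>\<close> collects the factor 2 card I of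
  the recursion, one power of d, and the factor of \<open>trace_weight_step\<close>.\<close>

lemma mtr_bound:
  fixes d p k :: nat and ls :: "nat list"
  assumes d: "d \<ge> 1" and p: "p + 1 \<le> 7 * d" and \<theta>: "\<theta> > 0" "\<theta>\<^sup>2 * (real d * (real p + 1)) = 1"
    and I: "I \<subseteq> {1..k}"
    and \<sigma>: "\<sigma> \<ge> 0" "\<sigma>\<^sup>2 = 8 * real (card I) * real d * (1 + 9 * (real p + 1)\<^sup>2 / real d)"
    and len: "sum_list ls \<le> 2 * p"
  shows "mtr d k I ls \<le> prod_list (map (\<lambda>l. real d * trace_weight \<theta> l) ls) * \<sigma> ^ sum_list ls"
  using len
proof (induction "sum_list ls + length ls" arbitrary: ls rule: less_induct)
  case less
  let ?P = "\<lambda>ls. prod_list (map (\<lambda>l. real d * trace_weight \<theta> l) ls)"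
  have d0: "real d > 0" using d by simp
  have wpos: "trace_weight \<theta> m > 0" for m using \<theta> cat_weight_pos by (simp add: trace_weight_def)
  have Ppos: "?P ms > 0" for ms using d0 wpos by (induction ms) auto
  show ?case
  proof (cases ls)
    case Nil
    then show ?thesis by (simp add: mtr_def ptr_prod_def avg_const sample_space_finite sample_space_nonempty)
  next
    case (Cons l ms)
    show ?thesis
    proof (cases l)
      case 0
      have "ptr d 0 H = real d" for H by (simp add: ptr_def trw_def)
      then have "mtr d k I ls = real d * mtr d k I ms"
        using Cons 0 by (simp add: mtr_def ptr_prod_def avg_cmult)
      also have "\<dots> \<le> real d * (?P ms * \<sigma> ^ sum_list ms)"
        using less.hyps[of ms] less.prems Cons d0 by (intro mult_left_mono) auto
      finally show ?thesis using Cons 0 by (simp add: trace_weight_def)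
    next
      case (Suc n)
      define S where "S = sum_list ms"
      define e where "e = n + S - 1"
      have lenS: "Suc n + S \<le> 2 * p" using less.prems Cons Suc by (simp add: S_def)
      let ?K = "?P ms * \<sigma> ^ e"
      have K0: "?K \<ge> 0" using Ppos[of ms] \<sigma> by simp
      have 1: "mtr d k I (u # (n - 1 - u) # ms) \<le> (real d)\<^sup>2 * (trace_weight \<theta> u * trace_weight \<theta> (n - 1 - u)) * ?K"
        if u: "u < n" for u
      proof -
        have "mtr d k I (u # (n - 1 - u) # ms) \<le> ?P (u # (n - 1 - u) # ms) * \<sigma> ^ sum_list (u # (n - 1 - u) # ms)"
          by (rule less.hyps) (use u less.prems Cons Suc in auto)
        moreover have "sum_list (u # (n - 1 - u) # ms) = e" using u by (simp add: e_def S_def)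
        ultimately show ?thesis by (simp add: power2_eq_square mult_ac)
      qed
      have 2: "real n * mtr d k I ((n - 1) # ms) \<le> (real d)\<^sup>2 * (real n / real d * trace_weight \<theta> (n - 1)) * ?K"
      proof (cases "n = 0")
        case False
        have "mtr d k I ((n - 1) # ms) \<le> ?P ((n - 1) # ms) * \<sigma> ^ sum_list ((n - 1) # ms)"
          by (rule less.hyps) (use less.prems Cons Suc in auto)
        moreover have "sum_list ((n - 1) # ms) = e" using False by (simp add: e_def S_def)
        ultimately have "real n * mtr d k I ((n - 1) # ms) \<le> real n * (real d * trace_weight \<theta> (n - 1) * ?K)"
          by (intro mult_left_mono) (auto simp: mult_ac)
        then show ?thesis using d0 by (simp add: power2_eq_square mult_ac)
      qed simp
      have 3: "2 * real (ms ! j) * mtr d k I ((n + ms ! j - 1) # take j ms @ drop (Suc j) ms)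
         \<le> (real d)\<^sup>2 * (2 * real (ms ! j) / (real d)\<^sup>2 * (trace_weight \<theta> (n + ms ! j - 1) / trace_weight \<theta> (ms ! j))) * ?K"
        if j: "j < length ms" for j
      proof (cases "ms ! j = 0")
        case False
        let ?m = "ms ! j" and ?r = "take j ms @ drop (Suc j) ms"
        have dec: "ms = take j ms @ ?m # drop (Suc j) ms" using j by (rule id_take_nth_drop)
        have s: "sum_list ms = ?m + sum_list ?r" by (subst dec) simp
        have P: "?P ms = real d * trace_weight \<theta> ?m * ?P ?r" by (subst dec) simp
        have "length ms = Suc (length ?r)" using j by simp
        then have "mtr d k I ((n + ?m - 1) # ?r) \<le> ?P ((n + ?m - 1) # ?r) * \<sigma> ^ sum_list ((n + ?m - 1) # ?r)"
          using less.prems Cons Suc s False by (intro less.hyps) auto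
        moreover have "sum_list ((n + ?m - 1) # ?r) = e" using s False by (simp add: e_def S_def)
        ultimately have "mtr d k I ((n + ?m - 1) # ?r) \<le> real d * trace_weight \<theta> (n + ?m - 1) * ?P ?r * \<sigma> ^ e"
          by simp
        also have "\<dots> = trace_weight \<theta> (n + ?m - 1) / trace_weight \<theta> ?m * ?K"
          unfolding P using wpos[of ?m] by simp
        finally have "2 * real ?m * mtr d k I ((n + ?m - 1) # ?r) \<le> 2 * real ?m * (trace_weight \<theta> (n + ?m - 1) / trace_weight \<theta> ?m * ?K)"
          by (intro mult_left_mono) auto
        then show ?thesis using d0 by simp
      qed simp
      let ?T = "(\<Sum>u<n. trace_weight \<theta> u * trace_weight \<theta> (n - 1 - u)) + real n / real d * trace_weight \<theta> (n - 1)
         + (\<Sum>m\<leftarrow>ms. 2 * real m / (real d)\<^sup>2 * (trace_weight \<theta> (n + m - 1) / trace_weight \<theta> m))"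
      have T: "?T \<le> 4 * (1 + 9 * (real p + 1)\<^sup>2 / real d) * trace_weight \<theta> (Suc n)"
        by (rule trace_weight_step) (use d p \<theta> lenS S_def in auto)
      have sl: "(\<Sum>m\<leftarrow>ms. 2 * real m / (real d)\<^sup>2 * (trace_weight \<theta> (n + m - 1) / trace_weight \<theta> m))
         = (\<Sum>j<length ms. 2 * real (ms ! j) / (real d)\<^sup>2 * (trace_weight \<theta> (n + ms ! j - 1) / trace_weight \<theta> (ms ! j)))"
        by (simp add: sum_list_sum_nth atLeast0LessThan)
      have "mtr d k I ls \<le> 2 * real (card I) * ((\<Sum>u<n. mtr d k I (u # (n - 1 - u) # ms)) + real n * mtr d k I ((n - 1) # ms)
        + (\<Sum>j<length ms. 2 * real (ms ! j) * mtr d k I ((n + ms ! j - 1) # take j ms @ drop (Suc j) ms)))"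
        unfolding Cons Suc by (rule mtr_recursion[OF I])
      also have "\<dots> \<le> 2 * real (card I) * ((\<Sum>u<n. (real d)\<^sup>2 * (trace_weight \<theta> u * trace_weight \<theta> (n - 1 - u)) * ?K)
        + (real d)\<^sup>2 * (real n / real d * trace_weight \<theta> (n - 1)) * ?K
        + (\<Sum>j<length ms. (real d)\<^sup>2 * (2 * real (ms ! j) / (real d)\<^sup>2 * (trace_weight \<theta> (n + ms ! j - 1) / trace_weight \<theta> (ms ! j))) * ?K))"
        using 1 2 3 by (intro mult_left_mono add_mono sum_mono) auto
      also have "\<dots> = 2 * real (card I) * (real d)\<^sup>2 * ?K * ?T"
      proof -
        have factor: "(\<Sum>x\<in>A. (real d)\<^sup>2 * f x * ?K) = (real d)\<^sup>2 * (\<Sum>x\<in>A. f x) * ?K" for A :: "nat set" and f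
          by (simp add: sum_distrib_left sum_distrib_right)
        show ?thesis unfolding sl factor by (simp only: distrib_left distrib_right mult.assoc mult.left_commute mult.commute)
      qed
      also have "\<dots> \<le> 2 * real (card I) * (real d)\<^sup>2 * ?K * (4 * (1 + 9 * (real p + 1)\<^sup>2 / real d) * trace_weight \<theta> (Suc n))"
        using K0 by (intro mult_left_mono T) auto
      also have "\<dots> = real d * trace_weight \<theta> (Suc n) * ?P ms * (\<sigma>\<^sup>2 * \<sigma> ^ e)"
        unfolding \<sigma>(2) by (simp add: power2_eq_square)
      finally have main: "mtr d k I ls \<le> real d * trace_weight \<theta> (Suc n) * ?P ms * (\<sigma>\<^sup>2 * \<sigma> ^ e)" .
      show ?thesis
      proof (cases "n + S = 0")
        case False
        have "sum_list ls = Suc n + S" using Cons Suc by (simp add: S_def)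
        then have "sum_list ls = 2 + e" using False unfolding e_def by arith
        then show ?thesis using main Cons Suc by (simp only: power_add) simp
      next
        \<comment> \<open>Total degree one: the exponent \<open>e\<close> is truncated to 0 here,
          but every term of the loop equation vanishes, so the moment is at most 0.\<close>
        case True
        then have z: "n = 0" "\<forall>m\<in>set ms. m = 0" by (auto simp: S_def)
        then have "(\<Sum>j<length ms. 2 * real (ms ! j) * mtr d k I ((n + ms ! j - 1) # take j ms @ drop (Suc j) ms)) = 0"
          by (intro sum.neutral) auto
        then have "mtr d k I ls \<le> 0" using mtr_recursion[OF I, of d n ms] Cons Suc z by simp
        also have "0 \<le> ?P ls * \<sigma> ^ sum_list ls" using Ppos[of ls] \<sigma> by simp
        finally show ?thesis .
      qed
    qed
  qed
qed

theorem sign_sum_moment: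
  assumes d: "d \<ge> 1" and p: "p + 1 \<le> 7 * d" and I: "I \<subseteq> {1..k}"
  shows "E d k (\<lambda>\<omega>. trw d (replicate (2 * p) (sign_sum I \<omega>)))
     \<le> real d * (8 * real (card I) * real d * (1 + 9 * (real p + 1)\<^sup>2 / real d)) ^ p"
proof -
  define \<theta> where "\<theta> = 1 / sqrt (real d * (real p + 1))"
  define X where "X = 8 * real (card I) * real d * (1 + 9 * (real p + 1)\<^sup>2 / real d)"
  have X0: "X \<ge> 0" unfolding X_def by (intro mult_nonneg_nonneg add_nonneg_nonneg divide_nonneg_nonneg) auto
  have dp: "real d * (real p + 1) > 0" using d by simp
  have "\<theta> > 0" "\<theta>\<^sup>2 * (real d * (real p + 1)) = 1"
    using dp d by (simp_all add: \<theta>_def power_divide)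
  then have "mtr d k I [2 * p] \<le> prod_list (map (\<lambda>l. real d * trace_weight \<theta> l) [2 * p]) * sqrt X ^ sum_list [2 * p]"
    by (intro mtr_bound[OF d p _ _ I]) (use X0 X_def in auto)
  also have "\<dots> = real d * cat_weight p * X ^ p" using X0 by (simp add: trace_weight_def power_mult)
  also have "\<dots> \<le> real d * 1 * X ^ p" using X0 cat_weight_le_1 by (intro mult_right_mono mult_left_mono) auto
  finally show ?thesis by (simp add: mtr_def ptr_prod_def ptr_def X_def)
qed

section \<open>Matching first and second moments\<close>

definition proj :: "nat \<Rightarrow> rmat" where
  "proj d a b = of_bool (a = b) - 1 / real d"

definition perm_part :: "nat \<Rightarrow> nat \<Rightarrow> outcome \<Rightarrow> rmat" where
  "perm_part d i \<omega> a b = of_bool (a = fst \<omega> i b) - 1 / real d"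

definition perm_summand :: "nat \<Rightarrow> nat \<Rightarrow> outcome \<Rightarrow> rmat" where
  "perm_summand d i \<omega> a b = perm_part d i \<omega> a b + perm_part d i \<omega> b a"

definition sign_part :: "nat \<Rightarrow> nat \<Rightarrow> outcome \<Rightarrow> rmat" where
  "sign_part d i \<omega> a b = (\<Sum>x<d. \<Sum>y<d. proj d a x * proj d y b * snd \<omega> i x y)"

text \<open>
  The normalisation makes the covariance agree with that of \<open>perm_summand\<close>.
\<close>
definition sign_summand :: "nat \<Rightarrow> nat \<Rightarrow> outcome \<Rightarrow> rmat" where
  "sign_summand d i \<omega> a b = (sign_part d i \<omega> a b + sign_part d i \<omega> b a) / sqrt (real d - 1)"

text \<open>\<open>Z\<close> does not see the randomness of slot \<open>r\<close>. Moments of slot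
  \<open>r\<close> against an arbitrary such \<open>Z\<close> play the role of independence between
  the slots.\<close>

definition off_slot :: "nat \<Rightarrow> (outcome \<Rightarrow> 'b) \<Rightarrow> bool" where
  "off_slot r Z \<longleftrightarrow> (\<forall>\<pi> \<epsilon> \<sigma> \<eta>. Z (\<pi>(r := \<sigma>), \<epsilon>(r := \<eta>)) = Z (\<pi>, \<epsilon>))"

lemma symm_proj: "symm (proj d)" by (auto simp: symm_def proj_def)
lemma symm_perm_summand: "symm (perm_summand d i \<omega>)" by (simp add: symm_def perm_summand_def add.commute)
lemma symm_sign_summand: "symm (sign_summand d i \<omega>)" by (simp add: symm_def sign_summand_def add.commute)

lemma proj_idem: "d \<ge> 1 \<Longrightarrow> a < d \<Longrightarrow> c < d \<Longrightarrow> (\<Sum>x<d. proj d a x * proj d x c) = proj d a c"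
proof -
  assume a: "d \<ge> 1" "a < d" "c < d"
  have "(\<Sum>x<d. proj d a x * proj d x c) = (\<Sum>x<d. (if x = a then of_bool (x = c) - 1 / real d else 0)
      - (if x = c then 1 / real d else 0) + 1 / (real d)\<^sup>2)"
    by (rule sum.cong) (auto simp: proj_def algebra_simps power2_eq_square)
  also have "\<dots> = proj d a c" using a
    by (simp add: sum.distrib sum_subtractf proj_def power2_eq_square)
  finally show ?thesis .
qed

fun swap_slot :: "nat \<Rightarrow> nat \<Rightarrow> nat \<Rightarrow> outcome \<Rightarrow> outcome" where
  "swap_slot r a c (\<pi>, \<epsilon>) = (\<pi>(r := Transposition.transpose a c \<circ> \<pi> r), \<epsilon>)"

lemma double_sum_product:
  fixes f g :: "'a \<Rightarrow> 'b \<Rightarrow> real"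
  shows "(\<Sum>x\<in>A. \<Sum>y\<in>B. f x y) * (\<Sum>x'\<in>C. \<Sum>y'\<in>D. g x' y') * z
    = (\<Sum>x\<in>A. \<Sum>y\<in>B. \<Sum>x'\<in>C. \<Sum>y'\<in>D. f x y * g x' y' * z)"
proof -
  have "(\<Sum>x\<in>A. \<Sum>y\<in>B. f x y) * (\<Sum>x'\<in>C. \<Sum>y'\<in>D. g x' y') * z
    = (\<Sum>x\<in>A. \<Sum>y\<in>B. f x y * ((\<Sum>x'\<in>C. \<Sum>y'\<in>D. g x' y') * z))"
    unfolding mult.assoc by (subst sum_distrib_right, rule sum.cong[OF refl], rule sum_distrib_right)
  also have "\<dots> = (\<Sum>x\<in>A. \<Sum>y\<in>B. \<Sum>x'\<in>C. \<Sum>y'\<in>D. f x y * g x' y' * z)"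
    by (simp add: sum_distrib_left sum_distrib_right mult.assoc)
  finally show ?thesis .
qed

context
  fixes d k r :: nat
  assumes r: "r \<in> {1..k}" and d: "d \<ge> 2"
begin

abbreviation "EE \<equiv> avg (sample_space d k)"

lemma off_slot_flip:
  assumes "off_slot r Z"
  shows "Z (flip (r, a, b) \<omega>) = Z \<omega>"
proof (cases \<omega>)
  case (Pair \<pi> \<epsilon>)
  have "Z (\<pi>(r := \<pi> r), \<epsilon>(r := (\<epsilon> r)(a := (\<epsilon> r a)(b := - \<epsilon> r a b)))) = Z (\<pi>, \<epsilon>)"
    using assms unfolding off_slot_def by blast
  then show ?thesis using Pair by simp
qed

lemma off_slot_swap:
  assumes "off_slot r Z"
  shows "Z (swap_slot r a c \<omega>) = Z \<omega>"
proof (cases \<omega>)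
  case (Pair \<pi> \<epsilon>)
  have "Z (\<pi>(r := Transposition.transpose a c \<circ> \<pi> r), \<epsilon>(r := \<epsilon> r)) = Z (\<pi>, \<epsilon>)"
    using assms unfolding off_slot_def by blast
  then show ?thesis using Pair by simp
qed

lemma sgv_slot_mean:
  assumes "off_slot r Z" "a < d" "b < d"
  shows "EE (\<lambda>\<omega>. snd \<omega> r a b * Z \<omega>) = 0"
proof -
  have v: "(r, a, b) \<in> sign_vars d k" using r assms by (simp add: sign_vars_def)
  have "EE (\<lambda>\<omega>. sgv (r, a, b) \<omega> * Z \<omega>) = EE (\<lambda>\<omega>. - (sgv (r, a, b) \<omega> * Z \<omega>))"
    by (subst avg_flip[OF v, symmetric]) (simp add: sgv_flip off_slot_flip[OF assms(1)] del: sgv.simps flip.simps)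
  then show ?thesis by (simp add: avg_minus)
qed

lemma sgv_slot_cov:
  assumes "off_slot r Z" "a < d" "b < d" "c < d" "e < d"
  shows "EE (\<lambda>\<omega>. snd \<omega> r a b * snd \<omega> r c e * Z \<omega>) = of_bool (a = c \<and> b = e) * EE Z"
proof (cases "a = c \<and> b = e")
  case True
  have v: "(r, a, b) \<in> sign_vars d k" using r assms by (simp add: sign_vars_def)
  have "EE (\<lambda>\<omega>. snd \<omega> r a b * snd \<omega> r c e * Z \<omega>) = EE Z"
    by (rule avg_cong) (use sgv_square[OF v] True in auto)
  then show ?thesis using True by simp
next
  case False
  have v: "(r, a, b) \<in> sign_vars d k" using r assms by (simp add: sign_vars_def)
  have ne: "(r, c, e) \<noteq> (r, a, b)" using False by auto
  have "EE (\<lambda>\<omega>. sgv (r, a, b) \<omega> * sgv (r, c, e) \<omega> * Z \<omega>) = EE (\<lambda>\<omega>. - (sgv (r, a, b) \<omega> * sgv (r, c, e) \<omega> * Z \<omega>))"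
  proof -
    have "sgv (r, c, e) (flip (r, a, b) \<omega>) = sgv (r, c, e) \<omega>" for \<omega>
      unfolding sgv_flip if_not_P[OF ne] ..
    moreover have "sgv (r, a, b) (flip (r, a, b) \<omega>) = - sgv (r, a, b) \<omega>" for \<omega>
      unfolding sgv_flip if_P[OF refl] ..
    ultimately show ?thesis
      by (subst avg_flip[OF v, symmetric]) (simp add: off_slot_flip[OF assms(1)] del: sgv.simps flip.simps)
  qed
  then show ?thesis using False by (simp add: avg_minus)
qed

lemma sign_part_mean:
  assumes "off_slot r Z"
  shows "EE (\<lambda>\<omega>. sign_part d r \<omega> a b * Z \<omega>) = 0"
proof -
  have "EE (\<lambda>\<omega>. sign_part d r \<omega> a b * Z \<omega>)
     = (\<Sum>x<d. \<Sum>y<d. proj d a x * proj d y b * EE (\<lambda>\<omega>. snd \<omega> r x y * Z \<omega>))"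
    unfolding avg_cmult[symmetric] avg_sum[symmetric] sign_part_def
    by (simp add: sum_distrib_right mult.assoc)
  then show ?thesis by (simp add: sgv_slot_mean[OF assms])
qed

lemma sign_part_cov:
  assumes "off_slot r Z" "a < d" "b < d" "c < d" "e < d"
  shows "EE (\<lambda>\<omega>. sign_part d r \<omega> a b * sign_part d r \<omega> c e * Z \<omega>) = proj d a c * proj d b e * EE Z"
proof -
  have "EE (\<lambda>\<omega>. sign_part d r \<omega> a b * sign_part d r \<omega> c e * Z \<omega>)
     = (\<Sum>x<d. \<Sum>y<d. \<Sum>x'<d. \<Sum>y'<d. (proj d a x * proj d y b) * (proj d c x' * proj d y' e) *
           EE (\<lambda>\<omega>. snd \<omega> r x y * snd \<omega> r x' y' * Z \<omega>))"
    unfolding avg_cmult[symmetric] avg_sum[symmetric] sign_part_def double_sum_product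
    by (simp add: mult_ac)
  also have "\<dots> = (\<Sum>x<d. \<Sum>y<d. (proj d a x * proj d x c) * (proj d b y * proj d y e) * EE Z)"
  proof (intro sum.cong refl)
    fix x y assume xy: "x \<in> {..<d}" "y \<in> {..<d}"
    have "(\<Sum>x'<d. \<Sum>y'<d. (proj d a x * proj d y b) * (proj d c x' * proj d y' e) *
           EE (\<lambda>\<omega>. snd \<omega> r x y * snd \<omega> r x' y' * Z \<omega>))
       = (\<Sum>x'<d. \<Sum>y'<d. if x' = x then (if y' = y then (proj d a x * proj d y b) * (proj d c x' * proj d y' e) * EE Z else 0) else 0)"
      using xy by (intro sum.cong refl) (auto simp: sgv_slot_cov[OF assms(1)])
    also have "\<dots> = (\<Sum>x'<d. if x' = x then (\<Sum>y'<d. if y' = y then (proj d a x * proj d y b) * (proj d c x' * proj d y' e) * EE Z else 0) else 0)"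
      by (intro sum.cong refl) auto
    also have "\<dots> = (proj d a x * proj d y b) * (proj d c x * proj d y e) * EE Z"
      using xy by simp
    finally show "(\<Sum>x'<d. \<Sum>y'<d. (proj d a x * proj d y b) * (proj d c x' * proj d y' e) *
           EE (\<lambda>\<omega>. snd \<omega> r x y * snd \<omega> r x' y' * Z \<omega>)) = (proj d a x * proj d x c) * (proj d b y * proj d y e) * EE Z"
      using symm_proj[of d] by (simp add: symm_def)
  qed
  also have "\<dots> = (\<Sum>x<d. proj d a x * proj d x c) * (\<Sum>y<d. proj d b y * proj d y e) * EE Z"
    by (subst sum_product) (simp add: sum_distrib_right)
  finally show ?thesis using assms d by (simp add: proj_idem)
qed

lemma sign_summand_mean:
  assumes "off_slot r Z"
  shows "EE (\<lambda>\<omega>. sign_summand d r \<omega> a b * Z \<omega>) = 0"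
proof -
  have "EE (\<lambda>\<omega>. sign_summand d r \<omega> a b * Z \<omega>)
     = 1 / sqrt (real d - 1) * (EE (\<lambda>\<omega>. sign_part d r \<omega> a b * Z \<omega>) + EE (\<lambda>\<omega>. sign_part d r \<omega> b a * Z \<omega>))"
    unfolding avg_add[symmetric] avg_cmult[symmetric] by (simp add: sign_summand_def add_divide_distrib algebra_simps)
  then show ?thesis by (simp add: sign_part_mean[OF assms])
qed

text \<open>The common covariance of the entries of the permutation summand and of the sign
  summand.\<close>

definition slot_cov :: "nat \<Rightarrow> nat \<Rightarrow> nat \<Rightarrow> nat \<Rightarrow> real" where
  "slot_cov a b c e = 2 * (proj d a c * proj d b e + proj d a e * proj d b c) / (real d - 1)"

lemma sign_summand_cov:
  assumes "off_slot r Z" "a < d" "b < d" "c < d" "e < d"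
  shows "EE (\<lambda>\<omega>. sign_summand d r \<omega> a b * sign_summand d r \<omega> c e * Z \<omega>) = slot_cov a b c e * EE Z"
proof -
  have "sqrt (real d - 1) * sqrt (real d - 1) = real d - 1" using d by simp
  then have "sign_summand d r \<omega> a b * sign_summand d r \<omega> c e * Z \<omega>
     = 1 / (real d - 1) * (sign_part d r \<omega> a b * sign_part d r \<omega> c e * Z \<omega> + sign_part d r \<omega> a b * sign_part d r \<omega> e c * Z \<omega>
      + (sign_part d r \<omega> b a * sign_part d r \<omega> c e * Z \<omega> + sign_part d r \<omega> b a * sign_part d r \<omega> e c * Z \<omega>))" for \<omega>
    by (simp add: sign_summand_def) (simp add: algebra_simps)
  then have "EE (\<lambda>\<omega>. sign_summand d r \<omega> a b * sign_summand d r \<omega> c e * Z \<omega>)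
     = 1 / (real d - 1) * (proj d a c * proj d b e * EE Z + proj d a e * proj d b c * EE Z
       + (proj d b c * proj d a e * EE Z + proj d b e * proj d a c * EE Z))"
    by (simp only: avg_cmult avg_add sign_part_cov assms)
  then show ?thesis by (simp add: slot_cov_def algebra_simps add_divide_distrib)
qed

lemma swap_in_space:
  assumes "\<omega> \<in> sample_space d k" "a < d" "c < d"
  shows "swap_slot r a c \<omega> \<in> sample_space d k"
proof (cases \<omega>)
  case (Pair \<pi> \<epsilon>)
  have \<pi>: "\<pi> \<in> {1..k} \<rightarrow>\<^sub>E perms d" using assms Pair by (simp add: sample_space_def)
  then have "\<pi> r \<in> perms d" using r by (rule PiE_mem)
  then have "Transposition.transpose a c \<circ> \<pi> r \<in> perms d"
    using assms by (auto simp: perms_def intro!: permutes_compose permutes_swap_id)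
  then show ?thesis using \<pi> r assms Pair by (auto simp: sample_space_def PiE_iff extensional_def)
qed

lemma swap_swap: "swap_slot r a c (swap_slot r a c \<omega>) = \<omega>"
  by (cases \<omega>) (auto simp: fun_eq_iff)

lemma avg_swap:
  assumes "a < d" "c < d"
  shows "EE (\<lambda>\<omega>. g (swap_slot r a c \<omega>)) = EE g"
  by (rule avg_involution) (use assms in \<open>auto simp: swap_in_space swap_swap\<close>)

lemma fst_swap: "fst (swap_slot r a c \<omega>) r b = Transposition.transpose a c (fst \<omega> r b)"
  by (cases \<omega>) auto

lemma perm_slot_lt: "\<omega> \<in> sample_space d k \<Longrightarrow> b < d \<Longrightarrow> fst \<omega> r b < d"
proof -
  assume a: "\<omega> \<in> sample_space d k" "b < d"
  then have "fst \<omega> \<in> {1..k} \<rightarrow>\<^sub>E perms d" by (auto simp: sample_space_def)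
  then have "fst \<omega> r \<in> perms d" using r by (rule PiE_mem)
  then show ?thesis using a permutes_in_image[of "fst \<omega> r" "{..<d}" b] by (auto simp: perms_def)
qed

lemma perm_slot_inj: "\<omega> \<in> sample_space d k \<Longrightarrow> fst \<omega> r b = fst \<omega> r e \<Longrightarrow> b = e"
proof -
  assume a: "\<omega> \<in> sample_space d k" "fst \<omega> r b = fst \<omega> r e"
  then have "fst \<omega> \<in> {1..k} \<rightarrow>\<^sub>E perms d" by (auto simp: sample_space_def)
  then have "fst \<omega> r \<in> perms d" using r by (rule PiE_mem)
  then show ?thesis using a permutes_inj[of "fst \<omega> r" "{..<d}"] by (auto simp: perms_def inj_def)
qed

text \<open>Composing with the transposition of \<open>a\<close> and \<open>a'\<close> shows that
  all d positions in the column have the same mean, and these add up to the mean of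
  \<open>Z\<close>.\<close>

lemma perm_slot_mean:
  assumes Z: "off_slot r Z" and ab: "a < d" "b < d"
  shows "EE (\<lambda>\<omega>. of_bool (a = fst \<omega> r b) * Z \<omega>) = EE Z / real d"
proof -
  have const: "EE (\<lambda>\<omega>. of_bool (a' = fst \<omega> r b) * Z \<omega>) = EE (\<lambda>\<omega>. of_bool (a = fst \<omega> r b) * Z \<omega>)" if "a' < d" for a'
  proof -
    have "EE (\<lambda>\<omega>. of_bool (a = fst \<omega> r b) * Z \<omega>)
       = EE (\<lambda>\<omega>. of_bool (a = fst (swap_slot r a a' \<omega>) r b) * Z (swap_slot r a a' \<omega>))"
      using avg_swap[of a a' "\<lambda>\<omega>. of_bool (a = fst \<omega> r b) * Z \<omega>"] ab that by simp
    also have "\<dots> = EE (\<lambda>\<omega>. of_bool (a' = fst \<omega> r b) * Z \<omega>)"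
    proof -
      have "a = Transposition.transpose a a' x \<longleftrightarrow> a' = x" for x by (auto simp: Transposition.transpose_def)
      then show ?thesis unfolding fst_swap off_slot_swap[OF Z] by simp
    qed
    finally show ?thesis by simp
  qed
  have "EE Z = EE (\<lambda>\<omega>. \<Sum>a'<d. of_bool (a' = fst \<omega> r b) * Z \<omega>)"
  proof (rule avg_cong)
    fix \<omega> assume \<omega>: "\<omega> \<in> sample_space d k"
    have "(\<Sum>a'<d. of_bool (a' = fst \<omega> r b) * Z \<omega>) = (\<Sum>a'<d. if a' = fst \<omega> r b then Z \<omega> else 0)"
      by (rule sum.cong) auto
    then show "Z \<omega> = (\<Sum>a'<d. of_bool (a' = fst \<omega> r b) * Z \<omega>)" using perm_slot_lt[OF \<omega> ab(2)] by simp
  qed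
  also have "\<dots> = real d * EE (\<lambda>\<omega>. of_bool (a = fst \<omega> r b) * Z \<omega>)"
    unfolding avg_sum using const by simp
  finally show ?thesis using d by simp
qed

text \<open>For two distinct columns, transposing \<open>c\<close> and \<open>c'\<close> leaves
  \<open>a\<close> alone, so the d - 1 values of \<open>c\<close> other than \<open>a\<close> share
  one mean; they add up to the mean for one column.\<close>

lemma perm_slot_pair:
  assumes Z: "off_slot r Z" and ab: "a < d" "b < d" "c < d" "e < d"
  shows "EE (\<lambda>\<omega>. of_bool (a = fst \<omega> r b) * of_bool (c = fst \<omega> r e) * Z \<omega>) =
     (if b = e then of_bool (a = c) / real d else of_bool (a \<noteq> c) / (real d * (real d - 1))) * EE Z"
proof (cases "b = e")
  case True
  have "EE (\<lambda>\<omega>. of_bool (a = fst \<omega> r b) * of_bool (c = fst \<omega> r e) * Z \<omega>)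
     = EE (\<lambda>\<omega>. of_bool (a = c) * (of_bool (a = fst \<omega> r b) * Z \<omega>))"
    by (rule avg_cong) (use True in auto)
  then show ?thesis using True by (simp add: avg_cmult perm_slot_mean[OF Z] ab)
next
  case False
  show ?thesis
  proof (cases "a = c")
    case True
    have "EE (\<lambda>\<omega>. of_bool (a = fst \<omega> r b) * of_bool (c = fst \<omega> r e) * Z \<omega>) = EE (\<lambda>\<omega>. 0)"
      by (rule avg_cong) (use True False perm_slot_inj in auto)
    then show ?thesis using True False by (simp add: avg_def)
  next
    case ac: False
    let ?Q = "\<lambda>c. EE (\<lambda>\<omega>. of_bool (a = fst \<omega> r b) * of_bool (c = fst \<omega> r e) * Z \<omega>)"
    have const: "?Q c' = ?Q c" if c': "c' < d" "c' \<noteq> a" for c'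
    proof -
      have "?Q c = EE (\<lambda>\<omega>. of_bool (a = fst (swap_slot r c c' \<omega>) r b) * of_bool (c = fst (swap_slot r c c' \<omega>) r e) * Z (swap_slot r c c' \<omega>))"
        using avg_swap[of c c' "\<lambda>\<omega>. of_bool (a = fst \<omega> r b) * of_bool (c = fst \<omega> r e) * Z \<omega>"] ab c' by simp
      also have "\<dots> = ?Q c'"
      proof -
        have "a = Transposition.transpose c c' x \<longleftrightarrow> a = x" "c = Transposition.transpose c c' x \<longleftrightarrow> c' = x" for x
          using c' ac by (auto simp: Transposition.transpose_def)
        then show ?thesis unfolding fst_swap off_slot_swap[OF Z] by simp
      qed
      finally show ?thesis by simp
    qed
    have zero: "?Q a = 0"
    proof -
      have "?Q a = EE (\<lambda>\<omega>. 0)"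
        by (rule avg_cong) (use False perm_slot_inj in auto)
      then show ?thesis by (simp add: avg_def)
    qed
    have "EE Z / real d = EE (\<lambda>\<omega>. of_bool (a = fst \<omega> r b) * Z \<omega>)" using perm_slot_mean[OF Z] ab by simp
    also have "\<dots> = EE (\<lambda>\<omega>. \<Sum>c'<d. of_bool (a = fst \<omega> r b) * of_bool (c' = fst \<omega> r e) * Z \<omega>)"
    proof (rule avg_cong)
      fix \<omega> assume \<omega>: "\<omega> \<in> sample_space d k"
      have "(\<Sum>c'<d. of_bool (a = fst \<omega> r b) * of_bool (c' = fst \<omega> r e) * Z \<omega>) = (\<Sum>c'<d. if c' = fst \<omega> r e then of_bool (a = fst \<omega> r b) * Z \<omega> else 0)"
        by (rule sum.cong) auto
      then show "of_bool (a = fst \<omega> r b) * Z \<omega> = (\<Sum>c'<d. of_bool (a = fst \<omega> r b) * of_bool (c' = fst \<omega> r e) * Z \<omega>)"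
        using perm_slot_lt[OF \<omega> ab(4)] by simp
    qed
    also have "\<dots> = (\<Sum>c'<d. ?Q c')" by (rule avg_sum)
    also have "\<dots> = ?Q a + (\<Sum>c'\<in>{..<d} - {a}. ?Q c')" using ab by (intro sum.remove) auto
    also have "(\<Sum>c'\<in>{..<d} - {a}. ?Q c') = (\<Sum>c'\<in>{..<d} - {a}. ?Q c)" by (rule sum.cong) (use const in auto)
    finally have "EE Z / real d = (real d - 1) * ?Q c" using zero ab d by (simp add: of_nat_diff)
    then have "?Q c = 1 / (real d * (real d - 1)) * EE Z" using d by (simp add: field_simps)
    then show ?thesis using False ac by simp
  qed
qed

lemma perm_part_mean:
  assumes Z: "off_slot r Z" and ab: "a < d" "b < d"
  shows "EE (\<lambda>\<omega>. perm_part d r \<omega> a b * Z \<omega>) = 0"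
  unfolding perm_part_def left_diff_distrib avg_diff avg_cmult using perm_slot_mean[OF assms] by simp

text \<open>After centring, the four cases of the pair law collapse to a product of two projections
  over d - 1. This identity dictates the sign model: compression from both sides and the factor
  1/sqrt (d - 1).\<close>

lemma perm_part_cov:
  assumes Z: "off_slot r Z" and ab: "a < d" "b < d" "c < d" "e < d"
  shows "EE (\<lambda>\<omega>. perm_part d r \<omega> a b * perm_part d r \<omega> c e * Z \<omega>) = proj d a c * proj d b e / (real d - 1) * EE Z"
proof -
  have "perm_part d r \<omega> a b * perm_part d r \<omega> c e * Z \<omega> = of_bool (a = fst \<omega> r b) * of_bool (c = fst \<omega> r e) * Z \<omega>
     - 1 / real d * (of_bool (a = fst \<omega> r b) * Z \<omega>) - 1 / real d * (of_bool (c = fst \<omega> r e) * Z \<omega>) + 1 / real d * (1 / real d * Z \<omega>)" for \<omega>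
    by (simp add: perm_part_def algebra_simps)
  then have "EE (\<lambda>\<omega>. perm_part d r \<omega> a b * perm_part d r \<omega> c e * Z \<omega>)
     = (if b = e then of_bool (a = c) / real d else of_bool (a \<noteq> c) / (real d * (real d - 1))) * EE Z
       - 1 / real d * (EE Z / real d) - 1 / real d * (EE Z / real d) + 1 / real d * (1 / real d * EE Z)"
    by (simp only: avg_add avg_diff avg_cmult perm_slot_pair[OF assms] perm_slot_mean[OF Z] ab)
  also have "\<dots> = ((if b = e then of_bool (a = c) / real d else of_bool (a \<noteq> c) / (real d * (real d - 1))) - 1 / (real d)\<^sup>2) * EE Z"
    by (simp add: algebra_simps power2_eq_square)
  also have "(if b = e then of_bool (a = c) / real d else of_bool (a \<noteq> c) / (real d * (real d - 1))) - 1 / (real d)\<^sup>2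
     = proj d a c * proj d b e / (real d - 1)"
  proof -
    define x where "x = real d - 1"
    have x: "real d = x + 1" "x > 0" using d by (auto simp: x_def)
    then have "x + 1 \<noteq> 0" "x \<noteq> 0" by auto
    then show ?thesis unfolding proj_def x
      by (simp add: divide_simps) (simp add: algebra_simps power2_eq_square)
  qed
  finally show ?thesis .
qed

lemma perm_summand_mean:
  assumes Z: "off_slot r Z" and ab: "a < d" "b < d"
  shows "EE (\<lambda>\<omega>. perm_summand d r \<omega> a b * Z \<omega>) = 0"
  unfolding perm_summand_def distrib_right avg_add by (simp add: perm_part_mean Z ab)

lemma perm_summand_cov:
  assumes Z: "off_slot r Z" and ab: "a < d" "b < d" "c < d" "e < d"
  shows "EE (\<lambda>\<omega>. perm_summand d r \<omega> a b * perm_summand d r \<omega> c e * Z \<omega>) = slot_cov a b c e * EE Z"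
proof -
  have "EE (\<lambda>\<omega>. perm_summand d r \<omega> a b * perm_summand d r \<omega> c e * Z \<omega>)
     = proj d a c * proj d b e / (real d - 1) * EE Z + proj d b c * proj d a e / (real d - 1) * EE Z
       + (proj d a e * proj d b c / (real d - 1) * EE Z + proj d b e * proj d a c / (real d - 1) * EE Z)"
    unfolding perm_summand_def by (simp only: distrib_left distrib_right avg_add perm_part_cov assms)
  then show ?thesis by (simp add: slot_cov_def algebra_simps add_divide_distrib)
qed

end

section \<open>Replacing one summand\<close>

text \<open>A word over the booleans records one term of the expansion of a power of a sum;
  \<open>True\<close> marks the summand of the slot being replaced, \<open>False\<close> the
  rest.\<close>

abbreviation bool_words :: "nat \<Rightarrow> bool list set" where
  "bool_words n \<equiv> {w. length w = n}"

lemma finite_bool_words: "finite (bool_words n)"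
  using finite_lists_length_eq[of "UNIV :: bool set" n] by simp

lemma sum_bool_words_Suc:
  "(\<Sum>w\<in>bool_words (Suc n). f w) = (\<Sum>w\<in>bool_words n. f (True # w) + f (False # w) :: real)"
proof -
  have e: "bool_words (Suc n) = Cons True ` bool_words n \<union> Cons False ` bool_words n"
    by (auto simp: length_Suc_conv image_iff)
  have "(\<Sum>w\<in>bool_words (Suc n). f w) = (\<Sum>w\<in>Cons True ` bool_words n. f w) + (\<Sum>w\<in>Cons False ` bool_words n. f w)"
    unfolding e by (rule sum.union_disjoint) (auto simp: finite_bool_words)
  also have "\<dots> = (\<Sum>w\<in>bool_words n. f (True # w)) + (\<Sum>w\<in>bool_words n. f (False # w))"
    by (simp add: sum.reindex)
  finally show ?thesis by (simp add: sum.distrib)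
qed

definition madd :: "rmat \<Rightarrow> rmat \<Rightarrow> rmat" where
  "madd A B a b = A a b + B a b"

lemma symm_madd: "symm A \<Longrightarrow> symm B \<Longrightarrow> symm (madd A B)"
  by (simp add: symm_def madd_def)

lemma mprod_madd_expand:
  "mprod d (replicate n (madd Y S)) i j = (\<Sum>w\<in>bool_words n. mprod d (map (\<lambda>b. if b then S else Y) w) i j)"
proof (induction n arbitrary: i)
  case (Suc n)
  have "mprod d (replicate (Suc n) (madd Y S)) i j
     = (\<Sum>l<d. \<Sum>w\<in>bool_words n. S i l * mprod d (map (\<lambda>b. if b then S else Y) w) l j + Y i l * mprod d (map (\<lambda>b. if b then S else Y) w) l j)"
    by (simp add: Suc madd_def sum_distrib_left algebra_simps)
  also have "\<dots> = (\<Sum>w\<in>bool_words n. \<Sum>l<d. S i l * mprod d (map (\<lambda>b. if b then S else Y) w) l j + Y i l * mprod d (map (\<lambda>b. if b then S else Y) w) l j)"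
    by (rule sum.swap)
  finally show ?case by (simp add: sum_bool_words_Suc sum.distrib del: length_Suc_conv)
qed simp

lemma trw_madd_expand:
  "trw d (replicate n (madd Y S)) = (\<Sum>w\<in>bool_words n. trw d (map (\<lambda>b. if b then S else Y) w))"
  unfolding trw_def mprod_madd_expand by (rule sum.swap)

definition cnt :: "bool list \<Rightarrow> nat" where
  "cnt w = length (filter id w)"

lemma cnt_simps [simp]: "cnt [] = 0" "cnt (True # w) = Suc (cnt w)" "cnt (False # w) = cnt w"
  by (simp_all add: cnt_def)

text \<open>A union bound over the positions of \<open>m\<close> letters with weight
  \<open>s\<close>, the other n - m letters being free; the induction follows Pascal's rule.\<close>

lemma word_tail_bound:
  assumes "y \<ge> 0" "s \<ge> 0"
  shows "(\<Sum>w\<in>bool_words n. of_bool (m \<le> cnt w) * prod_list (map (\<lambda>b. if b then s else y) w))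
     \<le> real (n choose m) * s ^ m * (y + s) ^ (n - m)"
proof (induction n arbitrary: m)
  case (Suc n)
  let ?f = "\<lambda>m w. of_bool (m \<le> cnt w) * prod_list (map (\<lambda>b. if b then s else y) w) :: real"
  show ?case
  proof (cases m)
    case 0
    have "(\<Sum>w\<in>bool_words (Suc n). ?f 0 w) = (s + y) * (\<Sum>w\<in>bool_words n. ?f 0 w)"
      by (simp add: sum_bool_words_Suc sum_distrib_left algebra_simps del: length_Suc_conv)
    also have "\<dots> \<le> (s + y) * (y + s) ^ n" using Suc[of 0] assms by (intro mult_left_mono) auto
    finally show ?thesis using 0 by (simp add: add.commute)
  next
    case (Suc m')
    have "(\<Sum>w\<in>bool_words (Suc n). ?f m w) = s * (\<Sum>w\<in>bool_words n. ?f m' w) + y * (\<Sum>w\<in>bool_words n. ?f m w)"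
      by (simp add: sum_bool_words_Suc Suc sum_distrib_left sum.distrib mult_ac del: length_Suc_conv)
    also have "\<dots> \<le> s * (real (n choose m') * s ^ m' * (y + s) ^ (n - m')) + y * (real (n choose m) * s ^ m * (y + s) ^ (n - m))"
      using assms by (intro add_mono mult_left_mono Suc.IH) auto
    also have "\<dots> \<le> real (n choose m') * s ^ m * (y + s) ^ (n - m') + real (n choose m) * s ^ m * (y + s) ^ (n - m')"
    proof (rule add_mono)
      show "s * (real (n choose m') * s ^ m' * (y + s) ^ (n - m')) \<le> real (n choose m') * s ^ m * (y + s) ^ (n - m')"
        by (simp add: Suc)
      show "y * (real (n choose m) * s ^ m * (y + s) ^ (n - m)) \<le> real (n choose m) * s ^ m * (y + s) ^ (n - m')"
      proof (cases "m \<le> n")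
        case True
        then have "n - m' = Suc (n - m)" using Suc by simp
        then have "y * (y + s) ^ (n - m) \<le> (y + s) ^ (n - m')" using assms by (simp add: mult_right_mono)
        then have "(real (n choose m) * s ^ m) * (y * (y + s) ^ (n - m)) \<le> (real (n choose m) * s ^ m) * (y + s) ^ (n - m')"
          using assms by (intro mult_left_mono) auto
        then show ?thesis by (simp add: mult_ac)
      qed (simp add: binomial_eq_0)
    qed
    also have "\<dots> = real (Suc n choose m) * s ^ m * (y + s) ^ (Suc n - m)"
      by (simp add: Suc algebra_simps)
    finally show ?thesis .
  qed
qed (use assms in simp)

lemma cnt_0: "cnt w = 0 \<Longrightarrow> w = replicate (length w) False"
proof (induction w)
  case (Cons b w)
  then show ?case by (cases b) auto
qed simp

lemma cnt_Suc: "cnt w = Suc m \<Longrightarrow> \<exists>u w'. w = replicate u False @ True # w' \<and> cnt w' = m"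
proof (induction w)
  case (Cons b w)
  show ?case
  proof (cases b)
    case True
    then show ?thesis using Cons by (intro exI[of _ 0] exI[of _ w]) auto
  next
    case False
    then obtain u w' where "w = replicate u False @ True # w'" "cnt w' = m" using Cons by auto
    then show ?thesis using False by (intro exI[of _ "Suc u"] exI[of _ w']) auto
  qed
qed simp

lemma trw_cong_middle:
  assumes "\<And>i j. i < d \<Longrightarrow> j < d \<Longrightarrow> mprod d us i j = mprod d vs i j"
  shows "trw d (xs @ us @ ys) = trw d (xs @ vs @ ys)"
proof -
  have "trw d (us @ (ys @ xs)) = trw d (vs @ (ys @ xs))"
    unfolding trw_append by (intro sum.cong refl) (use assms in auto)
  then show ?thesis by (metis append.assoc trw_append_commute)
qed

lemma trw_one_letter: "trw d (xs @ [A] @ ys) = (\<Sum>a<d. \<Sum>b<d. A a b * mprod d (ys @ xs) b a)"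
  by (subst trw_append_commute) (simp add: trw_def)

lemma trw_two_letters:
  "trw d (xs @ [A] @ ys @ [A'] @ zs) =
     (\<Sum>a<d. \<Sum>b<d. \<Sum>c<d. \<Sum>e<d. A a b * A' c e * (mprod d ys b c * mprod d (zs @ xs) e a))"
proof -
  have "trw d (xs @ [A] @ (ys @ [A'] @ zs)) = (\<Sum>a<d. \<Sum>b<d. A a b * mprod d (ys @ (A' # (zs @ xs))) b a)"
    by (subst trw_one_letter) simp
  also have "\<dots> = (\<Sum>a<d. \<Sum>b<d. \<Sum>c<d. \<Sum>e<d. A a b * A' c e * (mprod d ys b c * mprod d (zs @ xs) e a))"
    by (intro sum.cong refl) (simp add: mprod_append[of _ d ys] sum_distrib_left mult_ac)
  finally show ?thesis .
qed

lemma off_slot_mprod: "off_slot r Y \<Longrightarrow> off_slot r (\<lambda>\<omega>. mprod d (replicate n (Y \<omega>)) a b)"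
  by (simp add: off_slot_def)

lemma off_slot_mult: "off_slot r f \<Longrightarrow> off_slot r g \<Longrightarrow> off_slot r (\<lambda>\<omega>. f \<omega> * g \<omega>)"
  by (simp add: off_slot_def)

text \<open>Such a word is a polynomial of degree at most two in the entries of slot
  \<open>r\<close> with off-slot coefficients, so only the mean and the covariance of the summand
  enter.\<close>

lemma etr_bool_word_eq:
  fixes Y :: "outcome \<Rightarrow> rmat"
  assumes r: "r \<in> {1..k}" and d: "d \<ge> 2" and Y: "off_slot r Y" and w: "cnt w \<le> 2"
  shows "etr (sample_space d k) d (map (\<lambda>b. if b then perm_summand d r else Y) w)
       = etr (sample_space d k) d (map (\<lambda>b. if b then sign_summand d r else Y) w)"
proof -
  let ?E = "etr (sample_space d k) d"
  have off: "off_slot r (\<lambda>\<omega>. mprod d (replicate n (Y \<omega>)) a b)" for n a b by (rule off_slot_mprod[OF Y])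
  have one: "?E (replicate u Y @ [A] @ replicate v Y) = 0"
    if "\<And>Z a b. off_slot r Z \<Longrightarrow> a < d \<Longrightarrow> b < d \<Longrightarrow> E d k (\<lambda>\<omega>. A \<omega> a b * Z \<omega>) = 0" for A u v
  proof -
    have "?E (replicate u Y @ [A] @ replicate v Y) = (\<Sum>a<d. \<Sum>b<d. E d k (\<lambda>\<omega>. A \<omega> a b * mprod d (replicate (v + u) (Y \<omega>)) b a))"
      unfolding etr_def avg_sum[symmetric]
      by (rule avg_cong) (simp only: map_append map_replicate list.map trw_one_letter replicate_add)
    then show ?thesis using that off by simp
  qed
  have two: "?E (replicate u Y @ [A] @ replicate v Y @ [A] @ replicate t Y)
     = (\<Sum>a<d. \<Sum>b<d. \<Sum>c<d. \<Sum>e<d. slot_cov d a b c e * E d k (\<lambda>\<omega>. mprod d (replicate v (Y \<omega>)) b c * mprod d (replicate (t + u) (Y \<omega>)) e a))"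
    if "\<And>Z a b c e. off_slot r Z \<Longrightarrow> a < d \<Longrightarrow> b < d \<Longrightarrow> c < d \<Longrightarrow> e < d \<Longrightarrow> E d k (\<lambda>\<omega>. A \<omega> a b * A \<omega> c e * Z \<omega>) = slot_cov d a b c e * E d k Z" for A u v t
  proof -
    have "?E (replicate u Y @ [A] @ replicate v Y @ [A] @ replicate t Y) = (\<Sum>a<d. \<Sum>b<d. \<Sum>c<d. \<Sum>e<d. E d k (\<lambda>\<omega>. A \<omega> a b * A \<omega> c e *
        (mprod d (replicate v (Y \<omega>)) b c * mprod d (replicate (t + u) (Y \<omega>)) e a)))"
      unfolding etr_def avg_sum[symmetric]
      by (rule avg_cong) (simp only: map_append map_replicate list.map trw_two_letters replicate_add)
    then show ?thesis using that[OF off_slot_mult[OF off off]] by simp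
  qed
  consider "cnt w = 0" | "cnt w = Suc 0" | "cnt w = Suc (Suc 0)" using w by linarith
  then show ?thesis
  proof cases
    case 1
    then have "\<forall>b\<in>set w. \<not> b" using cnt_0[of w] by (metis in_set_replicate)
    then have "map (\<lambda>b. if b then perm_summand d r else Y) w = map (\<lambda>b. if b then sign_summand d r else Y) w" by auto
    then show ?thesis by (simp only:)
  next
    case 2
    then obtain u w' where "w = replicate u False @ True # w'" "cnt w' = 0" using cnt_Suc by blast
    then have w: "w = replicate u False @ [True] @ replicate (length w') False" using cnt_0[of w'] by simp
    have "map (\<lambda>b. if b then A else Y) w = replicate u Y @ [A] @ replicate (length w') Y" for A
      by (subst w) simp
    then show ?thesis using one[of "perm_summand d r"] one[of "sign_summand d r"]
        perm_summand_mean[OF r d] sign_summand_mean[OF r d] by simp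
  next
    case 3
    then obtain u w1 where w1: "w = replicate u False @ True # w1" "cnt w1 = Suc 0" using cnt_Suc by blast
    then obtain v w2 where w2: "w1 = replicate v False @ True # w2" "cnt w2 = 0" using cnt_Suc by blast
    have w: "w = replicate u False @ [True] @ replicate v False @ [True] @ replicate (length w2) False"
      using w1 w2 cnt_0[of w2] by simp
    have "map (\<lambda>b. if b then A else Y) w = replicate u Y @ [A] @ replicate v Y @ [A] @ replicate (length w2) Y" for A
      by (subst w) simp
    then show ?thesis using two[of "perm_summand d r", OF perm_summand_cov[OF r d]] two[of "sign_summand d r", OF sign_summand_cov[OF r d]]
      by (simp only:)
  qed
qed

lemma etr_replicate: "etr \<Omega> d (replicate n A) = avg \<Omega> (\<lambda>\<omega>. trw d (replicate n (A \<omega>)))"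
  by (simp add: etr_def)

text \<open>The expansions of the two moments agree on words with at most two letters from slot
  \<open>r\<close>. Each remaining word is bounded by Hoelder's inequality, and the factor 2 counts
  both expansions.\<close>

lemma lindeberg_step:
  fixes Y :: "outcome \<Rightarrow> rmat"
  assumes r: "r \<in> {1..k}" and d: "d \<ge> 2" and Y: "off_slot r Y" "\<And>\<omega>. symm (Y \<omega>)" and p: "p \<ge> 1"
    and c: "c \<ge> 0" "etr (sample_space d k) d (replicate (2 * p) (perm_summand d r)) \<le> c ^ (2 * p)"
      "etr (sample_space d k) d (replicate (2 * p) (sign_summand d r)) \<le> c ^ (2 * p)"
    and z: "z \<ge> 0" "etr (sample_space d k) d (replicate (2 * p) (\<lambda>\<omega>. madd (Y \<omega>) (sign_summand d r \<omega>))) \<le> z ^ (2 * p)"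
  shows "etr (sample_space d k) d (replicate (2 * p) (\<lambda>\<omega>. madd (Y \<omega>) (perm_summand d r \<omega>)))
     \<le> z ^ (2 * p) + 2 * real ((2 * p) choose 3) * c ^ 3 * (z + c) ^ (2 * p - 3)"
proof -
  let ?\<Omega> = "sample_space d k"
  let ?E = "etr ?\<Omega> d"
  let ?L = "{A. \<forall>\<omega>\<in>?\<Omega>. symm (A \<omega>)}"
  interpret word_trace ?E ?L by (rule word_trace_etr)
  let ?S = "perm_summand d r" and ?T = "sign_summand d r"
  let ?YT = "\<lambda>\<omega>. madd (Y \<omega>) (?T \<omega>)"
  have sL: "Y \<in> ?L" "?S \<in> ?L" "?T \<in> ?L" "?YT \<in> ?L"
    using Y(2) symm_perm_summand symm_sign_summand symm_madd by auto
  have expand: "?E (replicate n (\<lambda>\<omega>. madd (Y \<omega>) (A \<omega>))) = (\<Sum>w\<in>bool_words n. ?E (map (\<lambda>b. if b then A else Y) w))" for n A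
  proof -
    have "map (\<lambda>X. X \<omega>) (map (\<lambda>b. if b then A else Y) w) = map (\<lambda>b. if b then A \<omega> else Y \<omega>) w" for w \<omega>
      by auto
    then show ?thesis by (simp only: etr_replicate trw_madd_expand etr_def[of _ _ "map _ _"] avg_sum)
  qed
  define N where "N = ?E (replicate (2 * p) Y)"
  have N0: "N \<ge> 0" unfolding N_def by (rule replicate_even_nonneg) (use sL in auto)
  have NT0: "?E (replicate (2 * p) ?YT) \<ge> 0" by (rule replicate_even_nonneg) (use sL in auto)
  \<comment> \<open>The words contain \<open>Y\<close>, but the hypothesis bounds \<open>Y\<close>
    plus a sign summand. As that summand is centred given \<open>Y\<close>, it may be added to one
    factor of the moment of \<open>Y\<close>; Hoelder's inequality then bounds N^(2p) by N^(2p - 1)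
    times the larger moment.\<close>
  have mono: "N \<le> ?E (replicate (2 * p) ?YT)"
  proof (cases "N = 0")
    case False
    define q where "q = 2 * p - 1"
    have q: "2 * p = Suc q" using p by (simp add: q_def)
    have "?E (replicate q Y @ [?YT]) = ?E (replicate q Y @ [Y]) + ?E (replicate q Y @ [?T])"
    proof -
      have "trw d (xs @ [madd A B]) = trw d (xs @ [A]) + trw d (xs @ [B])" for xs A B
        using trw_one_letter[of d xs "madd A B" "[]"] trw_one_letter[of d xs A "[]"] trw_one_letter[of d xs B "[]"]
        by (simp add: madd_def distrib_right sum.distrib)
      then show ?thesis by (simp add: etr_def avg_add)
    qed
    moreover have "?E (replicate q Y @ [?T]) = 0"
    proof -
      have "?E (replicate q Y @ [?T]) = (\<Sum>a<d. \<Sum>b<d. E d k (\<lambda>\<omega>. ?T \<omega> a b * mprod d (replicate q (Y \<omega>)) b a))"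
        unfolding etr_def avg_sum[symmetric] using trw_one_letter[of d _ _ "[]"] by simp
      then show ?thesis using sign_summand_mean[OF r d off_slot_mprod[OF Y(1)]] by simp
    qed
    moreover have "replicate q Y @ [Y] = replicate (2 * p) Y" using q by (simp add: replicate_append_same)
    ultimately have "?E (replicate q Y @ [?YT]) = N" by (simp add: N_def)
    moreover have "\<bar>?E (replicate q Y @ [?YT])\<bar> ^ (2 * p) \<le> prod_list (map (\<lambda>x. ?E (replicate (2 * p) x)) (replicate q Y @ [?YT]))"
      by (rule holder) (use sL p q in auto)
    ultimately have "N ^ (2 * p) \<le> N ^ q * ?E (replicate (2 * p) ?YT)"
      using N0 by (simp add: N_def prod_list_replicate)
    then have "N ^ q * N \<le> N ^ q * ?E (replicate (2 * p) ?YT)" using q by (simp add: mult.commute)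
    moreover have "N ^ q > 0" using N0 False by simp
    ultimately show ?thesis by simp
  qed (use NT0 in simp)
  define B where "B = (\<lambda>w. prod_list (map (\<lambda>b. if b then c else z) w))"
  have bound: "\<bar>?E (map (\<lambda>b. if b then A else Y) w)\<bar> \<le> B w"
    if w: "w \<in> bool_words (2 * p)" and A: "A \<in> ?L" "?E (replicate (2 * p) A) \<le> c ^ (2 * p)" for w A
  proof -
    \<comment> \<open>Letters are functions, and \<open>A\<close> and \<open>Y\<close> might
      coincide; the minimum keeps \<open>b\<close> a bound for both in that case.\<close>
    define b where "b X = (if X = Y then min z (if A = Y then c else z) else c)" for X
    have ub: "?E (replicate (2 * p) Y) \<le> z ^ (2 * p)" using mono z by (simp add: N_def)
    have "\<bar>?E (map (\<lambda>b. if b then A else Y) w)\<bar> \<le> prod_list (map b (map (\<lambda>b. if b then A else Y) w))"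
    proof (rule holder_bound)
      fix x assume x: "x \<in> set (map (\<lambda>b. if b then A else Y) w)"
      then have "x = A \<or> x = Y" by auto
      then show "0 \<le> b x \<and> ?E (replicate (2 * p) x) \<le> b x ^ (2 * p)"
        using A ub z c by (auto simp: b_def min_def)
    qed (use w A sL p in auto)
    also have "\<dots> \<le> B w"
    proof -
      have pt: "0 \<le> b (if t then A else Y)" "b (if t then A else Y) \<le> (if t then c else z)" for t
        using z c by (auto simp: b_def)
      have "0 \<le> prod_list (map b (map (\<lambda>b. if b then A else Y) v)) \<and> prod_list (map b (map (\<lambda>b. if b then A else Y) v)) \<le> B v" for v
      proof (induction v)
        case (Cons t v)
        have "b (if t then A else Y) * prod_list (map b (map (\<lambda>b. if b then A else Y) v)) \<le> (if t then c else z) * B v"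
          using Cons pt[of t] by (intro mult_mono) auto
        then show ?case using Cons pt[of t] by (simp only: B_def list.map prod_list.Cons) simp
      qed (simp add: B_def)
      then show ?thesis by blast
    qed
    finally show ?thesis .
  qed
  have "?E (replicate (2 * p) (\<lambda>\<omega>. madd (Y \<omega>) (?S \<omega>))) - ?E (replicate (2 * p) ?YT)
     = (\<Sum>w\<in>bool_words (2 * p). ?E (map (\<lambda>b. if b then ?S else Y) w) - ?E (map (\<lambda>b. if b then ?T else Y) w))"
    unfolding expand by (simp add: sum_subtractf)
  also have "\<dots> \<le> (\<Sum>w\<in>bool_words (2 * p). 2 * (of_bool (3 \<le> cnt w) * B w))"
  proof (rule sum_mono)
    fix w assume w: "w \<in> bool_words (2 * p)"
    show "?E (map (\<lambda>b. if b then ?S else Y) w) - ?E (map (\<lambda>b. if b then ?T else Y) w) \<le> 2 * (of_bool (3 \<le> cnt w) * B w)"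
    proof (cases "3 \<le> cnt w")
      case True
      then show ?thesis using bound[OF w sL(2) c(2)] bound[OF w sL(3) c(3)] by simp
    next
      case False
      then show ?thesis using etr_bool_word_eq[OF r d Y(1), of w] by simp
    qed
  qed
  also have "\<dots> = 2 * (\<Sum>w\<in>bool_words (2 * p). of_bool (3 \<le> cnt w) * B w)" by (simp only: sum_distrib_left)
  also have "\<dots> \<le> 2 * (real ((2 * p) choose 3) * c ^ 3 * (z + c) ^ (2 * p - 3))"
    unfolding B_def by (intro mult_left_mono word_tail_bound) (use z c in auto)
  finally show ?thesis using z by simp
qed

section \<open>From the sign model to the permutation model\<close>

lemma trw_scale: "trw d (replicate n (\<lambda>a b. c * A a b)) = c ^ n * trw d (replicate n A)"
proof -
  have "mprod d (replicate n (\<lambda>a b. c * A a b)) i j = c ^ n * mprod d (replicate n A) i j" for i j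
    by (induction n arbitrary: i) (auto simp: sum_distrib_left mult_ac)
  then show ?thesis by (simp add: trw_def sum_distrib_left)
qed

definition compress :: "nat \<Rightarrow> rmat \<Rightarrow> rmat" where
  "compress d H a b = (\<Sum>x<d. \<Sum>y<d. proj d a x * H x y * proj d y b)"

lemma symm_compress:
  assumes "symm H"
  shows "symm (compress d H)"
proof -
  have "compress d H a b = compress d H b a" for a b
    unfolding compress_def by (subst sum.swap) (use assms symm_proj[of d] in \<open>auto simp: symm_def mult_ac\<close>)
  then show ?thesis by (simp add: symm_def)
qed

lemma mprod_single: "j < d \<Longrightarrow> mprod d [A] i j = A i j"
  by (simp add: if_distrib cong: if_cong)

lemma proj_compress:
  assumes "d \<ge> 1" "a < d"
  shows "(\<Sum>l<d. proj d a l * compress d H l b) = compress d H a b"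
proof -
  have "(\<Sum>l<d. proj d a l * compress d H l b) = (\<Sum>x<d. \<Sum>y<d. (\<Sum>l<d. proj d a l * proj d l x) * H x y * proj d y b)"
    unfolding compress_def sum_distrib_left sum_distrib_right
    by (subst sum_rotate[symmetric]) (simp add: mult_ac)
  also have "\<dots> = compress d H a b"
    unfolding compress_def using assms by (intro sum.cong refl) (simp add: proj_idem)
  finally show ?thesis .
qed

text \<open>The projections are absorbed by the neighbouring compressed factors, so one factor of
  the moment may be replaced by \<open>H\<close> itself. Hoelder's inequality then bounds N^(2p) by
  N^(2p - 1) times the moment of \<open>H\<close>.\<close>

lemma compress_moment:
  fixes H :: "outcome \<Rightarrow> rmat"
  assumes d: "d \<ge> 1" and p: "p \<ge> 1" and H: "\<And>\<omega>. symm (H \<omega>)"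
  shows "etr \<Omega> d (replicate (2 * p) (\<lambda>\<omega>. compress d (H \<omega>))) \<le> etr \<Omega> d (replicate (2 * p) H)"
proof -
  let ?E = "etr \<Omega> d"
  let ?L = "{A. \<forall>\<omega>\<in>\<Omega>. symm (A \<omega>)}"
  interpret word_trace ?E ?L by (rule word_trace_etr)
  let ?A = "\<lambda>\<omega>. compress d (H \<omega>)"
  have L: "?A \<in> ?L" "H \<in> ?L" using H symm_compress by auto
  define q where "q = 2 * p - 2"
  have q: "2 * p = Suc (Suc q)" using p by (simp add: q_def)
  have key: "trw d (replicate (Suc q) (compress d h) @ [compress d h]) = trw d (replicate (Suc q) (compress d h) @ [h])"
    if h: "symm h" for h
  proof -
    let ?a = "compress d h"
    have 1: "mprod d [?a] i j = mprod d [proj d, h, proj d] i j" if "i < d" "j < d" for i j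
    proof -
      have "mprod d [proj d, h, proj d] i j = (\<Sum>x<d. proj d i x * (\<Sum>y<d. h x y * mprod d [proj d] y j))" by simp
      also have "\<dots> = compress d h i j" unfolding mprod_single[OF that(2)] compress_def
        by (simp add: sum_distrib_left mult.assoc)
      finally show ?thesis using mprod_single[OF that(2)] by simp
    qed
    have 2: "mprod d [proj d, ?a] i j = mprod d [?a] i j" if "i < d" "j < d" for i j
      using proj_compress[of d i h j] d that mprod_single[OF that(2)] by (simp del: mprod.simps(1))
    have 3: "mprod d [?a, proj d] i j = mprod d [?a] i j" if "i < d" "j < d" for i j
      using mprod_rev[of "[proj d, ?a]" i d j] mprod_rev[of "[?a]" i d j] 2[of j i] that symm_proj symm_compress[OF h] by auto
    have "trw d (replicate (Suc q) ?a @ [?a]) = trw d (replicate (Suc q) ?a @ [proj d, h, proj d])"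
      using trw_cong_middle[OF 1, where xs = "replicate (Suc q) ?a" and ys = "[]"] by simp
    also have "\<dots> = trw d (replicate q ?a @ [?a, proj d] @ [h, proj d])"
      by (simp add: replicate_append_same[symmetric])
    also have "\<dots> = trw d (replicate q ?a @ [?a] @ [h, proj d])" by (rule trw_cong_middle[OF 3])
    also have "\<dots> = trw d ((replicate (Suc q) ?a @ [h]) @ [proj d])" by (simp add: replicate_append_same[symmetric])
    also have "\<dots> = trw d ([proj d] @ (replicate (Suc q) ?a @ [h]))" by (rule trw_append_commute)
    also have "\<dots> = trw d ([] @ [proj d, ?a] @ (replicate q ?a @ [h]))" by simp
    also have "\<dots> = trw d ([] @ [?a] @ (replicate q ?a @ [h]))" by (rule trw_cong_middle[OF 2])
    finally show ?thesis by simp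
  qed
  define N where "N = ?E (replicate (2 * p) ?A)"
  have N0: "N \<ge> 0" unfolding N_def by (rule replicate_even_nonneg) (use L in auto)
  have eq: "N = ?E (replicate (Suc q) ?A @ [H])"
  proof -
    have "replicate (2 * p) ?A = replicate (Suc q) ?A @ [?A]" using q by (simp add: replicate_append_same)
    then have "N = ?E (replicate (Suc q) ?A @ [?A])" by (simp add: N_def)
    also have "\<dots> = ?E (replicate (Suc q) ?A @ [H])"
      unfolding etr_def by (rule avg_cong) (simp only: map_append map_replicate list.map key[OF H])
    finally show ?thesis .
  qed
  have "\<bar>N\<bar> ^ (2 * p) \<le> prod_list (map (\<lambda>x. ?E (replicate (2 * p) x)) (replicate (Suc q) ?A @ [H]))"
    unfolding eq by (rule holder) (use L p q in auto)
  then have "N ^ (2 * p) \<le> N ^ Suc q * ?E (replicate (2 * p) H)"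
    using N0 by (simp add: N_def prod_list_replicate)
  then have "N ^ Suc q * N \<le> N ^ Suc q * ?E (replicate (2 * p) H)" using q by (simp add: mult.commute)
  moreover have "?E (replicate (2 * p) H) \<ge> 0" by (rule replicate_even_nonneg) (use L in auto)
  ultimately show ?thesis using N0 unfolding N_def[symmetric] by (cases "N = 0") (auto simp: mult_le_cancel_left)
qed

lemma sign_summand_compress:
  "(\<Sum>i\<in>I. sign_summand d i \<omega> a b) = 1 / sqrt (real d - 1) * compress d (sign_sum I \<omega>) a b"
proof -
  have "sign_part d i \<omega> b a = (\<Sum>x<d. \<Sum>y<d. proj d a x * proj d y b * snd \<omega> i y x)" for i
    unfolding sign_part_def by (subst sum.swap) (use symm_proj[of d] in \<open>auto simp: symm_def mult_ac\<close>)
  then have "sign_part d i \<omega> a b + sign_part d i \<omega> b a = (\<Sum>x<d. \<Sum>y<d. proj d a x * (snd \<omega> i x y + snd \<omega> i y x) * proj d y b)" for i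
    by (simp add: sign_part_def sum.distrib[symmetric] algebra_simps)
  then have "(\<Sum>i\<in>I. sign_summand d i \<omega> a b) = 1 / sqrt (real d - 1) * (\<Sum>i\<in>I. \<Sum>x<d. \<Sum>y<d. proj d a x * (snd \<omega> i x y + snd \<omega> i y x) * proj d y b)"
    by (simp add: sign_summand_def sum_distrib_left sum_divide_distrib[symmetric])
  also have "(\<Sum>i\<in>I. \<Sum>x<d. \<Sum>y<d. proj d a x * (snd \<omega> i x y + snd \<omega> i y x) * proj d y b) = compress d (sign_sum I \<omega>) a b"
    unfolding compress_def sign_sum_def by (subst sum_rotate[symmetric]) (simp add: sum_distrib_left sum_distrib_right)
  finally show ?thesis .
qed

theorem sign_model_moment:
  assumes d: "d \<ge> 2" and p: "p \<ge> 1" "p + 1 \<le> 7 * d" and I: "I \<subseteq> {1..k}"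
  shows "etr (sample_space d k) d (replicate (2 * p) (\<lambda>\<omega> a b. \<Sum>i\<in>I. sign_summand d i \<omega> a b))
     \<le> real d * (8 * real (card I) * (real d / (real d - 1)) * (1 + 9 * (real p + 1)\<^sup>2 / real d)) ^ p"
proof -
  have s: "(1 / sqrt (real d - 1)) ^ (2 * p) = 1 / (real d - 1) ^ p" using d
    by (simp add: power_mult power_divide)
  have "etr (sample_space d k) d (replicate (2 * p) (\<lambda>\<omega> a b. \<Sum>i\<in>I. sign_summand d i \<omega> a b))
     = 1 / (real d - 1) ^ p * etr (sample_space d k) d (replicate (2 * p) (\<lambda>\<omega>. compress d (sign_sum I \<omega>)))"
    unfolding etr_replicate sign_summand_compress trw_scale s avg_cmult ..
  also have "\<dots> \<le> 1 / (real d - 1) ^ p * etr (sample_space d k) d (replicate (2 * p) (sign_sum I))"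
    using d p by (intro mult_left_mono compress_moment symm_sign_sum) auto
  also have "\<dots> \<le> 1 / (real d - 1) ^ p * (real d * (8 * real (card I) * real d * (1 + 9 * (real p + 1)\<^sup>2 / real d)) ^ p)"
    unfolding etr_replicate using d p I by (intro mult_left_mono sign_sum_moment) auto
  also have "\<dots> = real d * (8 * real (card I) * (real d / (real d - 1)) * (1 + 9 * (real p + 1)\<^sup>2 / real d)) ^ p"
    by (simp add: power_mult_distrib power_divide)
  finally show ?thesis .
qed

text \<open>On a vector the summand acts as the sum of two rearrangements, each with its mean
  removed. Removing the mean does not increase the Euclidean norm, so the operator norm is at most
  2.\<close>

lemma perm_summand_contraction:
  assumes r: "r \<in> {1..k}" and \<omega>: "\<omega> \<in> sample_space d k" and d: "d \<ge> 2"
  shows "(\<Sum>i<d. (\<Sum>m<d. perm_summand d r \<omega> i m * v m)\<^sup>2) \<le> 4 * (\<Sum>m<d. (v m)\<^sup>2)"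
proof -
  define \<pi> where "\<pi> = fst \<omega> r"
  have "fst \<omega> \<in> {1..k} \<rightarrow>\<^sub>E perms d" using \<omega> by (auto simp: sample_space_def)
  then have "\<pi> \<in> perms d" unfolding \<pi>_def using r by (rule PiE_mem)
  then have \<pi>: "\<pi> permutes {..<d}" by (simp add: perms_def)
  define \<mu> where "\<mu> = (\<Sum>m<d. v m) / real d"
  have centre: "(\<Sum>i<d. (u i - \<mu>)\<^sup>2) \<le> (\<Sum>m<d. (v m)\<^sup>2)"
    if "(\<Sum>i<d. u i) = (\<Sum>m<d. v m)" "(\<Sum>i<d. (u i)\<^sup>2) = (\<Sum>m<d. (v m)\<^sup>2)" for u :: "nat \<Rightarrow> real"
  proof -
    have "(\<Sum>i<d. (u i - \<mu>)\<^sup>2) = (\<Sum>i<d. (u i)\<^sup>2) - 2 * \<mu> * (\<Sum>i<d. u i) + real d * \<mu>\<^sup>2"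
      by (simp add: power2_diff sum.distrib sum_subtractf sum_distrib_left mult_ac)
    also have "\<dots> = (\<Sum>m<d. (v m)\<^sup>2) - real d * \<mu>\<^sup>2"
      using that d by (simp add: \<mu>_def power2_eq_square)
    finally show ?thesis by simp
  qed
  let ?u = "\<lambda>i. v (inv_into UNIV \<pi> i)" and ?w = "\<lambda>i. v (\<pi> i)"
  have inv: "inv_into UNIV \<pi> permutes {..<d}" by (rule permutes_inv[OF \<pi>])
  have 1: "(\<Sum>i<d. (?u i - \<mu>)\<^sup>2) \<le> (\<Sum>m<d. (v m)\<^sup>2)"
    by (rule centre) (use sum.permute[OF inv, of v] sum.permute[OF inv, of "\<lambda>m. (v m)\<^sup>2"] in \<open>simp_all add: o_def\<close>)
  have 2: "(\<Sum>i<d. (?w i - \<mu>)\<^sup>2) \<le> (\<Sum>m<d. (v m)\<^sup>2)"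
    by (rule centre) (use sum.permute[OF \<pi>, of v] sum.permute[OF \<pi>, of "\<lambda>m. (v m)\<^sup>2"] in \<open>simp_all add: o_def\<close>)
  have row: "(\<Sum>m<d. perm_summand d r \<omega> i m * v m) = (?u i - \<mu>) + (?w i - \<mu>)" if i: "i < d" for i
  proof -
    have "(\<Sum>m<d. perm_summand d r \<omega> i m * v m) = (\<Sum>m<d. (if m = inv_into UNIV \<pi> i then v m else 0) + (if m = \<pi> i then v m else 0) - 2 * (v m / real d))"
    proof (intro sum.cong refl)
      fix m
      have "(m = inv_into UNIV \<pi> i) = (i = \<pi> m)" using permutes_inv_eq[OF \<pi>, of i m] by auto
      then have e1: "(if m = inv_into UNIV \<pi> i then v m else 0) = of_bool (i = \<pi> m) * v m" by (simp only: of_bool_def) simp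
      have e2: "(if m = \<pi> i then v m else 0) = of_bool (m = \<pi> i) * v m" by (simp only: of_bool_def) simp
      have ps: "perm_summand d r \<omega> i m = of_bool (i = \<pi> m) + of_bool (m = \<pi> i) - 2 / real d"
        by (simp only: perm_summand_def perm_part_def \<pi>_def)
      show "perm_summand d r \<omega> i m * v m = (if m = inv_into UNIV \<pi> i then v m else 0) + (if m = \<pi> i then v m else 0) - 2 * (v m / real d)"
        unfolding e1 e2 ps left_diff_distrib distrib_right by simp
    qed
    also have "\<dots> = ?u i + ?w i - 2 * \<mu>"
      using i permutes_in_image[OF \<pi>, of i] permutes_in_image[OF inv, of i]
      by (simp add: sum.distrib sum_subtractf \<mu>_def sum_divide_distrib sum_distrib_left)
    finally show ?thesis by simp
  qed
  have "(\<Sum>i<d. (\<Sum>m<d. perm_summand d r \<omega> i m * v m)\<^sup>2) = (\<Sum>i<d. ((?u i - \<mu>) + (?w i - \<mu>))\<^sup>2)"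
    by (intro sum.cong refl) (simp only: row lessThan_iff)
  also have "\<dots> \<le> (\<Sum>i<d. 2 * (?u i - \<mu>)\<^sup>2 + 2 * (?w i - \<mu>)\<^sup>2)"
  proof (rule sum_mono)
    fix i
    have "(x + y)\<^sup>2 \<le> 2 * x\<^sup>2 + 2 * y\<^sup>2" for x y :: real
      using zero_le_power2[of "x - y"] by (simp add: power2_eq_square algebra_simps)
    then show "((?u i - \<mu>) + (?w i - \<mu>))\<^sup>2 \<le> 2 * (?u i - \<mu>)\<^sup>2 + 2 * (?w i - \<mu>)\<^sup>2" .
  qed
  also have "\<dots> = 2 * (\<Sum>i<d. (?u i - \<mu>)\<^sup>2) + 2 * (\<Sum>i<d. (?w i - \<mu>)\<^sup>2)"
    by (simp add: sum.distrib sum_distrib_left)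
  finally show ?thesis using 1 2 by simp
qed

text \<open>The trace is the squared Frobenius norm of the p-th power, each of whose d columns is a
  unit vector after p applications of an operator of norm at most 2.\<close>

lemma perm_summand_moment:
  assumes r: "r \<in> {1..k}" and d: "d \<ge> 2"
  shows "etr (sample_space d k) d (replicate (2 * p) (perm_summand d r)) \<le> real d * 4 ^ p"
proof -
  have "trw d (replicate (2 * p) (perm_summand d r \<omega>)) \<le> real d * 4 ^ p" if \<omega>: "\<omega> \<in> sample_space d k" for \<omega>
  proof -
    let ?S = "perm_summand d r \<omega>"
    have col: "(\<Sum>i<d. (mprod d (replicate n ?S) i l)\<^sup>2) \<le> 4 ^ n" if l: "l < d" for n l
    proof (induction n)
      case 0
      have "(\<Sum>i<d. (mprod d (replicate 0 ?S) i l)\<^sup>2) = (\<Sum>i<d. if i = l then 1 else 0)"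
        by (intro sum.cong) auto
      then show ?case using l by simp
    next
      case (Suc n)
      then show ?case using perm_summand_contraction[OF r \<omega> d, of "\<lambda>m. mprod d (replicate n ?S) m l"] by simp
    qed
    have "trw d (replicate (2 * p) ?S) = trw d (replicate p ?S @ rev (replicate p ?S))"
      by (simp add: mult_2 replicate_add)
    also have "\<dots> = (\<Sum>i<d. \<Sum>l<d. (mprod d (replicate p ?S) i l)\<^sup>2)"
      by (rule trw_palindrome) (auto simp: symm_perm_summand)
    also have "\<dots> = (\<Sum>l<d. \<Sum>i<d. (mprod d (replicate p ?S) i l)\<^sup>2)" by (rule sum.swap)
    also have "\<dots> \<le> (\<Sum>l<d. 4 ^ p)" by (intro sum_mono col) auto
    finally show ?thesis by simp
  qed
  then have "etr (sample_space d k) d (replicate (2 * p) (perm_summand d r)) \<le> E d k (\<lambda>_. real d * 4 ^ p)"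
    unfolding etr_replicate by (rule avg_mono)
  then show ?thesis by (simp add: avg_const sample_space_finite sample_space_nonempty)
qed

section \<open>Exchanging the slots one after another\<close>

definition hybrid :: "nat \<Rightarrow> nat \<Rightarrow> nat \<Rightarrow> outcome \<Rightarrow> rmat" where
  "hybrid d k j \<omega> a b = (\<Sum>i\<in>{1..j}. perm_summand d i \<omega> a b) + (\<Sum>i\<in>{j<..k}. sign_summand d i \<omega> a b)"

lemma exp_two_bound: "p \<ge> 1 \<Longrightarrow> (1 + 1 / real p) ^ (2 * p) \<le> 9"
proof -
  assume p: "p \<ge> 1"
  have "(1 + 1 / real p) ^ p \<le> exp (1 / real p) ^ p" by (intro power_mono) auto
  also have "\<dots> = exp 1" using p by (simp flip: exp_of_nat_mult)
  also have "\<dots> \<le> 3" by (rule exp_le)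
  finally have "((1 + 1 / real p) ^ p)\<^sup>2 \<le> 3\<^sup>2" by (intro power_mono) auto
  then show ?thesis by (simp add: power_mult[symmetric] mult.commute)
qed

lemma choose_three_bound: "real (n choose 3) \<le> real n ^ 3 / 6"
proof -
  have "real (n choose 3) = (\<Prod>i<3. real n - real i) / fact 3 \<or> n < 3"
    by (simp add: binomial_gbinomial gbinomial_prod_rev atLeast0LessThan)
  moreover have "(\<Prod>i<3. real n - real i) \<le> (\<Prod>i<(3::nat). real n)" if "n \<ge> 3"
    by (intro prod_mono) (use that in auto)
  ultimately show ?thesis by (cases "n < 3") (auto simp: binomial_eq_0 fact_numeral divide_right_mono)
qed

text \<open>
  The bound is linear in \<open>j\<close> after taking the \<open>2 * s\<close>-th root, that is, for the third power of the
  Schatten norm of order \<open>6 * s\<close>; a multiple of 6 avoids fractional powers.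
\<close>
lemma hybrid_moment:
  assumes d: "d \<ge> 2" and s: "s \<ge> 1" and c: "c > 0"
    and S: "\<And>r. r \<in> {1..k} \<Longrightarrow> etr (sample_space d k) d (replicate (2 * (3 * s)) (perm_summand d r)) \<le> c ^ (2 * (3 * s))"
    and T: "\<And>r. r \<in> {1..k} \<Longrightarrow> etr (sample_space d k) d (replicate (2 * (3 * s)) (sign_summand d r)) \<le> c ^ (2 * (3 * s))"
    and W: "W \<ge> (c * real (3 * s)) ^ 3" "etr (sample_space d k) d (replicate (2 * (3 * s)) (hybrid d k 0)) \<le> W ^ (2 * s)"
    and j: "j \<le> k"
  shows "etr (sample_space d k) d (replicate (2 * (3 * s)) (hybrid d k j)) \<le> (W + 36 * c ^ 3 * (real (3 * s))\<^sup>2 * real j) ^ (2 * s)"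
  using j
proof (induction j)
  case 0
  then show ?case using W by simp
next
  case (Suc j)
  define p where "p = 3 * s"
  have p: "p \<ge> 1" using s by (simp add: p_def)
  let ?\<Omega> = "sample_space d k"
  define X where "X = W + 36 * c ^ 3 * (real p)\<^sup>2 * real j"
  have XW: "X \<ge> (c * real p) ^ 3" using W(1) c unfolding X_def p_def by (simp add: add_increasing2)
  have cp: "c * real p > 0" using c p by simp
  have X0: "X > 0" using XW cp by (meson less_le_trans zero_less_power)
  define z where "z = root 3 X"
  have z3: "z ^ 3 = X" using X0 by (simp add: z_def)
  have z0: "z > 0" using X0 by (simp add: z_def)
  \<comment> \<open>This is what the lower bound on \<open>W\<close> is for: \<open>c\<close> is at
    most z/p, so replacing z + c by z in the power 2p - 3 costs at most (1 + 1/p)^(2p), which is at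
    most 9.\<close>
  have zc: "c * real p \<le> z"
    by (rule power_le_imp_le_base[of _ 2]) (use XW z3 z0 in \<open>auto simp: numeral_3_eq_3\<close>)
  have r: "Suc j \<in> {1..k}" using Suc by auto
  define Y where "Y \<omega> a b = (\<Sum>i\<in>{1..j}. perm_summand d i \<omega> a b) + (\<Sum>i\<in>{Suc j<..k}. sign_summand d i \<omega> a b)" for \<omega> a b
  have H1: "hybrid d k j = (\<lambda>\<omega>. madd (Y \<omega>) (sign_summand d (Suc j) \<omega>))"
  proof -
    have "{j<..k} = insert (Suc j) {Suc j<..k}" using Suc by auto
    then show ?thesis by (simp add: fun_eq_iff hybrid_def Y_def madd_def)
  qed
  have H2: "hybrid d k (Suc j) = (\<lambda>\<omega>. madd (Y \<omega>) (perm_summand d (Suc j) \<omega>))"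
    by (simp add: fun_eq_iff hybrid_def Y_def madd_def)
  have offY: "off_slot (Suc j) Y"
    unfolding off_slot_def Y_def fun_eq_iff
    by (auto simp: perm_summand_def perm_part_def sign_summand_def sign_part_def intro!: sum.cong arg_cong2[of _ _ _ _ "(+)"])
  have symY: "symm (Y \<omega>)" for \<omega>
    using symm_perm_summand[of d] symm_sign_summand[of d] by (simp add: symm_def Y_def)
  have ih: "etr ?\<Omega> d (replicate (2 * p) (hybrid d k j)) \<le> z ^ (2 * p)"
  proof -
    have "z ^ (2 * p) = X ^ (2 * s)" by (simp add: p_def z3[symmetric] flip: power_mult)
    then show ?thesis using Suc by (simp add: X_def p_def)
  qed
  have "etr ?\<Omega> d (replicate (2 * p) (hybrid d k (Suc j)))
     \<le> z ^ (2 * p) + 2 * real ((2 * p) choose 3) * c ^ 3 * (z + c) ^ (2 * p - 3)"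
    unfolding H2
    by (rule lindeberg_step[OF r d offY symY p]) (use c S T r z0 ih H1 in \<open>auto simp: p_def\<close>)
  also have "\<dots> \<le> z ^ (2 * p) + 2 * (real (2 * p) ^ 3 / 6) * c ^ 3 * (9 * z ^ (2 * p - 3))"
  proof -
    have "z + c \<le> z * (1 + 1 / real p)" using zc p by (simp add: field_simps)
    then have "(z + c) ^ (2 * p - 3) \<le> (z * (1 + 1 / real p)) ^ (2 * p - 3)" using z0 c by (intro power_mono) auto
    also have "\<dots> = (1 + 1 / real p) ^ (2 * p - 3) * z ^ (2 * p - 3)" by (simp add: power_mult_distrib mult.commute)
    also have "\<dots> \<le> 9 * z ^ (2 * p - 3)"
    proof (rule mult_right_mono)
      have "(1 + 1 / real p) ^ (2 * p - 3) \<le> (1 + 1 / real p) ^ (2 * p)" by (intro power_increasing) auto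
      then show "(1 + 1 / real p) ^ (2 * p - 3) \<le> 9" using exp_two_bound[OF p] by linarith
    qed (use z0 in simp)
    finally have "(z + c) ^ (2 * p - 3) \<le> 9 * z ^ (2 * p - 3)" .
    then show ?thesis using z0 c choose_three_bound[of "2 * p"]
      by (intro add_left_mono mult_mono mult_left_mono mult_right_mono) auto
  qed
  also have "\<dots> = z ^ (2 * p - 3) * (X + 24 * real p ^ 3 * c ^ 3)"
  proof -
    have "2 * p = (2 * p - 3) + 3" using s by (simp add: p_def)
    then have "z ^ (2 * p) = z ^ (2 * p - 3) * X" using z3 by (metis power_add)
    then show ?thesis by (simp add: algebra_simps power_mult_distrib)
  qed
  also have "\<dots> \<le> (X + 36 * c ^ 3 * (real p)\<^sup>2) ^ (2 * s)"
  proof -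
    \<comment> \<open>One replacement adds 2 ((2p)^3/6) 9 = 24 times p^3 c^3. Bernoulli's inequality
      for the exponent 2s = 2p/3 absorbs it into an increment of \<open>X\<close>, and 24 p^3
      divided by 2p/3 is 36 p^2.\<close>
    define u where "u = 36 * c ^ 3 * (real p)\<^sup>2 / X"
    have u0: "u \<ge> 0" using c X0 by (simp add: u_def)
    have "1 + real (2 * s) * u \<le> (1 + u) ^ (2 * s)" using u0 by (intro Bernoulli_inequality) auto
    then have "X ^ (2 * s) * (1 + real (2 * s) * u) \<le> X ^ (2 * s) * (1 + u) ^ (2 * s)"
      using X0 by (intro mult_left_mono) auto
    also have "\<dots> = (X * (1 + u)) ^ (2 * s)" by (simp add: power_mult_distrib)
    also have "X * (1 + u) = X + 36 * c ^ 3 * (real p)\<^sup>2" using X0 by (simp add: u_def field_simps)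
    finally have 1: "X ^ (2 * s) * (1 + real (2 * s) * u) \<le> (X + 36 * c ^ 3 * (real p)\<^sup>2) ^ (2 * s)" .
    have "2 * p - 3 = 3 * (2 * s - 1)" by (simp add: p_def)
    then have "z ^ (2 * p - 3) = X ^ (2 * s - 1)" by (simp add: power_mult z3)
    moreover have "X ^ (2 * s) = X ^ (2 * s - 1) * X" using s by (simp flip: power_Suc2)
    moreover have "X * (real (2 * s) * u) = 24 * real p ^ 3 * c ^ 3"
      using X0 by (simp add: u_def p_def power2_eq_square power3_eq_cube)
    ultimately have "z ^ (2 * p - 3) * (X + 24 * real p ^ 3 * c ^ 3) = X ^ (2 * s) * (1 + real (2 * s) * u)"
      by (simp add: distrib_left mult.assoc)
    then show ?thesis using 1 by simp
  qed
  finally show ?case by (simp add: X_def p_def algebra_simps)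
qed

section \<open>Tail bound for the norm\<close>

text \<open>The operator norm is at most the Schatten norm. Hoelder's inequality is applied to the
  word consisting of \<open>A\<close> twice and 2p - 2 copies of the rank one matrix
  \<open>R\<close> built from \<open>u\<close>: its trace is |Au|^2 q^(2p - 3), and \<open>R\<close>
  has Schatten norm q = |u|^2.\<close>

lemma symmetric_norm_le_trace:
  fixes u :: "nat \<Rightarrow> real"
  assumes A: "symm A" and p: "p \<ge> 2" and t: "t \<ge> 0" "trw d (replicate (2 * p) A) \<le> t ^ (2 * p)"
  shows "(\<Sum>i<d. (\<Sum>m<d. A i m * u m)\<^sup>2) \<le> t\<^sup>2 * (\<Sum>i<d. (u i)\<^sup>2)"
proof -
  let ?E = "etr {()} d"
  let ?L = "{A. \<forall>\<omega>\<in>{()}. symm (A \<omega>)}"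
  interpret word_trace ?E ?L by (rule word_trace_etr)
  define q where "q = (\<Sum>i<d. (u i)\<^sup>2)"
  have q0: "q \<ge> 0" unfolding q_def by (rule sum_nonneg) auto
  define R where "R = (\<lambda>i j. u i * u j)"
  define N where "N = (\<Sum>i<d. (\<Sum>m<d. A i m * u m)\<^sup>2)"
  have Rpow: "mprod d (replicate (Suc n) R) i j = u i * u j * q ^ n" if "j < d" for i j n
  proof (induction n arbitrary: i)
    case 0
    then show ?case using mprod_single[OF that, of R i] by (simp add: R_def)
  next
    case (Suc n)
    have "mprod d (replicate (Suc (Suc n)) R) i j = (\<Sum>l<d. R i l * (u l * u j * q ^ n))"
      using Suc by simp
    also have "\<dots> = u i * u j * q ^ n * (\<Sum>l<d. (u l)\<^sup>2)"
      by (simp add: R_def sum_distrib_left power2_eq_square mult_ac)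
    finally show ?case by (simp add: q_def mult_ac)
  qed
  have RN: "trw d (replicate (2 * p) R) = q ^ (2 * p)"
  proof -
    obtain m where m: "2 * p = Suc m" using p by (cases "2 * p") auto
    have "trw d (replicate (2 * p) R) = (\<Sum>i<d. u i * u i * q ^ m)"
      unfolding trw_def m by (intro sum.cong refl Rpow) auto
    also have "\<dots> = q * q ^ m" by (simp add: q_def sum_distrib_right power2_eq_square)
    finally show ?thesis using m by simp
  qed
  define n where "n = 2 * p - 3"
  have n: "2 * p = Suc (Suc (Suc n))" using p by (simp add: n_def)
  have "trw d ([A, A] @ replicate (Suc n) R) = (\<Sum>i<d. \<Sum>l<d. \<Sum>m<d. A i l * A l m * (u m * u i * q ^ n))"
    by (simp add: trw_def Rpow sum_distrib_left mult_ac del: replicate_Suc)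
  also have "\<dots> = (\<Sum>l<d. \<Sum>i<d. \<Sum>m<d. (A l i * u i) * (A l m * u m) * q ^ n)"
    by (subst sum.swap) (use A in \<open>simp add: symm_def mult_ac\<close>)
  also have "\<dots> = N * q ^ n"
  proof -
    have "(\<Sum>i<d. \<Sum>m<d. f i * f m * w) = (\<Sum>i<d. f i)\<^sup>2 * w" for f :: "nat \<Rightarrow> real" and w
      by (subst power2_eq_square, subst sum_product) (simp add: sum_distrib_right)
    then show ?thesis by (simp add: N_def sum_distrib_right)
  qed
  finally have eq: "trw d ([A, A] @ replicate (Suc n) R) = N * q ^ n" .
  have N0: "N \<ge> 0" unfolding N_def by (rule sum_nonneg) auto
  let ?A = "\<lambda>_::unit. A" and ?R = "\<lambda>_::unit. R"
  have RL: "symm R" by (simp add: symm_def R_def mult.commute)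
  \<comment> \<open>The minimum covers the case that \<open>A\<close> and \<open>R\<close> are the
    same matrix.\<close>
  define b where "b X = (if X = ?A then (if ?A = ?R then min t q else t) else q)" for X
  have eR: "?E (replicate (2 * p) ?R) = q ^ (2 * p)" and eA: "?E (replicate (2 * p) ?A) \<le> t ^ (2 * p)"
    using RN t by (simp_all add: etr_def avg_def)
  have "\<bar>?E ([?A, ?A] @ replicate (Suc n) ?R)\<bar> \<le> prod_list (map b ([?A, ?A] @ replicate (Suc n) ?R))"
  proof (rule holder_bound[where p = p])
    fix x assume "x \<in> set ([?A, ?A] @ replicate (Suc n) ?R)"
    then have "x = ?A \<or> x = ?R" by auto
    then show "0 \<le> b x \<and> ?E (replicate (2 * p) x) \<le> b x ^ (2 * p)"
      using eR eA q0 t by (auto simp: b_def min_def)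
  qed (use A RL n p in auto)
  also have "\<dots> \<le> t\<^sup>2 * q ^ Suc n"
  proof -
    have bA: "0 \<le> b ?A" "b ?A \<le> t" and bR: "0 \<le> b ?R" "b ?R \<le> q" using q0 t by (auto simp: b_def)
    have "(b ?A * b ?A) * b ?R ^ Suc n \<le> (t * t) * q ^ Suc n"
      using bA bR q0 t by (intro mult_mono power_mono) auto
    then show ?thesis by (simp add: prod_list_replicate power2_eq_square mult.assoc)
  qed
  also have "?E ([?A, ?A] @ replicate (Suc n) ?R) = N * q ^ n" using eq by (simp add: etr_def avg_def)
  finally have main: "N * q ^ n \<le> t\<^sup>2 * q * q ^ n" using N0 q0 by (simp add: abs_mult mult.assoc)
  show ?thesis
  proof (cases "q = 0")
    case True
    then have "(u i)\<^sup>2 = 0" if "i < d" for i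
      using that sum_nonneg_eq_0_iff[of "{..<d}" "\<lambda>i. (u i)\<^sup>2"] unfolding q_def by auto
    then show ?thesis by simp
  next
    case False
    then have "q ^ n > 0" using q0 by simp
    then show ?thesis using main unfolding N_def q_def[symmetric] by simp
  qed
qed

section \<open>From the sample space to the law of the permutation matrices\<close>

definition perm_family :: "nat \<Rightarrow> nat \<Rightarrow> (nat \<Rightarrow> nat \<Rightarrow> nat) \<Rightarrow> nat \<Rightarrow> real mat" where
  "perm_family d k \<pi> i = (if i \<in> {1..k} then perm_matrix d (\<pi> i) else 0\<^sub>m d d)"

lemma perm_matrix_inj: "inj_on (perm_matrix d) (perms d)"
proof (rule inj_onI)
  fix \<pi> \<sigma> assume a: "\<pi> \<in> perms d" "\<sigma> \<in> perms d" "perm_matrix d \<pi> = perm_matrix d \<sigma>"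
  show "\<pi> = \<sigma>"
  proof
    fix c
    show "\<pi> c = \<sigma> c"
    proof (cases "c < d")
      case True
      have "\<pi> c < d" using a(1) True permutes_in_image[of \<pi> "{..<d}" c] by (auto simp: perms_def)
      then have "perm_matrix d \<pi> $$ (\<pi> c, c) = 1" "perm_matrix d \<sigma> $$ (\<pi> c, c) = (if \<pi> c = \<sigma> c then 1 else 0)"
        using True by (simp_all add: perm_matrix_def)
      then show ?thesis using a(3) by (auto split: if_splits)
    next
      case False
      then have "\<pi> c = c" "\<sigma> c = c"
        using a permutes_not_in[of \<pi> "{..<d}" c] permutes_not_in[of \<sigma> "{..<d}" c] by (auto simp: perms_def)
      then show ?thesis by simp
    qed
  qed
qed

text \<open>Tuples of permutations correspond bijectively to tuples of permutation matrices, and a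
  product of uniform laws is uniform. The signs are averaged out because the event depends on the
  permutations only.\<close>

lemma iid_perm_matrices_prob:
  "measure_pmf.prob (iid_perm_matrices d k) {P. Q P} = avg (sample_space d k) (\<lambda>\<omega>. of_bool (Q (perm_family d k (fst \<omega>))))"
proof -
  define A where "A = ({1..k} \<rightarrow>\<^sub>E perms d)"
  define B where "B = PiE_dflt {1..k} (0\<^sub>m d d) (\<lambda>_. perm_matrices d)"
  define G where "G = ({1..k} \<rightarrow>\<^sub>E sign_matrices d)"
  have \<Omega>: "sample_space d k = A \<times> G" by (simp add: sample_space_def A_def G_def)
  have fin: "finite A" "finite G" "A \<noteq> {}" "G \<noteq> {}"
    using sample_space_finite[of d k] sample_space_nonempty[of d k] unfolding \<Omega>
    by (auto dest: finite_cartesian_productD1 finite_cartesian_productD2)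
  have pm: "perm_matrices d = perm_matrix d ` perms d" by (simp add: perm_matrices_def perms_def)
  have finp: "finite (perms d)" by (simp add: perms_def finite_permutations)
  have nep: "perms d \<noteq> {}" using permutes_id[of "{..<d}"] unfolding perms_def by blast
  have "bij_betw (perm_family d k) A B"
    unfolding bij_betw_def
  proof
    show "inj_on (perm_family d k) A"
    proof (rule inj_onI)
      fix \<pi> \<sigma> assume a: "\<pi> \<in> A" "\<sigma> \<in> A" "perm_family d k \<pi> = perm_family d k \<sigma>"
      show "\<pi> = \<sigma>"
      proof (rule PiE_ext[of \<pi> "{1..k}" "\<lambda>_. perms d" \<sigma>])
        fix i assume i: "i \<in> {1..k}"
        have "perm_matrix d (\<pi> i) = perm_matrix d (\<sigma> i)"
          using fun_cong[OF a(3), of i] i by (simp add: perm_family_def)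
        then show "\<pi> i = \<sigma> i" using perm_matrix_inj[of d] a i PiE_mem[of _ "{1..k}" "\<lambda>_. perms d" i]
          unfolding A_def inj_on_def by blast
      qed (use a in \<open>auto simp: A_def\<close>)
    qed
    show "perm_family d k ` A = B"
    proof (intro equalityI subsetI)
      fix P assume "P \<in> perm_family d k ` A"
      then obtain \<pi> where \<pi>: "\<pi> \<in> A" "P = perm_family d k \<pi>" by auto
      have "\<pi> i \<in> perms d" if "i \<in> {1..k}" for i using \<pi>(1) that unfolding A_def by (rule PiE_mem)
      then show "P \<in> B" unfolding B_def PiE_dflt_def \<pi>(2) perm_family_def pm by auto
    next
      fix P assume P: "P \<in> B"
      have "\<exists>\<sigma>. \<sigma> \<in> perms d \<and> P i = perm_matrix d \<sigma>" if "i \<in> {1..k}" for i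
        using P that unfolding B_def PiE_dflt_def pm by auto
      then obtain f where f: "\<And>i. i \<in> {1..k} \<Longrightarrow> f i \<in> perms d \<and> P i = perm_matrix d (f i)" by metis
      have "restrict f {1..k} \<in> A" using f by (auto simp: A_def)
      moreover have "P = perm_family d k (restrict f {1..k})"
      proof
        fix i show "P i = perm_family d k (restrict f {1..k}) i"
          using f[of i] P by (auto simp: perm_family_def B_def PiE_dflt_def)
      qed
      ultimately show "P \<in> perm_family d k ` A" by blast
    qed
  qed
  note bij = this
  have finB: "finite B" "B \<noteq> {}" using bij fin bij_betw_finite by (auto simp: bij_betw_def)
  have cB: "card B = card A" using bij_betw_same_card[OF bij] by simp
  have "iid_perm_matrices d k = pmf_of_set B"
    unfolding iid_perm_matrices_def B_def by (rule Pi_pmf_of_set) (use finp nep in \<open>auto simp: pm\<close>)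
  then have "measure_pmf.prob (iid_perm_matrices d k) {P. Q P} = real (card (B \<inter> {P. Q P})) / real (card B)"
    using finB by (simp add: measure_pmf_of_set)
  also have "real (card (B \<inter> {P. Q P})) = (\<Sum>P\<in>B. of_bool (Q P))"
    using finB by (simp add: sum_of_bool_eq)
  also have "\<dots> = (\<Sum>\<pi>\<in>A. of_bool (Q (perm_family d k \<pi>)))"
    by (rule sum.reindex_bij_betw[OF bij, symmetric])
  also have "\<dots> / real (card B) = avg (sample_space d k) (\<lambda>\<omega>. of_bool (Q (perm_family d k (fst \<omega>))))"
  proof -
    have "(\<Sum>\<omega>\<in>A \<times> G. of_bool (Q (perm_family d k (fst \<omega>)))) = (\<Sum>\<pi>\<in>A. \<Sum>g\<in>G. of_bool (Q (perm_family d k \<pi>)) :: real)"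
      by (subst sum.cartesian_product) (simp add: split_def)
    then show ?thesis using fin unfolding avg_def \<Omega> cB
      by (simp add: card_cartesian_product sum_distrib_left[symmetric])
  qed
  finally show ?thesis .
qed

text \<open>The model differs from \<open>hybrid d k k\<close> by 2k/d times the all-ones matrix,
  which vanishes on the orthogonal complement of the all-ones vector.\<close>

lemma norm_perp_le:
  assumes p: "p \<ge> 2" and t: "t \<ge> 0" "trw d (replicate (2 * p) (hybrid d k k \<omega>)) \<le> t ^ (2 * p)"
  shows "norm_perp d (perm_model d k (perm_family d k (fst \<omega>))) \<le> t"
proof -
  let ?M = "perm_model d k (perm_family d k (fst \<omega>))"
  let ?A = "hybrid d k k \<omega>"
  have symA: "symm ?A" using symm_perm_summand[of d] by (simp add: symm_def hybrid_def)
  have M: "?M $$ (a, b) = ?A a b + 2 * real k / real d" if "a < d" "b < d" for a b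
  proof -
    have "?M $$ (a, b) = (\<Sum>i\<in>{1..k}. perm_summand d i \<omega> a b + 2 / real d)"
      using that unfolding perm_model_def
      by (auto simp: perm_family_def perm_matrix_def perm_summand_def perm_part_def intro!: sum.cong)
    then show ?thesis by (simp add: hybrid_def sum.distrib)
  qed
  have dimM: "?M \<in> carrier_mat d d" by (simp add: perm_model_def)
  have bound: "vec_norm2 (?M *\<^sub>v v) \<le> t" if v: "v \<in> orth_complement d (ones_vec d)" "vec_norm2 v \<le> 1" for v
  proof -
    have vd: "dim_vec v = d" and v0: "(\<Sum>i<d. vec_index v i) = 0"
      using v(1) by (auto simp: orth_complement_def ones_vec_def scalar_prod_def atLeast0LessThan)
    have vv: "(\<Sum>i<d. (vec_index v i)\<^sup>2) \<le> 1"
      using v(2) by (simp add: vec_norm2_def scalar_prod_def vd power2_eq_square atLeast0LessThan)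
    have row: "vec_index (?M *\<^sub>v v) i = (\<Sum>m<d. ?A i m * vec_index v m)" if i: "i < d" for i
    proof -
      have "vec_index (?M *\<^sub>v v) i = (\<Sum>m<d. ?M $$ (i, m) * vec_index v m)"
        using i dimM vd by (simp add: scalar_prod_def atLeast0LessThan)
      also have "\<dots> = (\<Sum>m<d. ?A i m * vec_index v m + 2 * real k / real d * vec_index v m)"
        by (intro sum.cong refl) (use M i in \<open>simp add: distrib_right\<close>)
      also have "\<dots> = (\<Sum>m<d. ?A i m * vec_index v m) + 2 * real k / real d * (\<Sum>m<d. vec_index v m)"
        by (simp only: sum.distrib sum_distrib_left)
      finally show ?thesis using v0 by simp
    qed
    have "(?M *\<^sub>v v) \<bullet> (?M *\<^sub>v v) = (\<Sum>i<d. (vec_index (?M *\<^sub>v v) i)\<^sup>2)"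
      using dimM by (simp add: scalar_prod_def power2_eq_square atLeast0LessThan)
    also have "\<dots> = (\<Sum>i<d. (\<Sum>m<d. ?A i m * vec_index v m)\<^sup>2)" by (intro sum.cong refl) (simp only: row lessThan_iff)
    also have "\<dots> \<le> t\<^sup>2 * (\<Sum>i<d. (vec_index v i)\<^sup>2)" by (rule symmetric_norm_le_trace[OF symA p t])
    also have "\<dots> \<le> t\<^sup>2 * 1" using vv by (intro mult_left_mono) auto
    finally have "sqrt ((?M *\<^sub>v v) \<bullet> (?M *\<^sub>v v)) \<le> sqrt (t\<^sup>2)" by (simp only: real_sqrt_le_iff mult_1_right)
    then show ?thesis using t by (simp add: vec_norm2_def)
  qed
  have ne: "0\<^sub>v d \<in> {v \<in> orth_complement d (ones_vec d). vec_norm2 v \<le> 1}"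
    by (simp add: orth_complement_def ones_vec_def vec_norm2_def)
  show ?thesis unfolding norm_perp_def opnorm_on_def
    by (rule cSUP_least) (use ne bound in auto)
qed

lemma norm_perp_tail:
  assumes p: "p \<ge> 2" and t: "t > 0"
  shows "measure_pmf.prob (iid_perm_matrices d k) {P. norm_perp d (perm_model d k P) \<le> t}
     \<ge> 1 - etr (sample_space d k) d (replicate (2 * p) (hybrid d k k)) / t ^ (2 * p)"
proof -
  let ?A = "\<lambda>\<omega>. hybrid d k k \<omega>"
  have "1 - etr (sample_space d k) d (replicate (2 * p) (hybrid d k k)) / t ^ (2 * p)
     = E d k (\<lambda>\<omega>. 1 - 1 / t ^ (2 * p) * trw d (replicate (2 * p) (?A \<omega>)))"
    unfolding avg_diff avg_cmult etr_replicate by (simp add: avg_const sample_space_finite sample_space_nonempty)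
  also have "\<dots> \<le> E d k (\<lambda>\<omega>. of_bool (norm_perp d (perm_model d k (perm_family d k (fst \<omega>))) \<le> t))"
  proof (rule avg_mono)
    fix \<omega>
    have symA: "symm (?A \<omega>)" using symm_perm_summand[of d] by (simp add: symm_def hybrid_def)
    have "trw d (replicate (2 * p) (?A \<omega>)) = trw d (replicate p (?A \<omega>) @ rev (replicate p (?A \<omega>)))"
      by (simp add: mult_2 replicate_add)
    also have "\<dots> = (\<Sum>i<d. \<Sum>l<d. (mprod d (replicate p (?A \<omega>)) i l)\<^sup>2)"
      by (rule trw_palindrome) (use symA in auto)
    finally have nonneg: "trw d (replicate (2 * p) (?A \<omega>)) \<ge> 0" by (simp add: sum_nonneg)
    show "1 - 1 / t ^ (2 * p) * trw d (replicate (2 * p) (?A \<omega>))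
       \<le> of_bool (norm_perp d (perm_model d k (perm_family d k (fst \<omega>))) \<le> t)"
    proof (cases "trw d (replicate (2 * p) (?A \<omega>)) \<le> t ^ (2 * p)")
      case True
      then show ?thesis using norm_perp_le[OF p _ True] t nonneg by simp
    next
      case False
      then have "1 \<le> 1 / t ^ (2 * p) * trw d (replicate (2 * p) (?A \<omega>))" using t by (simp add: field_simps)
      then show ?thesis by (simp add: of_bool_def)
    qed
  qed
  also have "\<dots> = measure_pmf.prob (iid_perm_matrices d k) {P. norm_perp d (perm_model d k P) \<le> t}"
    by (rule iid_perm_matrices_prob[symmetric])
  finally show ?thesis .
qed

text \<open>\<open>D\<close> is the relative loss of the sign model, and \<open>W\<close> bounds the
  cubed Schatten norm of order 6s of the centred sum. Its three terms are the sign model with its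
  dimension factor, the lower bound (c p)^3 required at the start of the exchange, and the cost of k
  replacements.\<close>

theorem norm_perp_concentration:
  fixes d k s :: nat and a t :: real
  defines "D \<equiv> real d / (real d - 1) * (1 + 9 * (3 * real s + 1)\<^sup>2 / real d)"
  defines "W \<equiv> real d powr (1 / (2 * real s)) * sqrt (8 * real k * D) ^ 3 + (6 * sqrt D * (3 * real s)) ^ 3
     + 36 * (6 * sqrt D) ^ 3 * (3 * real s)\<^sup>2 * real k"
  assumes d: "d \<ge> 2" and s: "s \<ge> 1" "s \<le> 2 * d" "ln (real d) \<le> real s"
    and t: "t > 0" "real d powr (a / (2 * real s)) * W \<le> t ^ 3"
  shows "measure_pmf.prob (iid_perm_matrices d k) {P. norm_perp d (perm_model d k P) \<le> t} \<ge> 1 - real d powr (- a)"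
proof -
  define p where "p = 3 * s"
  have p: "p \<ge> 2" "p \<ge> 1" "p + 1 \<le> 7 * d" using s d by (auto simp: p_def)
  have d1: "real d - 1 > 0" "real d > 0" using d by auto
  have D1: "D \<ge> 1"
  proof -
    have "1 \<le> real d / (real d - 1)" using d1 by simp
    moreover have "1 \<le> 1 + 9 * (3 * real s + 1)\<^sup>2 / real d" by simp
    ultimately show ?thesis unfolding D_def using mult_mono[of 1 "real d / (real d - 1)" 1] by simp
  qed
  \<comment> \<open>\<open>c\<close> bounds the Schatten norm of one summand of either kind. With
    the dimension factor below 4^p the two moments are at most 16^p and (32 D)^p, both below (36
    D)^p.\<close>
  define c where "c = 6 * sqrt D"
  have c: "c \<ge> 6" using D1 by (simp add: c_def)
  have cc: "c ^ (2 * n) = (36 * D) ^ n" for n using D1 by (simp add: c_def power_mult power_mult_distrib)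
  have d4: "real d \<le> 4 ^ p"
  proof -
    have "real d = exp (ln (real d))" using d1 by simp
    also have "\<dots> \<le> exp (real s)" by (subst exp_le_cancel_iff) (rule s(3))
    also have "\<dots> = exp 1 ^ s" by (simp flip: exp_of_nat_mult)
    also have "\<dots> \<le> 3 ^ s" by (intro power_mono exp_le) auto
    also have "\<dots> \<le> 4 ^ s" by (intro power_mono) auto
    also have "\<dots> \<le> 4 ^ p" by (intro power_increasing) (auto simp: p_def)
    finally show ?thesis .
  qed
  let ?N = "\<lambda>A. etr (sample_space d k) d (replicate (2 * p) A)"
  have S: "?N (perm_summand d r) \<le> c ^ (2 * p)" if "r \<in> {1..k}" for r
  proof -
    have "?N (perm_summand d r) \<le> real d * 4 ^ p" by (rule perm_summand_moment[OF that d])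
    also have "\<dots> \<le> 4 ^ p * 4 ^ p" using d4 by (intro mult_right_mono) auto
    also have "\<dots> = 16 ^ p" by (subst power_mult_distrib[symmetric]) simp
    also have "\<dots> \<le> (36 * D) ^ p" using D1 by (intro power_mono) auto
    finally show ?thesis by (simp add: cc)
  qed
  have Dp: "real d / (real d - 1) * (1 + 9 * (real p + 1)\<^sup>2 / real d) = D" by (simp add: D_def p_def)
  have T: "?N (sign_summand d r) \<le> c ^ (2 * p)" if "r \<in> {1..k}" for r
  proof -
    have "sign_summand d r = (\<lambda>\<omega> a b. \<Sum>i\<in>{r}. sign_summand d i \<omega> a b)"
      by (simp add: fun_eq_iff)
    then have "?N (sign_summand d r) = ?N (\<lambda>\<omega> a b. \<Sum>i\<in>{r}. sign_summand d i \<omega> a b)"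
      by (simp only:)
    also have "\<dots> \<le> real d * (8 * real (card {r}) * (real d / (real d - 1)) * (1 + 9 * (real p + 1)\<^sup>2 / real d)) ^ p"
      by (rule sign_model_moment) (use d p that in auto)
    also have "\<dots> = real d * (8 * D) ^ p" by (simp add: Dp[symmetric] mult.assoc)
    also have "\<dots> \<le> 4 ^ p * (8 * D) ^ p" using d4 D1 by (intro mult_right_mono) auto
    also have "\<dots> = (32 * D) ^ p" by (subst power_mult_distrib[symmetric]) simp
    also have "\<dots> \<le> (36 * D) ^ p" using D1 by (intro power_mono) auto
    finally show ?thesis by (simp add: cc)
  qed
  define G where "G = real d powr (1 / (2 * real s)) * sqrt (8 * real k * D) ^ 3"
  have G0: "G \<ge> 0" using D1 by (simp add: G_def)
  have GG: "G ^ (2 * s) = real d * (8 * real k * D) ^ p"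
  proof -
    have "(real d powr (1 / (2 * real s))) ^ (2 * s) = real d powr (1 / (2 * real s) * real (2 * s))"
      using d1 by (subst powr_realpow[symmetric]) (auto simp: powr_powr)
    also have "\<dots> = real d" using s d1 by simp
    finally have 1: "(real d powr (1 / (2 * real s))) ^ (2 * s) = real d" .
    have "(sqrt (8 * real k * D) ^ 3) ^ (2 * s) = sqrt (8 * real k * D) ^ (3 * (2 * s))" by (rule power_mult[symmetric])
    also have "3 * (2 * s) = 2 * p" by (simp add: p_def)
    also have "sqrt (8 * real k * D) ^ (2 * p) = (8 * real k * D) ^ p" using D1 by (simp add: power_mult)
    finally have "(sqrt (8 * real k * D) ^ 3) ^ (2 * s) = (8 * real k * D) ^ p" .
    then show ?thesis using 1 by (simp add: G_def power_mult_distrib)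
  qed
  \<comment> \<open>A sum serves instead of a maximum: \<open>W0\<close> dominates both the initial
    moment and the threshold of \<open>hybrid_moment\<close>.\<close>
  define W0 where "W0 = G + (c * real (3 * s)) ^ 3"
  have W0: "W0 \<ge> (c * real (3 * s)) ^ 3" "W0 \<ge> G" using G0 c by (auto simp: W0_def)
  have H0: "?N (hybrid d k 0) \<le> W0 ^ (2 * s)"
  proof -
    have "hybrid d k 0 = (\<lambda>\<omega> a b. \<Sum>i\<in>{1..k}. sign_summand d i \<omega> a b)"
      by (simp add: fun_eq_iff hybrid_def atLeastSucAtMost_greaterThanAtMost)
    then have "?N (hybrid d k 0) \<le> real d * (8 * real (card {1..k}) * (real d / (real d - 1)) * (1 + 9 * (real p + 1)\<^sup>2 / real d)) ^ p"
      by (simp only:) (rule sign_model_moment, use d p in auto)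
    also have "\<dots> = G ^ (2 * s)" by (simp add: GG Dp[symmetric] mult.assoc)
    also have "\<dots> \<le> W0 ^ (2 * s)" using W0 G0 by (intro power_mono) auto
    finally show ?thesis .
  qed
  have N: "?N (hybrid d k k) \<le> W ^ (2 * s)"
  proof -
    have "?N (hybrid d k k) \<le> (W0 + 36 * c ^ 3 * (real (3 * s))\<^sup>2 * real k) ^ (2 * s)"
      unfolding p_def by (rule hybrid_moment) (use d s c S T W0 H0 in \<open>auto simp: p_def\<close>)
    also have "W0 + 36 * c ^ 3 * (real (3 * s))\<^sup>2 * real k = W" by (simp add: W_def W0_def G_def c_def)
    finally show ?thesis .
  qed
  have W0': "W \<ge> 0" unfolding W_def using D1 by (intro add_nonneg_nonneg mult_nonneg_nonneg zero_le_power) auto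
  have "(real d powr (a / (2 * real s))) ^ (2 * s) = real d powr (a / (2 * real s) * real (2 * s))"
    using d1 by (subst powr_realpow[symmetric]) (auto simp: powr_powr)
  also have "\<dots> = real d powr a" using s by simp
  finally have da: "(real d powr (a / (2 * real s))) ^ (2 * s) = real d powr a" .
  have "real d powr a * W ^ (2 * s) = (real d powr (a / (2 * real s)) * W) ^ (2 * s)"
    by (simp add: power_mult_distrib da)
  also have "\<dots> \<le> (t ^ 3) ^ (2 * s)" using t W0' by (intro power_mono) auto
  also have "\<dots> = t ^ (2 * p)" by (simp add: p_def flip: power_mult)
  finally have "?N (hybrid d k k) * real d powr a \<le> t ^ (2 * p)"
    using mult_right_mono[OF N, of "real d powr a"] by (simp add: mult.commute)
  then have "?N (hybrid d k k) / t ^ (2 * p) \<le> real d powr (- a)"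
    using t d1 by (simp add: powr_minus field_simps)
  then show ?thesis using norm_perp_tail[OF p(1) t(1), of d k] by linarith
qed

section \<open>Choice of the moment\<close>

text \<open>
  \<open>M\<close> is the order of the moment; the substitution by \<open>x\<close>, \<open>y\<close>, \<open>z\<close> makes all exponents integral.
\<close>
lemma degree_choice_bounds:
  fixes d k :: nat and x y z M :: real
  assumes d: "d \<ge> 2" and k: "k \<ge> 1"
    and x: "x = ln (real d) powr (1 / 12)" and y: "y = real k powr (1 / 6)" and z: "z = real d powr (1 / 4)"
    and M: "M = max (x ^ 12) (min (x ^ 4 * y) (x ^ 3 * z))"
  shows "x > 0" "y \<ge> 1" "z \<ge> 1" "x ^ 12 = ln (real d)" "y ^ 6 = real k" "z ^ 4 = real d" "M \<ge> 1 / 2" "M \<le> real d"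
    "x ^ 12 / M \<le> x ^ 9 / z + x ^ 8 / y"
    "M ^ 3 / y ^ 9 \<le> (x ^ 12 / y ^ 3) ^ 3 + x ^ 12 / y ^ 3"
    "M\<^sup>2 / y ^ 3 \<le> (x ^ 8 / y) ^ 3 + x ^ 8 / y"
    "M\<^sup>2 / z ^ 4 \<le> 3 * (x ^ 9 / z)"
    "M\<^sup>2 / z ^ 4 \<le> 4"
proof -
  have d0: "real d > 0" using d by simp
  have ln2: "ln (2::real) \<ge> 1 / 2"
    using ln_le_minus_one[of "1 / 2 :: real"] by (simp add: ln_div)
  have "ln 2 \<le> ln (real d)" using d by (subst ln_le_cancel_iff) auto
  then have l: "ln (real d) \<ge> 1 / 2" using ln2 by linarith
  show x0: "x > 0" using l by (simp add: x)
  show y1: "y \<ge> 1" using k by (simp add: y ge_one_powr_ge_zero)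
  show z1: "z \<ge> 1" using d by (simp add: z ge_one_powr_ge_zero)
  show xl: "x ^ 12 = ln (real d)" using l by (simp add: x powr_powr flip: powr_realpow')
  show yk: "y ^ 6 = real k" using k by (simp add: y powr_powr flip: powr_realpow')
  show zd: "z ^ 4 = real d" using d by (simp add: z powr_powr flip: powr_realpow')
  show Mh: "M \<ge> 1 / 2" using l xl M by simp
  \<comment> \<open>The estimate ln d \<le> 2 sqrt d, from the logarithm of sqrt d; ln d \<le> d
    would be too weak for the last two claims when \<open>M\<close> is ln d.\<close>
  have x12: "x ^ 12 \<le> 2 * z\<^sup>2"
  proof -
    have "sqrt (real d) = z\<^sup>2" using zd z1 by (intro real_sqrt_unique) (auto simp flip: power_mult)
    moreover have "ln (sqrt (real d)) \<le> sqrt (real d) - 1" using d0 by (intro ln_le_minus_one) simp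
    moreover have "ln (sqrt (real d)) = ln (real d) / 2" using d0 by (simp add: ln_sqrt)
    ultimately show ?thesis using xl by linarith
  qed
  have xz: "x ^ 3 \<le> z"
  proof (rule power_le_imp_le_base[of _ 3])
    have "ln (real d) \<le> real d - 1" using d0 by (rule ln_le_minus_one)
    then show "(x ^ 3) ^ Suc 3 \<le> z ^ Suc 3" using xl zd by (simp flip: power_mult)
  qed (use z1 in simp)
  have xz1: "x ^ 3 * z \<ge> 1"
  proof (rule power_le_imp_le_base[of _ 3])
    have "1 \<le> ln (real d) * real d" using l d mult_mono[of "1/2" "ln (real d)" 2 "real d"] by simp
    then show "1 ^ Suc 3 \<le> (x ^ 3 * z) ^ Suc 3" using xl zd by (simp add: power_mult_distrib flip: power_mult)
  qed (use x0 z1 in simp)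
  \<comment> \<open>Either \<open>M\<close> is ln d, or it is below both (ln d)^(1/3) k^(1/6) and (d
    ln d)^(1/4), the orders at which (ln d)/M equals the second and the first error term of the
    theorem.\<close>
  have M_cases: "M = x ^ 12 \<or> M \<le> x ^ 4 * y \<and> M \<le> x ^ 3 * z" using M by auto
  show "M \<le> real d"
  proof (cases "M = x ^ 12")
    case True
    have "ln (real d) \<le> real d - 1" using d0 by (rule ln_le_minus_one)
    then show ?thesis using True xl by simp
  next
    case False
    then have "M \<le> x ^ 3 * z" using M_cases by auto
    also have "\<dots> \<le> z * z" using xz z1 by (intro mult_right_mono) auto
    also have "\<dots> = z ^ 2 * 1" by (simp add: power2_eq_square)
    also have "\<dots> \<le> z ^ 2 * z ^ 2" using z1 by (intro mult_left_mono) auto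
    also have "\<dots> = z ^ 4" by (simp flip: power_add)
    finally show ?thesis using zd by simp
  qed
  have M0: "M > 0" using Mh by simp
  have e0: "x ^ 9 / z \<ge> 0" "x ^ 8 / y \<ge> 0" "x ^ 12 / y ^ 3 \<ge> 0" using x0 y1 z1 by auto
  show "x ^ 12 / M \<le> x ^ 9 / z + x ^ 8 / y"
  proof -
    have "min (x ^ 4 * y) (x ^ 3 * z) \<le> M" using M by simp
    then consider "x ^ 4 * y \<le> M" | "x ^ 3 * z \<le> M" by (auto simp: min_def split: if_splits)
    then show ?thesis
    proof cases
      case 1
      have "x ^ 12 / M \<le> x ^ 12 / (x ^ 4 * y)" using 1 x0 y1 M0 by (intro divide_left_mono) auto
      also have "\<dots> = x ^ 8 / y" using x0 y1 by (simp add: field_simps flip: power_add)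
      finally show ?thesis using e0 by linarith
    next
      case 2
      have "x ^ 12 / M \<le> x ^ 12 / (x ^ 3 * z)" using 2 x0 z1 M0 by (intro divide_left_mono) auto
      also have "\<dots> = x ^ 9 / z" using x0 z1 by (simp add: field_simps flip: power_add)
      finally show ?thesis using e0 by linarith
    qed
  qed
  show "M ^ 3 / y ^ 9 \<le> (x ^ 12 / y ^ 3) ^ 3 + x ^ 12 / y ^ 3"
  proof (cases "M = x ^ 12")
    case True
    then show ?thesis using e0 by (simp add: power_divide flip: power_mult)
  next
    case False
    then have "M ^ 3 \<le> (x ^ 4 * y) ^ 3" using M_cases M0 by (intro power_mono) auto
    also have "\<dots> = x ^ 12 * y ^ 3" by (simp add: power_mult_distrib flip: power_mult)
    finally have "M ^ 3 / y ^ 9 \<le> x ^ 12 * y ^ 3 / y ^ 9" using y1 by (intro divide_right_mono) auto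
    also have "\<dots> = x ^ 12 / y ^ 6" using y1 by (simp add: field_simps flip: power_add)
    also have "\<dots> \<le> x ^ 12 / y ^ 3" using y1 x0 by (intro divide_left_mono power_increasing) auto
    finally show ?thesis using e0 by (simp add: add_increasing)
  qed
  show "M\<^sup>2 / y ^ 3 \<le> (x ^ 8 / y) ^ 3 + x ^ 8 / y"
  proof (cases "M = x ^ 12")
    case True
    then show ?thesis using e0 by (simp add: power_divide flip: power_mult)
  next
    case False
    then have "M\<^sup>2 \<le> (x ^ 4 * y)\<^sup>2" using M_cases M0 by (intro power_mono) auto
    also have "\<dots> = x ^ 8 * y\<^sup>2" by (simp add: power_mult_distrib flip: power_mult)
    finally have "M\<^sup>2 / y ^ 3 \<le> x ^ 8 * y\<^sup>2 / y ^ 3" using y1 by (intro divide_right_mono) auto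
    also have "\<dots> = x ^ 8 / y" using y1 by (simp add: power2_eq_square power3_eq_cube)
    finally show ?thesis using e0 by (simp add: add_increasing)
  qed
  show "M\<^sup>2 / z ^ 4 \<le> 3 * (x ^ 9 / z)"
  proof (cases "M = x ^ 12")
    case True
    \<comment> \<open>The claim reduces to x^15 \<le> 3 z^3, whose fourth power reads (ln d)^5 \<le>
      81 d^3.\<close>
    have "(x ^ 15) ^ Suc 3 = (x ^ 12) ^ 5" by (simp flip: power_mult)
    also have "\<dots> \<le> (2 * z\<^sup>2) ^ 5" using x12 x0 by (intro power_mono) auto
    also have "\<dots> = 32 * z ^ 10" by (simp add: power_mult_distrib flip: power_mult)
    also have "\<dots> \<le> 81 * z ^ 12" using z1 by (intro mult_mono power_increasing) auto
    also have "\<dots> = (3 * z ^ 3) ^ Suc 3" by (simp add: power_mult_distrib flip: power_mult)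
    finally have "x ^ 15 \<le> 3 * z ^ 3" by (rule power_le_imp_le_base) (use z1 in simp)
    then have "x ^ 9 * x ^ 15 \<le> x ^ 9 * (3 * z ^ 3)" using x0 by (intro mult_left_mono) auto
    then have "M\<^sup>2 \<le> 3 * x ^ 9 * z ^ 3" using True by (simp add: mult_ac flip: power_mult power_add)
    then have "M\<^sup>2 / z ^ 4 \<le> 3 * x ^ 9 * z ^ 3 / z ^ 4" using z1 by (intro divide_right_mono) auto
    also have "\<dots> = 3 * (x ^ 9 / z)" using z1 by (simp add: power3_eq_cube power4_eq_xxxx)
    finally show ?thesis .
  next
    case False
    then have "M\<^sup>2 \<le> (x ^ 3 * z)\<^sup>2" using M_cases M0 by (intro power_mono) auto
    also have "\<dots> = x ^ 6 * z\<^sup>2 * 1" by (simp add: power_mult_distrib flip: power_mult)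
    also have "\<dots> \<le> x ^ 6 * z\<^sup>2 * (x ^ 3 * z)" using xz1 x0 by (intro mult_left_mono) auto
    also have "\<dots> = x ^ 9 * z ^ 3" by (simp add: mult_ac power2_eq_square power3_eq_cube flip: power_add) (simp add: eval_nat_numeral)
    finally have "M\<^sup>2 / z ^ 4 \<le> x ^ 9 * z ^ 3 / z ^ 4" using z1 by (intro divide_right_mono) auto
    also have "\<dots> = x ^ 9 / z" using z1 by (simp add: power3_eq_cube power4_eq_xxxx)
    finally show ?thesis using e0 by linarith
  qed
  show "M\<^sup>2 / z ^ 4 \<le> 4"
  proof (cases "M = x ^ 12")
    case True
    have "(x ^ 12)\<^sup>2 \<le> (2 * z\<^sup>2)\<^sup>2" using x12 x0 by (intro power_mono) auto
    then show ?thesis using True z1 by (simp add: power_mult_distrib divide_le_eq flip: power_mult)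
  next
    case False
    then have "M\<^sup>2 \<le> (x ^ 3 * z)\<^sup>2" using M_cases M0 by (intro power_mono) auto
    also have "\<dots> \<le> (z * z)\<^sup>2" using xz z1 x0 by (intro power_mono mult_right_mono) auto
    also have "\<dots> = z ^ 4" by (simp add: power2_eq_square power4_eq_xxxx)
    finally have "M\<^sup>2 / z ^ 4 \<le> 1" using z1 by (simp add: divide_le_eq)
    then show ?thesis by linarith
  qed
qed

text \<open>This turns the dimension and tail factors, which are exponentials of a multiple of (ln
  d)/s, into 1 plus a linear error.\<close>

lemma exp_linear_bound: "u \<ge> 0 \<Longrightarrow> u \<le> b \<Longrightarrow> exp u \<le> 1 + u * exp (b :: real)"
proof -
  assume u: "u \<ge> 0" "u \<le> b"
  have "1 - u \<le> exp (- u)" using exp_ge_add_one_self[of "- u"] by simp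
  then have "(1 - u) * exp u \<le> exp (- u) * exp u" by (intro mult_right_mono) auto
  also have "\<dots> = 1" by (simp flip: exp_add)
  finally have "exp u \<le> 1 + u * exp u" by (simp add: algebra_simps)
  also have "\<dots> \<le> 1 + u * exp b" using u by (intro add_left_mono mult_left_mono) auto
  finally show ?thesis .
qed

text \<open>Origin of the constants: \<open>\<delta>\<close> is at most 4 * 1296 = 5184 and d/(d -
  1) at most 2, so \<open>D\<close> is at most 2 (1 + 5184) = 10370, and 10371 bounds D + 1.
  Further, D - 1 is at most 2 * 3888 + 24 = 7800 times \<open>e1\<close>. Finally 1000000 dominates
  5832 * 27 and 69984 * 9, where 5832 = 6^3 3^3 and 69984 = 36 * 6^3 3^2 come from
  \<open>W\<close>.\<close>

lemma concentration_bound_le: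
  fixes d k :: nat and a :: real
  defines "Q \<equiv> exp (a / 2) * 10370\<^sup>2 * 1000000"
  defines "C \<equiv> 1 + 7800 * 10371 + (a + 1) / 2 * exp ((a + 1) / 2) * 10370\<^sup>2 + Q"
  assumes d: "d \<ge> 2" and k: "k \<ge> 1" and a: "a > 0"
  shows "measure_pmf.prob (iid_perm_matrices d k)
      {P. norm_perp d (perm_model d k P)
         \<le> (1 + C * (ln (real d) powr (3/4) / real d powr (1/4))
              + C * (ln (real d) powr (2/3) / real k powr (1/6))
              + C * (ln (real d) / real k powr (1/2))) * (2 * sqrt (2 * real k))}
    \<ge> 1 - real d powr (- a)"
proof -
  define x where "x = ln (real d) powr (1 / 12)"
  define y where "y = real k powr (1 / 6)"
  define z where "z = real d powr (1 / 4)"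
  define M where "M = max (x ^ 12) (min (x ^ 4 * y) (x ^ 3 * z))"
  note B = degree_choice_bounds[OF d k x_def y_def z_def M_def]
  \<comment> \<open>Since \<open>M\<close> is at least 1/2, rounding up costs at most a factor 3.
    The moment actually used has order 6s, a constant multiple of \<open>M\<close>.\<close>
  define s where "s = nat \<lceil>M\<rceil>"
  have sM: "M \<le> real s" "real s \<le> M + 1" using B(7) unfolding s_def by linarith+
  have s3: "real s \<le> 3 * M" using sM B(7) by linarith
  have s1: "s \<ge> 1" using sM B(7) by linarith
  have s2: "s \<le> 2 * d" using sM B(8) d by linarith
  have lM: "ln (real d) \<le> M" using B(4) by (simp add: M_def)
  then have sl: "ln (real d) \<le> real s" using sM by linarith
  have d0: "real d > 0" "real d - 1 > 0" using d by auto
  have l0: "ln (real d) > 0" using d by simp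
  define e1 e2 e3 where "e1 = x ^ 9 / z" and "e2 = x ^ 8 / y" and "e3 = x ^ 12 / y ^ 3"
  have e0: "e1 \<ge> 0" "e2 \<ge> 0" "e3 \<ge> 0" using B(1-3) by (auto simp: e1_def e2_def e3_def)
  define E where "E = e1 + e2 + e3"
  have E0: "E \<ge> 0" "e1 \<le> E" "e2 \<le> E" "e3 \<le> E" using e0 by (auto simp: E_def)
  have ee: "ln (real d) powr (3/4) / real d powr (1/4) = e1" "ln (real d) powr (2/3) / real k powr (1/6) = e2"
     "ln (real d) / real k powr (1/2) = e3"
  proof -
    have "x ^ 9 = ln (real d) powr (3/4)" "x ^ 8 = ln (real d) powr (2/3)"
      using l0 by (simp_all add: x_def powr_powr flip: powr_realpow')
    moreover have "y ^ 3 = real k powr (1/2)" using k by (simp add: y_def powr_powr flip: powr_realpow')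
    ultimately show "ln (real d) powr (3/4) / real d powr (1/4) = e1" "ln (real d) powr (2/3) / real k powr (1/6) = e2"
     "ln (real d) / real k powr (1/2) = e3"
      using B(4) by (simp_all add: e1_def e2_def e3_def z_def y_def)
  qed
  define \<delta> where "\<delta> = 9 * (3 * real s + 1)\<^sup>2 / real d"
  define D where "D = real d / (real d - 1) * (1 + \<delta>)"
  have \<delta>0: "\<delta> \<ge> 0" by (simp add: \<delta>_def)
  have \<delta>M: "\<delta> \<le> 1296 * (M\<^sup>2 / real d)"
  proof -
    have "3 * real s + 1 \<le> 12 * M" using s1 s3 by linarith
    then have "(3 * real s + 1)\<^sup>2 \<le> (12 * M)\<^sup>2" by (intro power_mono) auto
    then have "9 * (3 * real s + 1)\<^sup>2 \<le> 1296 * M\<^sup>2" by (simp add: power_mult_distrib)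
    then show ?thesis unfolding \<delta>_def using d0 by (simp add: divide_right_mono)
  qed
  have \<delta>1: "\<delta> \<le> 3888 * e1" "\<delta> \<le> 5184" using \<delta>M B(12,13) B(6) by (auto simp: e1_def)
  have invd: "1 / real d \<le> 12 * e1"
  proof -
    have "1 \<le> 4 * M\<^sup>2" using power_mono[OF B(7), of 2] by (simp add: power_divide)
    then have "1 / real d \<le> 4 * M\<^sup>2 / real d" using d0 by (intro divide_right_mono) auto
    then show ?thesis using B(12) B(6) by (simp add: e1_def)
  qed
  have D1: "D \<ge> 1"
  proof -
    have "1 \<le> real d / (real d - 1)" using d0 by simp
    then show ?thesis unfolding D_def using \<delta>0 mult_mono[of 1 "real d / (real d - 1)" 1 "1 + \<delta>"] by simp
  qed
  have r: "real d / (real d - 1) = 1 + 1 / (real d - 1)" "1 / (real d - 1) \<le> 2 / real d" "1 / (real d - 1) \<le> 1"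
    using d0 d by (auto simp: field_simps)
  have DD: "D \<le> 10370"
  proof -
    have "D \<le> 2 * (1 + 5184)" unfolding D_def using r \<delta>0 \<delta>1 by (intro mult_mono) auto
    then show ?thesis by simp
  qed
  have De: "D - 1 \<le> 7800 * e1"
  proof -
    have "D - 1 = \<delta> + 1 / (real d - 1) * \<delta> + 1 / (real d - 1)" unfolding D_def r(1) by (simp add: algebra_simps add_divide_distrib)
    also have "\<dots> \<le> \<delta> + 1 * \<delta> + 2 / real d" using r \<delta>0 by (intro add_mono mult_right_mono) auto
    also have "\<dots> \<le> 7800 * e1" using \<delta>1 invd by simp
    finally show ?thesis .
  qed
  have D2: "D\<^sup>2 \<le> 1 + 7800 * 10371 * e1" "D\<^sup>2 \<le> 10370\<^sup>2"
  proof -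
    have "D\<^sup>2 - 1 = (D - 1) * (D + 1)" by (simp add: power2_eq_square algebra_simps)
    also have "\<dots> \<le> (7800 * e1) * 10371" using De DD D1 by (intro mult_mono) auto
    finally show "D\<^sup>2 \<le> 1 + 7800 * 10371 * e1" by simp
    show "D\<^sup>2 \<le> 10370\<^sup>2" using DD D1 by (intro power_mono) auto
  qed
  \<comment> \<open>As \<open>D\<close> is at least 1, the exponent 3/2 may be rounded up to 2,
    which removes the root.\<close>
  have sqD: "sqrt D ^ 3 \<le> D\<^sup>2"
  proof -
    have "sqrt D ^ 3 \<le> sqrt D ^ 4" using D1 by (intro power_increasing) auto
    also have "\<dots> = (sqrt D ^ 2) ^ 2" by (simp flip: power_mult)
    also have "\<dots> = D\<^sup>2" using D1 by simp
    finally show ?thesis .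
  qed
  define m where "m = 2 * sqrt (2 * real k)"
  have m8: "sqrt (8 * real k) = m"
    unfolding m_def by (rule real_sqrt_unique) (auto simp: power_mult_distrib)
  have m0: "m > 0" using k by (simp add: m_def)
  have ym: "y ^ 9 \<le> m ^ 3"
  proof -
    have "y ^ 3 = sqrt (real k)" using B(2,5) by (intro real_sqrt_unique[symmetric]) (auto simp flip: power_mult)
    also have "\<dots> \<le> m" unfolding m8[symmetric] by simp
    finally have "(y ^ 3) ^ 3 \<le> m ^ 3" using B(2) by (intro power_mono) auto
    then show ?thesis by (simp flip: power_mult)
  qed
  have y9: "y ^ 9 > 0" using B(2) by simp
  have s3m: "real s ^ 3 / m ^ 3 \<le> 27 * (e3 ^ 3 + e3)"
  proof -
    have "real s ^ 3 \<le> (3 * M) ^ 3" using s3 by (intro power_mono) auto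
    then have "real s ^ 3 \<le> 27 * M ^ 3" by (simp add: power_mult_distrib)
    then have "real s ^ 3 / m ^ 3 \<le> 27 * M ^ 3 / y ^ 9" using ym y9 m0 B(7) by (intro frac_le) auto
    then show ?thesis using B(10) by (simp add: e3_def)
  qed
  have s2m: "(real s)\<^sup>2 * real k / m ^ 3 \<le> 9 * (e2 ^ 3 + e2)"
  proof -
    have "(real s)\<^sup>2 \<le> (3 * M)\<^sup>2" using s3 by (intro power_mono) auto
    then have "(real s)\<^sup>2 * real k \<le> 9 * M\<^sup>2 * y ^ 6" using B(5) by (simp add: power_mult_distrib mult_right_mono)
    then have "(real s)\<^sup>2 * real k / m ^ 3 \<le> 9 * M\<^sup>2 * y ^ 6 / y ^ 9" using ym y9 m0 B(7) by (intro frac_le) auto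
    also have "\<dots> = 9 * (M\<^sup>2 / y ^ 3)" using B(2) by (simp add: field_simps flip: power_add)
    finally show ?thesis using B(11) by (simp add: e2_def)
  qed
  have powr_exp: "real d powr (b / (2 * real s)) = exp (b / 2 * (ln (real d) / real s))" for b
    using d0 by (simp add: powr_def)
  have ls: "ln (real d) / real s \<le> 1" "ln (real d) / real s \<le> e1 + e2" "ln (real d) / real s \<ge> 0"
  proof -
    show "ln (real d) / real s \<le> 1" using sl s1 by simp
    have "ln (real d) / real s \<le> ln (real d) / M" using sM B(7) l0 s1 by (intro divide_left_mono) auto
    then show "ln (real d) / real s \<le> e1 + e2" using B(9) B(4) by (simp add: e1_def e2_def)
    show "ln (real d) / real s \<ge> 0" using l0 by simp
  qed
  have pa: "real d powr (a / (2 * real s)) \<le> exp (a / 2)"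
  proof -
    have "a / 2 * (ln (real d) / real s) \<le> a / 2 * 1" using ls a by (intro mult_left_mono) auto
    then show ?thesis unfolding powr_exp by (subst exp_le_cancel_iff) (simp only: mult_1_right)
  qed
  define b where "b = (a + 1) / 2"
  have b0: "b > 0" using a by (simp add: b_def)
  have pb: "real d powr (a / (2 * real s)) * real d powr (1 / (2 * real s)) \<le> 1 + b * exp b * (e1 + e2)"
  proof -
    have "real d powr (a / (2 * real s)) * real d powr (1 / (2 * real s)) = real d powr ((a + 1) / (2 * real s))"
      by (simp add: powr_add[symmetric] add_divide_distrib)
    also have "\<dots> = exp (b * (ln (real d) / real s))" unfolding powr_exp b_def ..
    also have "\<dots> \<le> 1 + (b * (ln (real d) / real s)) * exp b"
    proof (rule exp_linear_bound)
      show "b * (ln (real d) / real s) \<ge> 0" using ls b0 by (intro mult_nonneg_nonneg) auto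
      have "b * (ln (real d) / real s) \<le> b * 1" using ls b0 by (intro mult_left_mono) auto
      then show "b * (ln (real d) / real s) \<le> b" by (simp only: mult_1_right)
    qed
    also have "\<dots> \<le> 1 + (b * (e1 + e2)) * exp b" using ls b0 by (intro add_left_mono mult_right_mono mult_left_mono) auto
    finally show ?thesis by (simp add: mult_ac)
  qed
  define W where "W = real d powr (1 / (2 * real s)) * sqrt (8 * real k * D) ^ 3 + (6 * sqrt D * (3 * real s)) ^ 3
     + 36 * (6 * sqrt D) ^ 3 * (3 * real s)\<^sup>2 * real k"
  define t where "t = (1 + C * E) * m"
  have Q0: "Q \<ge> 0" by (simp add: Q_def)
  have C1: "C \<ge> 1" using Q0 a by (simp add: C_def)
  have t0: "t > 0" unfolding t_def using C1 E0 m0 by (intro mult_pos_pos add_pos_nonneg) auto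
  have e23: "e2 + e3 \<le> E" "e2 ^ 3 + e3 ^ 3 \<le> E ^ 3"
  proof -
    show "e2 + e3 \<le> E" using e0 by (simp add: E_def)
    have "e2 ^ 3 + e3 ^ 3 \<le> (e2 + e3) ^ 3" using e0 by (simp add: power3_eq_cube algebra_simps)
    also have "\<dots> \<le> E ^ 3" using e0 by (intro power_mono) (auto simp: E_def)
    finally show "e2 ^ 3 + e3 ^ 3 \<le> E ^ 3" .
  qed
  have "real d powr (a / (2 * real s)) * W \<le> t ^ 3"
  proof -
    have W: "W = m ^ 3 * (real d powr (1 / (2 * real s)) * sqrt D ^ 3 + sqrt D ^ 3 * (5832 * (real s ^ 3 / m ^ 3) + 69984 * ((real s)\<^sup>2 * real k / m ^ 3)))"
      using m0 by (simp add: W_def real_sqrt_mult[of "8 * real k" D] m8 power_mult_distrib distrib_left)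
    have "real d powr (a / (2 * real s)) * (real d powr (1 / (2 * real s)) * sqrt D ^ 3 + sqrt D ^ 3 * (5832 * (real s ^ 3 / m ^ 3) + 69984 * ((real s)\<^sup>2 * real k / m ^ 3)))
       = (real d powr (a / (2 * real s)) * real d powr (1 / (2 * real s))) * sqrt D ^ 3
         + real d powr (a / (2 * real s)) * (sqrt D ^ 3 * (5832 * (real s ^ 3 / m ^ 3) + 69984 * ((real s)\<^sup>2 * real k / m ^ 3)))"
      by (simp add: algebra_simps)
    also have "\<dots> \<le> (1 + b * exp b * (e1 + e2)) * D\<^sup>2
        + exp (a / 2) * (10370\<^sup>2 * (5832 * (27 * (e3 ^ 3 + e3)) + 69984 * (9 * (e2 ^ 3 + e2))))"
      using pa pb sqD D1 D2 s3m s2m b0 e0 m0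
      by (intro add_mono mult_mono order_trans[OF sqD]) (auto intro!: mult_nonneg_nonneg add_nonneg_nonneg)
    also have "\<dots> \<le> (1 + C * (E + E ^ 3))"
    proof -
      have 1: "(1 + b * exp b * (e1 + e2)) * D\<^sup>2 \<le> 1 + 7800 * 10371 * E + b * exp b * 10370\<^sup>2 * E"
      proof -
        have "(1 + b * exp b * (e1 + e2)) * D\<^sup>2 = D\<^sup>2 + (b * exp b * (e1 + e2)) * D\<^sup>2" by (simp add: algebra_simps)
        also have "\<dots> \<le> (1 + 7800 * 10371 * e1) + (b * exp b * (e1 + e2)) * 10370\<^sup>2"
          using D2 b0 e0 by (intro add_mono mult_left_mono) auto
        also have "\<dots> \<le> (1 + 7800 * 10371 * E) + (b * exp b * E) * 10370\<^sup>2"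
          using b0 e0 by (intro add_mono mult_mono mult_left_mono) (auto simp: E_def)
        finally show ?thesis by (simp add: mult_ac)
      qed
      have 2: "exp (a / 2) * (10370\<^sup>2 * (5832 * (27 * (e3 ^ 3 + e3)) + 69984 * (9 * (e2 ^ 3 + e2)))) \<le> Q * (E + E ^ 3)"
      proof -
        have "5832 * (27 * (e3 ^ 3 + e3)) + 69984 * (9 * (e2 ^ 3 + e2)) \<le> 1000000 * ((e2 + e3) + (e2 ^ 3 + e3 ^ 3))"
          using e0 zero_le_power[OF e0(2), of 3] zero_le_power[OF e0(3), of 3] by (simp add: algebra_simps)
        also have "\<dots> \<le> 1000000 * (E + E ^ 3)" using e23 by (intro mult_left_mono add_mono) auto
        finally have "exp (a / 2) * (10370\<^sup>2 * (5832 * (27 * (e3 ^ 3 + e3)) + 69984 * (9 * (e2 ^ 3 + e2)))) \<le> exp (a / 2) * (10370\<^sup>2 * (1000000 * (E + E ^ 3)))"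
          by (intro mult_left_mono) auto
        then show ?thesis by (simp add: Q_def mult_ac)
      qed
      have E3: "E ^ 3 \<ge> 0" using E0 by simp
      have "C * (E + E ^ 3) = (E + E ^ 3) + 7800 * 10371 * (E + E ^ 3) + b * exp b * 10370\<^sup>2 * (E + E ^ 3) + Q * (E + E ^ 3)"
        unfolding C_def b_def[symmetric] by (simp only: distrib_right mult_1_left)
      moreover have "7800 * 10371 * E \<le> 7800 * 10371 * (E + E ^ 3)" using E3 by simp
      moreover have "b * exp b * 10370\<^sup>2 * E \<le> b * exp b * 10370\<^sup>2 * (E + E ^ 3)"
        using E3 b0 by (intro mult_left_mono) auto
      ultimately show ?thesis using 1 2 E0(1) E3 by linarith
    qed
    \<comment> \<open>The errors are those of a cubed norm. Their cubic part, which is dominant when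
      ln d exceeds sqrt k, fits below (C E)^3, so after the cube root all errors are linear in
      \<open>E\<close>.\<close>
    also have "\<dots> \<le> (1 + C * E) ^ 3"
    proof -
      have "(1 + C * E) ^ 3 = 1 + 3 * (C * E) + 3 * (C * E)\<^sup>2 + (C * E) ^ 3"
        by (simp add: power2_eq_square power3_eq_cube algebra_simps)
      moreover have "C * E ^ 3 \<le> C ^ 3 * E ^ 3"
        using C1 E0 power_increasing[of 1 3 C] by (intro mult_right_mono) auto
      moreover have "C * E \<ge> 0" using C1 E0 by simp
      moreover have "(C * E) ^ 3 = C ^ 3 * E ^ 3" by (rule power_mult_distrib)
      moreover have "(C * E)\<^sup>2 \<ge> 0" by simp
      ultimately show ?thesis by (simp only: distrib_left)
    qed
    finally have "m ^ 3 * (real d powr (a / (2 * real s)) * (real d powr (1 / (2 * real s)) * sqrt D ^ 3 + sqrt D ^ 3 * (5832 * (real s ^ 3 / m ^ 3) + 69984 * ((real s)\<^sup>2 * real k / m ^ 3))))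
        \<le> m ^ 3 * (1 + C * E) ^ 3" using m0 by (intro mult_left_mono) auto
    then show ?thesis unfolding W t_def power_mult_distrib by (simp only: mult_ac)
  qed
  from norm_perp_concentration[OF d s1 s2 sl t0, of a k] this
  have "measure_pmf.prob (iid_perm_matrices d k) {P. norm_perp d (perm_model d k P) \<le> t} \<ge> 1 - real d powr (- a)"
    unfolding W_def D_def \<delta>_def by simp
  moreover have "t = (1 + C * (ln (real d) powr (3/4) / real d powr (1/4))
              + C * (ln (real d) powr (2/3) / real k powr (1/6))
              + C * (ln (real d) / real k powr (1/2))) * (2 * sqrt (2 * real k))"
    unfolding ee t_def m_def E_def by (simp add: distrib_left add.assoc)
  ultimately show ?thesis by simp
qed

section \<open>The second eigenvalue\<close>

lemma norm_perp_eigenvalue: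
  assumes A: "A \<in> carrier_mat d d" and v: "v \<in> orth_complement d (ones_vec d)" "v \<noteq> 0\<^sub>v d"
    and ev: "A *\<^sub>v v = r \<cdot>\<^sub>v v"
  shows "r \<le> norm_perp d A"
proof -
  have vd: "v \<in> carrier_vec d" using v by (simp add: orth_complement_def)
  define n where "n = vec_norm2 v"
  have sq: "w \<bullet> w = (\<Sum>i<d. (vec_index w i)\<^sup>2)" if "w \<in> carrier_vec d" for w :: "real vec"
    using that by (simp add: scalar_prod_def power2_eq_square atLeast0LessThan)
  have nn: "n > 0"
  proof -
    obtain i where i: "i < d" "vec_index v i \<noteq> 0" using v(2) vd by (metis carrier_vecD eq_vecI index_zero_vec)
    then have "0 < (\<Sum>i<d. (vec_index v i)\<^sup>2)" by (intro sum_pos2[of _ i]) auto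
    then show ?thesis by (simp add: n_def vec_norm2_def sq[OF vd])
  qed
  let ?S = "{v \<in> orth_complement d (ones_vec d). vec_norm2 v \<le> 1}"
  have scale: "vec_norm2 (c \<cdot>\<^sub>v w) = \<bar>c\<bar> * vec_norm2 w" if "w \<in> carrier_vec d" for c w
    using that by (simp add: vec_norm2_def real_sqrt_mult flip: mult.assoc)
  define u where "u = (1 / n) \<cdot>\<^sub>v v"
  have ud: "u \<in> carrier_vec d" using vd by (simp add: u_def)
  have nu: "vec_norm2 u = 1" using scale[OF vd, of "1 / n"] nn by (simp add: u_def n_def)
  have u: "u \<in> ?S"
    using v vd nu by (auto simp: u_def orth_complement_def ones_vec_def)
  have Au: "A *\<^sub>v u = r \<cdot>\<^sub>v u"
    unfolding u_def using A vd ev by (simp add: mult_mat_vec smult_smult_assoc mult.commute)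
  \<comment> \<open>A supremum of reals bounds its members only if the set is bounded above; the
    Frobenius norm is such a bound.\<close>
  have "bdd_above ((\<lambda>v. vec_norm2 (A *\<^sub>v v)) ` ?S)"
  proof (rule bdd_aboveI2)
    fix w assume w: "w \<in> ?S"
    then have wd: "w \<in> carrier_vec d" by (simp add: orth_complement_def)
    have w1: "(\<Sum>i<d. (vec_index w i)\<^sup>2) \<le> 1" using w sq[OF wd] by (simp add: vec_norm2_def)
    have "(A *\<^sub>v w) \<bullet> (A *\<^sub>v w) = (\<Sum>i<d. (\<Sum>j<d. A $$ (i, j) * vec_index w j)\<^sup>2)"
      using A wd by (subst sq) (auto simp: scalar_prod_def atLeast0LessThan)
    also have "\<dots> \<le> (\<Sum>i<d. (\<Sum>j<d. (A $$ (i, j))\<^sup>2) * 1)"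
      using w1 by (intro sum_mono order_trans[OF Cauchy_Schwarz_ineq_sum] mult_left_mono) (auto intro: sum_nonneg)
    finally show "vec_norm2 (A *\<^sub>v w) \<le> sqrt (\<Sum>i<d. (\<Sum>j<d. (A $$ (i, j))\<^sup>2) * 1)"
      unfolding vec_norm2_def by (simp only: real_sqrt_le_iff)
  qed
  then have "vec_norm2 (A *\<^sub>v u) \<le> norm_perp d A"
    unfolding norm_perp_def opnorm_on_def using u by (intro cSUP_upper) auto
  then show ?thesis using Au scale[OF ud, of r] nu by simp
qed

section \<open>Symmetric matrices with constant row sums\<close>

locale symmetric_row_sums =
  fixes A :: "real mat" and d :: nat and \<kappa> :: real
  assumes A: "A \<in> carrier_mat d d" and d: "d \<ge> 2"
    and sym: "\<And>i j. i < d \<Longrightarrow> j < d \<Longrightarrow> A $$ (i, j) = A $$ (j, i)"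
    and rows: "\<And>i. i < d \<Longrightarrow> (\<Sum>j<d. A $$ (i, j)) = \<kappa>"
begin

text \<open>The matrix of the map induced by \<open>A\<close> on the quotient by the span of the all-ones vector.\<close>
definition quotient_mat :: "real mat" where
  "quotient_mat = mat (d - 1) (d - 1) (\<lambda>(i, j). A $$ (Suc i, Suc j) - A $$ (0, Suc j))"

text \<open>\<open>U\<close> replaces the first basis vector by the all-ones vector and
  \<open>V\<close> is its inverse. As the all-ones vector is an eigenvector, \<open>A\<close>
  becomes block upper triangular in the new basis.\<close>

lemma char_poly_factor: "char_poly A = [:- \<kappa>, 1:] * char_poly quotient_mat"
proof -
  define U where "U = mat d d (\<lambda>(i, j). if j = 0 \<or> i = j then 1 else 0 :: real)"
  define V where "V = mat d d (\<lambda>(i, j). of_bool (j = i) - (if i = 0 then 0 else of_bool (j = 0)) :: real)"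
  have carr: "U \<in> carrier_mat d d" "V \<in> carrier_mat d d" by (auto simp: U_def V_def)
  have Vmult: "(V * M) $$ (i, j) = M $$ (i, j) - (if i = 0 then 0 else M $$ (0, j))"
    if "M \<in> carrier_mat d d" "i < d" "j < d" for M i j
  proof -
    have "(V * M) $$ (i, j) = (\<Sum>l<d. (of_bool (l = i) - (if i = 0 then 0 else of_bool (l = 0))) * M $$ (l, j))"
      using that carr by (simp add: V_def scalar_prod_def atLeast0LessThan)
    also have "\<dots> = (\<Sum>l<d. (if l = i then M $$ (l, j) else 0) - (if l = 0 then (if i = 0 then 0 else M $$ (0, j)) else 0))"
      by (intro sum.cong refl) auto
    also have "\<dots> = M $$ (i, j) - (if i = 0 then 0 else M $$ (0, j))"
      using that by (simp add: sum_subtractf)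
    finally show ?thesis .
  qed
  have VU: "V * U = 1\<^sub>m d"
  proof (rule eq_matI)
    fix i j assume "i < dim_row (1\<^sub>m d)" "j < dim_col (1\<^sub>m d)"
    then have ij: "i < d" "j < d" by auto
    show "(V * U) $$ (i, j) = 1\<^sub>m d $$ (i, j)"
      unfolding Vmult[OF carr(1) ij] using ij d by (auto simp: U_def)
  qed (use carr in auto)
  have UV: "U * V = 1\<^sub>m d" by (rule mat_mult_left_right_inverse[OF carr(2,1) VU])
  define B where "B = V * (A * U)"
  have AU: "A * U \<in> carrier_mat d d" using A carr by auto
  have Bc: "B \<in> carrier_mat d d" unfolding B_def using AU carr by auto
  have "U * B * V = (U * V) * (A * U) * V"
    unfolding B_def using carr A AU by (simp add: assoc_mult_mat[of _ d d _ d _ d])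
  also have "\<dots> = A * (U * V)" using UV carr A AU by (simp add: assoc_mult_mat[of _ d d _ d _ d])
  also have "\<dots> = A" using UV A by simp
  finally have "A = U * B * V" by simp
  then have "similar_mat A B" by (intro similar_matI[of _ _ U V d]) (use A Bc carr UV VU in auto)
  then have "char_poly A = char_poly B" by (rule char_poly_similar)
  moreover have "char_poly B = char_poly (four_block_mat (mat 1 1 (\<lambda>_. \<kappa>)) (mat 1 (d - 1) (\<lambda>(i, j). B $$ (0, Suc j))) (0\<^sub>m (d - 1) 1) quotient_mat)"
  proof (rule arg_cong[where f = char_poly])
  show "B = four_block_mat (mat 1 1 (\<lambda>_. \<kappa>)) (mat 1 (d - 1) (\<lambda>(i, j). B $$ (0, Suc j))) (0\<^sub>m (d - 1) 1) quotient_mat"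
  proof (rule eq_matI)
    fix i j assume "i < dim_row (four_block_mat (mat 1 1 (\<lambda>_. \<kappa>)) (mat 1 (d - 1) (\<lambda>(i, j). B $$ (0, Suc j))) (0\<^sub>m (d - 1) 1) quotient_mat)"
      "j < dim_col (four_block_mat (mat 1 1 (\<lambda>_. \<kappa>)) (mat 1 (d - 1) (\<lambda>(i, j). B $$ (0, Suc j))) (0\<^sub>m (d - 1) 1) quotient_mat)"
    then have ij: "i < d" "j < d" using d by (auto simp: quotient_mat_def)
    have AUe: "(A * U) $$ (i, j) = (if j = 0 then \<kappa> else A $$ (i, j))" if "i < d" "j < d" for i j
    proof -
      have "(A * U) $$ (i, j) = (\<Sum>l<d. A $$ (i, l) * (if j = 0 \<or> l = j then 1 else 0))"
        using that A carr by (simp add: U_def scalar_prod_def atLeast0LessThan)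
      also have "\<dots> = (\<Sum>l<d. if j = 0 then A $$ (i, l) else if l = j then A $$ (i, l) else 0)"
        by (intro sum.cong refl) auto
      finally show ?thesis using that rows by auto
    qed
    have Bij: "B $$ (i, j) = (if j = 0 then (if i = 0 then \<kappa> else 0) else A $$ (i, j) - (if i = 0 then 0 else A $$ (0, j)))"
      unfolding B_def Vmult[OF AU ij] using AUe ij d by auto
    show "B $$ (i, j) = four_block_mat (mat 1 1 (\<lambda>_. \<kappa>)) (mat 1 (d - 1) (\<lambda>(i, j). B $$ (0, Suc j))) (0\<^sub>m (d - 1) 1) quotient_mat $$ (i, j)"
    proof (cases "i = 0 \<and> j \<noteq> 0")
      case True
      then show ?thesis using ij d by (subst index_mat_four_block) (auto simp: quotient_mat_def)
    next
      case False
      then show ?thesis using ij d by (subst index_mat_four_block) (auto simp: quotient_mat_def Bij)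
    qed
  qed (use Bc d in \<open>auto simp: quotient_mat_def\<close>)
  qed
  moreover have "char_poly (four_block_mat (mat 1 1 (\<lambda>_. \<kappa>)) (mat 1 (d - 1) (\<lambda>(i, j). B $$ (0, Suc j))) (0\<^sub>m (d - 1) 1) quotient_mat)
      = char_poly (mat 1 1 (\<lambda>_. \<kappa>)) * char_poly quotient_mat"
    by (rule char_poly_four_block_zeros_col[where n = "d - 1"]) (auto simp: quotient_mat_def)
  moreover have "char_poly (mat 1 1 (\<lambda>_. \<kappa>)) = [:- \<kappa>, 1:]"
    by (simp add: char_poly_def char_poly_matrix_def det_single)
  ultimately show ?thesis by simp
qed

text \<open>An eigenvector of the quotient lifts to \<open>v\<close> with A v equal to r v plus a
  constant vector, and subtracting the mean of \<open>v\<close> keeps this form. Symmetry forces the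
  new constant to vanish, so \<open>u\<close> is an eigenvector orthogonal to the all-ones vector,
  even when r equals \<open>\<kappa>\<close>.\<close>

lemma quotient_root_le:
  assumes r: "poly (char_poly quotient_mat) r = 0"
  shows "r \<le> norm_perp d A"
proof -
  have Q: "quotient_mat \<in> carrier_mat (d - 1) (d - 1)" by (simp add: quotient_mat_def)
  then obtain w where w: "w \<in> carrier_vec (d - 1)" "w \<noteq> 0\<^sub>v (d - 1)" "quotient_mat *\<^sub>v w = r \<cdot>\<^sub>v w"
    using r eigenvalue_root_char_poly[OF Q] unfolding eigenvalue_def eigenvector_def by auto
  define v where "v i = (if i = 0 then 0 else vec_index w (i - 1))" for i
  obtain m where m: "d = Suc m" using d by (cases d) auto
  define c where "c = (\<Sum>j<d. A $$ (0, j) * v j)"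
  have Av: "(\<Sum>j<d. A $$ (i, j) * v j) = r * v i + c" if i: "i < d" for i
  proof (cases i)
    case 0
    then show ?thesis by (simp add: v_def c_def)
  next
    case (Suc i')
    have dm: "d - 1 = m" and im: "i' < m" using i Suc m by auto
    have qm: "quotient_mat = mat m m (\<lambda>(i, j). A $$ (Suc i, Suc j) - A $$ (0, Suc j))" unfolding quotient_mat_def dm ..
    have wm: "w \<in> carrier_vec m" using w(1) unfolding dm .
    have "r * v i = vec_index (quotient_mat *\<^sub>v w) i'" using w(1,3) i Suc by (simp add: v_def)
    also have "\<dots> = (\<Sum>j<m. (A $$ (i, Suc j) - A $$ (0, Suc j)) * vec_index w j)"
      unfolding qm Suc using im wm by (simp add: scalar_prod_def atLeast0LessThan)
    also have "\<dots> = (\<Sum>j<d. A $$ (i, j) * v j) - c"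
      unfolding c_def m by (simp add: sum.lessThan_Suc_shift v_def left_diff_distrib sum_subtractf del: sum.lessThan_Suc)
    finally show ?thesis by simp
  qed
  define \<mu> where "\<mu> = (\<Sum>j<d. v j) / real d"
  define u where "u i = v i - \<mu>" for i
  have u0: "(\<Sum>j<d. u j) = 0" using d by (simp add: u_def sum_subtractf \<mu>_def)
  define c' where "c' = c - \<mu> * \<kappa> + r * \<mu>"
  have Au: "(\<Sum>j<d. A $$ (i, j) * u j) = r * u i + c'" if i: "i < d" for i
  proof -
    have "(\<Sum>j<d. A $$ (i, j) * u j) = (\<Sum>j<d. A $$ (i, j) * v j) - \<mu> * (\<Sum>j<d. A $$ (i, j))"
      by (simp add: u_def algebra_simps sum_subtractf sum_distrib_left)
    then show ?thesis using Av[OF i] rows[OF i] by (simp add: u_def c'_def algebra_simps)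
  qed
  \<comment> \<open>Column sums are \<open>\<kappa>\<close> by symmetry and \<open>u\<close> sums to
    zero; adding up all coordinates leaves d c' = 0.\<close>
  have "(\<Sum>i<d. \<Sum>j<d. A $$ (i, j) * u j) = (\<Sum>j<d. \<Sum>i<d. A $$ (j, i) * u j)"
    by (subst sum.swap) (intro sum.cong refl, use sym in auto)
  also have "\<dots> = (\<Sum>j<d. \<kappa> * u j)" by (intro sum.cong refl) (use rows in \<open>auto simp flip: sum_distrib_right\<close>)
  also have "\<dots> = 0" using u0 by (simp flip: sum_distrib_left)
  finally have "(\<Sum>i<d. r * u i + c') = 0" using Au by simp
  then have "c' = 0" using u0 d by (simp add: sum.distrib flip: sum_distrib_left)
  then have Au': "(\<Sum>j<d. A $$ (i, j) * u j) = r * u i" if "i < d" for i using Au[OF that] by simp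
  let ?u = "vec d u"
  have "A *\<^sub>v ?u = r \<cdot>\<^sub>v ?u"
    by (rule eq_vecI) (use A Au' in \<open>auto simp: scalar_prod_def atLeast0LessThan\<close>)
  moreover have "?u \<in> orth_complement d (ones_vec d)"
    using u0 by (simp add: orth_complement_def ones_vec_def scalar_prod_def atLeast0LessThan)
  moreover have "?u \<noteq> 0\<^sub>v d"
  proof
    assume z: "?u = 0\<^sub>v d"
    have ui: "u i = 0" if "i < d" for i using arg_cong[OF z, of "\<lambda>x. vec_index x i"] that by simp
    have "u 0 = 0" using ui[of 0] d by simp
    then have "\<mu> = 0" by (simp add: u_def v_def)
    then have "vec_index w i = 0" if "i < d - 1" for i using ui[of "Suc i"] that by (simp add: u_def v_def)
    then have "w = 0\<^sub>v (d - 1)" using w(1) by (intro eq_vecI) auto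
    then show False using w(2) by simp
  qed
  ultimately show ?thesis using norm_perp_eigenvalue[OF A] by blast
qed

text \<open>For a complex eigenvector the Hermitian form of a real symmetric matrix is real, and it
  equals \<open>z\<close> times a positive number.\<close>

lemma complex_root_real:
  assumes "poly (map_poly complex_of_real (char_poly A)) z = 0"
  shows "z \<in> \<real>"
proof -
  let ?A = "map_mat complex_of_real A"
  have Ac: "?A \<in> carrier_mat d d" using A by simp
  have "poly (char_poly ?A) z = 0" using assms of_real_hom.char_poly_hom[OF A, where 'a = complex] by simp
  then obtain v where v: "v \<in> carrier_vec d" "v \<noteq> 0\<^sub>v d" "?A *\<^sub>v v = z \<cdot>\<^sub>v v"
    using eigenvalue_root_char_poly[OF Ac] Ac unfolding eigenvalue_def eigenvector_def by auto
  have row: "(\<Sum>j<d. of_real (A $$ (i, j)) * vec_index v j) = z * vec_index v i" if i: "i < d" for i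
  proof -
    have "(\<Sum>j<d. of_real (A $$ (i, j)) * vec_index v j) = vec_index (?A *\<^sub>v v) i"
      using i A v(1) by (simp add: scalar_prod_def atLeast0LessThan)
    then show ?thesis using v i by simp
  qed
  define N where "N = (\<Sum>i<d. (cmod (vec_index v i))\<^sup>2)"
  define q where "q = (\<Sum>i<d. \<Sum>j<d. cnj (vec_index v i) * (of_real (A $$ (i, j)) * vec_index v j))"
  have "q = (\<Sum>i<d. cnj (vec_index v i) * (z * vec_index v i))"
    unfolding q_def by (intro sum.cong refl) (simp add: row flip: sum_distrib_left)
  also have "\<dots> = z * of_real N"
    unfolding N_def of_real_sum sum_distrib_left
    by (intro sum.cong refl) (unfold complex_norm_square, simp add: mult_ac)
  finally have q: "q = z * of_real N" .
  have "cnj q = (\<Sum>i<d. \<Sum>j<d. vec_index v i * (of_real (A $$ (i, j)) * cnj (vec_index v j)))"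
    by (simp add: q_def)
  also have "\<dots> = (\<Sum>j<d. \<Sum>i<d. vec_index v i * (of_real (A $$ (i, j)) * cnj (vec_index v j)))" by (rule sum.swap)
  also have "\<dots> = q" unfolding q_def by (intro sum.cong refl) (use sym in \<open>auto simp: mult_ac\<close>)
  finally have "q \<in> \<real>" by (simp add: Reals_cnj_iff)
  obtain i where i: "i < d" "vec_index v i \<noteq> 0" using v by (metis carrier_vecD eq_vecI index_zero_vec)
  then have "0 < N" unfolding N_def by (intro sum_pos2[of _ i]) auto
  then have "z = q / of_real N" using q by simp
  then show ?thesis using \<open>q \<in> \<real>\<close> by (simp add: Reals_divide)
qed

text \<open>The list of eigenvalues collects real roots only; this lemma guarantees that it has a
  second element.\<close>

lemma quotient_root_exists: "\<exists>r. poly (char_poly quotient_mat) r = 0"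
proof -
  have Q: "quotient_mat \<in> carrier_mat (d - 1) (d - 1)" by (simp add: quotient_mat_def)
  let ?q = "map_poly complex_of_real (char_poly quotient_mat)"
  have "degree ?q = d - 1" using degree_monic_char_poly[OF Q] by simp
  then have "\<not> constant (poly ?q)" using d by (simp add: constant_degree)
  then obtain z where z: "poly ?q z = 0" using fundamental_theorem_of_algebra by blast
  then have "poly (map_poly complex_of_real (char_poly A)) z = 0"
  proof -
    interpret of_real_poly: map_poly_comm_ring_hom complex_of_real ..
    show ?thesis by (simp only: char_poly_factor of_real_poly.hom_mult poly_mult z mult_zero_right)
  qed
  then have "z \<in> \<real>" by (rule complex_root_real)
  then obtain r where "z = of_real r" by (auto elim: Reals_cases)
  then have "poly (char_poly quotient_mat) r = 0" using z by (simp add: of_real_hom.poly_map_poly)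
  then show ?thesis by blast
qed

text \<open>Apart from one copy of \<open>\<kappa>\<close> all members of the list are roots of the
  quotient polynomial, hence at most the norm. If the second member exceeded the norm, so would the
  first, which makes two. The place of \<open>\<kappa>\<close> in the list does not matter.\<close>

lemma second_eigenvalue_le_norm_perp: "second_eigenvalue A \<le> norm_perp d A"
proof -
  let ?q = "char_poly quotient_mat"
  have Q: "quotient_mat \<in> carrier_mat (d - 1) (d - 1)" by (simp add: quotient_mat_def)
  have q0: "?q \<noteq> 0" using degree_monic_char_poly[OF Q] by auto
  have roots: "proots (char_poly A) = {#\<kappa>#} + proots ?q"
    unfolding char_poly_factor using q0 by (subst proots_mult) auto
  have small: "\<forall>r\<in>#proots ?q. \<not> r > norm_perp d A" unfolding not_less using quotient_root_le q0 by simp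
  have ne: "proots ?q \<noteq> {#}" using quotient_root_exists q0 by (metis (mono_tags, lifting) empty_iff mem_Collect_eq set_count_proots set_mset_empty)
  define L where "L = eigenvalues_desc A"
  have mL: "mset L = {#\<kappa>#} + proots ?q" by (simp add: L_def eigenvalues_desc_def roots)
  have srt: "sorted (rev L)" by (simp add: L_def eigenvalues_desc_def)
  have "size (mset L) \<ge> 2" unfolding mL using ne by (cases "proots ?q") auto
  then obtain x y zs where L: "L = x # y # zs" by (metis Suc_le_length_iff numeral_2_eq_2 size_mset)
  have xy: "y \<le> x" using srt unfolding L by (simp add: sorted_append)
  have "size (filter_mset (\<lambda>r. r > norm_perp d A) (mset L)) \<le> 1"
  proof -
    have z: "filter_mset (\<lambda>r. r > norm_perp d A) (proots ?q) = {#}"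
      by (rule multiset_eqI) (use small in \<open>auto simp: count_eq_zero_iff\<close>)
    show ?thesis unfolding mL filter_union_mset z by simp
  qed
  then have "\<not> y > norm_perp d A" using xy unfolding L by auto
  then show ?thesis by (simp add: second_eigenvalue_def L_def[symmetric] L)
qed

end

lemma perm_model_row_sums:
  assumes \<omega>: "\<omega> \<in> sample_space d k" and d: "d \<ge> 2"
  shows "symmetric_row_sums (perm_model d k (perm_family d k (fst \<omega>))) d (2 * real k)"
proof
  let ?M = "perm_model d k (perm_family d k (fst \<omega>))"
  have M: "?M $$ (a, b) = (\<Sum>i\<in>{1..k}. of_bool (a = fst \<omega> i b) + of_bool (b = fst \<omega> i a))" if "a < d" "b < d" for a b
    using that unfolding perm_model_def by (auto simp: perm_family_def perm_matrix_def intro!: sum.cong)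
  show "?M \<in> carrier_mat d d" by (simp add: perm_model_def)
  show "d \<ge> 2" by (rule d)
  show "?M $$ (i, j) = ?M $$ (j, i)" if "i < d" "j < d" for i j
    using that by (simp add: M add.commute)
  show "(\<Sum>b<d. ?M $$ (a, b)) = 2 * real k" if a: "a < d" for a
  proof -
    have "(\<Sum>b<d. of_bool (a = fst \<omega> i b) + of_bool (b = fst \<omega> i a)) = (2::real)" if i: "i \<in> {1..k}" for i
    proof -
      have "fst \<omega> \<in> {1..k} \<rightarrow>\<^sub>E perms d" using \<omega> by (auto simp: sample_space_def)
      then have "fst \<omega> i \<in> perms d" using i by (rule PiE_mem)
      then have \<pi>: "fst \<omega> i permutes {..<d}" by (simp add: perms_def)
      have inv: "inv_into UNIV (fst \<omega> i) permutes {..<d}" by (rule permutes_inv[OF \<pi>])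
      have e: "(a = fst \<omega> i b) = (b = inv_into UNIV (fst \<omega> i) a)" for b
        using permutes_inv_eq[OF \<pi>, of a b] by auto
      have "(\<Sum>b<d. of_bool (a = fst \<omega> i b) + of_bool (b = fst \<omega> i a))
         = (\<Sum>b<d. (if b = inv_into UNIV (fst \<omega> i) a then 1 else 0) + (if b = fst \<omega> i a then 1 else 0 :: real))"
        by (simp only: e of_bool_def)
      then show ?thesis using a permutes_in_image[OF \<pi>, of a] permutes_in_image[OF inv, of a]
        by (simp add: sum.distrib)
    qed
    then have "(\<Sum>i\<in>{1..k}. \<Sum>b<d. of_bool (a = fst \<omega> i b) + of_bool (b = fst \<omega> i a)) = (\<Sum>i\<in>{1..k}. 2 :: real)"
      by (intro sum.cong refl) simp
    then show ?thesis using a by (subst (asm) sum.swap) (simp add: M)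
  qed
qed

lemma second_eigenvalue_prob:
  assumes d: "d \<ge> 2"
  shows "measure_pmf.prob (iid_perm_matrices d k) {P. norm_perp d (perm_model d k P) \<le> t}
    \<le> measure_pmf.prob (iid_perm_matrices d k) {P. second_eigenvalue (perm_model d k P) \<le> t}"
  unfolding iid_perm_matrices_prob
proof (rule avg_mono)
  fix \<omega> assume "\<omega> \<in> sample_space d k"
  then interpret symmetric_row_sums "perm_model d k (perm_family d k (fst \<omega>))" d "2 * real k"
    using d by (rule perm_model_row_sums)
  show "of_bool (norm_perp d (perm_model d k (perm_family d k (fst \<omega>))) \<le> t)
     \<le> (of_bool (second_eigenvalue (perm_model d k (perm_family d k (fst \<omega>))) \<le> t) :: real)"
    using second_eigenvalue_le_norm_perp by auto
qed

lemma second_eigenvalue_asymptotics: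
  fixes d k :: "nat \<Rightarrow> nat"
  assumes d: "filterlim d at_top sequentially" and k: "filterlim k at_top sequentially"
    and small: "(\<lambda>n. ln (real (d n)) ^ 4) \<in> o[sequentially](\<lambda>n. real (k n))"
    and bound: "\<And>d k :: nat. d \<ge> 2 \<Longrightarrow> k \<ge> 1 \<Longrightarrow>
            measure_pmf.prob (iid_perm_matrices d k)
              {P. norm_perp d (perm_model d k P)
                    \<le> (1 + C * (ln (real d) powr (3/4) / real d powr (1/4))
                         + C * (ln (real d) powr (2/3) / real k powr (1/6))
                         + C * (ln (real d) / real k powr (1/2)))
                       * (2 * sqrt (2 * real k))}
            \<ge> 1 - real d powr (- 1)"
  shows "\<exists>\<epsilon> :: nat \<Rightarrow> real. \<epsilon> \<longlonglongrightarrow> 0 \<and>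
               (\<lambda>n. measure_pmf.prob (iid_perm_matrices (d n) (k n))
                      {P. second_eigenvalue (perm_model (d n) (k n) P)
                            \<le> (1 + \<epsilon> n) * (2 * sqrt (2 * real (k n) - 1))})
                 \<longlonglongrightarrow> 1"
proof -
  define F where "F n = 1 + C * (ln (real (d n)) powr (3/4) / real (d n) powr (1/4))
      + C * (ln (real (d n)) powr (2/3) / real (k n) powr (1/6)) + C * (ln (real (d n)) / real (k n) powr (1/2))" for n
  \<comment> \<open>The square root converts 2 sqrt (2k) into 2 sqrt (2k - 1), so the new threshold
    is exactly that of the norm bound.\<close>
  define \<epsilon> where "\<epsilon> n = F n * sqrt (2 * real (k n) / (2 * real (k n) - 1)) - 1" for n
  \<comment> \<open>The bound 3 exceeds Euler's number, so ln d is at least 1.\<close>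
  have ev: "\<forall>\<^sub>F n in sequentially. d n \<ge> 3 \<and> k n \<ge> 1"
    using filterlim_at_top[THEN iffD1, OF d, rule_format, of 3] filterlim_at_top[THEN iffD1, OF k, rule_format, of 1]
    by eventually_elim auto
  have quot: "(\<lambda>n. ln (real (d n)) ^ 4 / real (k n)) \<longlonglongrightarrow> 0" by (rule smalloD_tendsto[OF small])
  have l1: "(\<lambda>n. ln (real (d n)) powr (3/4) / real (d n) powr (1/4)) \<longlonglongrightarrow> 0"
  proof -
    have "((\<lambda>m. ln (real m) powr (3/4) / real m powr (1/4)) \<longlongrightarrow> 0) at_top" by real_asymp
    from filterlim_compose[OF this d] show ?thesis .
  qed
  \<comment> \<open>The sixth power of this term is (ln d)^4/k, so the growth hypothesis says
    precisely that it vanishes.\<close>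
  have l2: "(\<lambda>n. ln (real (d n)) powr (2/3) / real (k n) powr (1/6)) \<longlonglongrightarrow> 0"
  proof -
    have "(\<lambda>n. root 6 (ln (real (d n)) ^ 4 / real (k n))) \<longlonglongrightarrow> root 6 0" by (intro tendsto_real_root quot)
    moreover have "\<forall>\<^sub>F n in sequentially. root 6 (ln (real (d n)) ^ 4 / real (k n)) = ln (real (d n)) powr (2/3) / real (k n) powr (1/6)"
      using ev
    proof eventually_elim
      case (elim n)
      then have "ln (real (d n)) > 0" "real (k n) > 0" by auto
      then show ?case by (simp add: root_powr_inverse powr_divide powr_powr flip: powr_numeral)
    qed
    ultimately show ?thesis by (simp add: tendsto_cong)
  qed
  have l3: "(\<lambda>n. ln (real (d n)) / real (k n) powr (1/2)) \<longlonglongrightarrow> 0"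
  proof (rule tendsto_sandwich[of "\<lambda>_. 0" _ _ "\<lambda>n. sqrt (ln (real (d n)) ^ 4 / real (k n))"])
    have "(\<lambda>n. sqrt (ln (real (d n)) ^ 4 / real (k n))) \<longlonglongrightarrow> sqrt 0" by (intro tendsto_real_sqrt quot)
    then show "(\<lambda>n. sqrt (ln (real (d n)) ^ 4 / real (k n))) \<longlonglongrightarrow> 0" by simp
    show "\<forall>\<^sub>F n in sequentially. 0 \<le> ln (real (d n)) / real (k n) powr (1/2)"
      using ev by eventually_elim auto
    show "\<forall>\<^sub>F n in sequentially. ln (real (d n)) / real (k n) powr (1/2) \<le> sqrt (ln (real (d n)) ^ 4 / real (k n))"
      using ev
    proof eventually_elim
      case (elim n)
      define l where "l = ln (real (d n))"
      have "exp 1 \<le> real (d n)" using exp_le elim by linarith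
      then have l1: "l \<ge> 1" unfolding l_def using elim by (subst ln_ge_iff) auto
      have "sqrt (l ^ 4) = l\<^sup>2" by (rule real_sqrt_unique) (auto simp flip: power_mult)
      then have "sqrt (l ^ 4 / real (k n)) = l\<^sup>2 / sqrt (real (k n))" by (simp add: real_sqrt_divide)
      moreover have "l \<le> l\<^sup>2" using l1 by (simp add: power2_eq_square)
      ultimately show ?case unfolding l_def[symmetric] using elim
        by (simp add: powr_half_sqrt divide_right_mono)
    qed
  qed simp
  have "F \<longlonglongrightarrow> 1 + C * 0 + C * 0 + C * 0" unfolding F_def by (intro tendsto_intros l1 l2 l3)
  moreover have "(\<lambda>n. sqrt (2 * real (k n) / (2 * real (k n) - 1))) \<longlonglongrightarrow> 1"
  proof -
    have "((\<lambda>m. sqrt (2 * real m / (2 * real m - 1))) \<longlongrightarrow> 1) at_top" by real_asymp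
    from filterlim_compose[OF this k] show ?thesis .
  qed
  ultimately have "(\<lambda>n. F n * sqrt (2 * real (k n) / (2 * real (k n) - 1)) - 1) \<longlonglongrightarrow> (1 + C * 0 + C * 0 + C * 0) * 1 - 1"
    by (intro tendsto_intros)
  then have eps: "\<epsilon> \<longlonglongrightarrow> 0" unfolding \<epsilon>_def by simp
  let ?p = "\<lambda>n. measure_pmf.prob (iid_perm_matrices (d n) (k n))
      {P. second_eigenvalue (perm_model (d n) (k n) P) \<le> (1 + \<epsilon> n) * (2 * sqrt (2 * real (k n) - 1))}"
  have "?p \<longlonglongrightarrow> 1"
  proof (rule tendsto_sandwich[of "\<lambda>n. 1 - real (d n) powr (- 1)" _ _ "\<lambda>_. 1"])
    show "\<forall>\<^sub>F n in sequentially. 1 - real (d n) powr (- 1) \<le> ?p n"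
      using ev
    proof eventually_elim
      case (elim n)
      then have k1: "2 * real (k n) - 1 > 0" by auto
      have e: "(1 + \<epsilon> n) * (2 * sqrt (2 * real (k n) - 1)) = F n * (2 * sqrt (2 * real (k n)))"
        using k1 by (simp add: \<epsilon>_def real_sqrt_divide)
      show ?case unfolding e F_def
        by (rule order_trans[OF bound second_eigenvalue_prob]) (use elim in auto)
    qed
    have "((\<lambda>m. 1 - real m powr (- 1)) \<longlongrightarrow> 1) at_top" by real_asymp
    from filterlim_compose[OF this d] show "(\<lambda>n. 1 - real (d n) powr (- 1)) \<longlonglongrightarrow> 1" .
  qed auto
  then show ?thesis using eps by blast
qed

theorem theorem3p8:
  shows "(\<forall>a::real. a > 0 \<longrightarrow> (\<exists>C::real. C > 0 \<and> (\<forall>(d::nat) (k::nat). d \<ge> 2 \<longrightarrow> k \<ge> 1 \<longrightarrow>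
            measure_pmf.prob (iid_perm_matrices d k)
              {P. norm_perp d (perm_model d k P)
                    \<le> (1 + C * (ln (real d) powr (3/4) / real d powr (1/4))
                         + C * (ln (real d) powr (2/3) / real k powr (1/6))
                         + C * (ln (real d) / real k powr (1/2)))
                       * (2 * sqrt (2 * real k))}
            \<ge> 1 - real d powr (- a))))
       \<and> (\<forall>(d :: nat \<Rightarrow> nat) (k :: nat \<Rightarrow> nat).
            filterlim d at_top sequentially \<longrightarrow>
            filterlim k at_top sequentially \<longrightarrow>
            (\<lambda>n. ln (real (d n)) ^ 4) \<in> o[sequentially](\<lambda>n. real (k n)) \<longrightarrow>
            (\<exists>\<epsilon> :: nat \<Rightarrow> real. \<epsilon> \<longlonglongrightarrow> 0 \<and>
               (\<lambda>n. measure_pmf.prob (iid_perm_matrices (d n) (k n))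
                      {P. second_eigenvalue (perm_model (d n) (k n) P)
                            \<le> (1 + \<epsilon> n) * (2 * sqrt (2 * real (k n) - 1))})
                 \<longlonglongrightarrow> 1))"
proof (intro conjI allI impI)
  fix a :: real assume a: "a > 0"
  let ?C = "1 + 7800 * 10371 + (a + 1) / 2 * exp ((a + 1) / 2) * 10370\<^sup>2 + exp (a / 2) * 10370\<^sup>2 * 1000000"
  have "?C > 0" using a by (intro add_pos_nonneg) auto
  then show "\<exists>C::real. C > 0 \<and> (\<forall>(d::nat) (k::nat). d \<ge> 2 \<longrightarrow> k \<ge> 1 \<longrightarrow>
            measure_pmf.prob (iid_perm_matrices d k)
              {P. norm_perp d (perm_model d k P)
                    \<le> (1 + C * (ln (real d) powr (3/4) / real d powr (1/4))
                         + C * (ln (real d) powr (2/3) / real k powr (1/6))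
                         + C * (ln (real d) / real k powr (1/2)))
                       * (2 * sqrt (2 * real k))}
            \<ge> 1 - real d powr (- a))"
    using concentration_bound_le[OF _ _ a] by (intro exI[of _ ?C]) blast
next
  fix d k :: "nat \<Rightarrow> nat"
  assume "filterlim d at_top sequentially" "filterlim k at_top sequentially"
    "(\<lambda>n. ln (real (d n)) ^ 4) \<in> o[sequentially](\<lambda>n. real (k n))"
  then show "\<exists>\<epsilon> :: nat \<Rightarrow> real. \<epsilon> \<longlonglongrightarrow> 0 \<and>
               (\<lambda>n. measure_pmf.prob (iid_perm_matrices (d n) (k n))
                      {P. second_eigenvalue (perm_model (d n) (k n) P)
                            \<le> (1 + \<epsilon> n) * (2 * sqrt (2 * real (k n) - 1))})
                 \<longlonglongrightarrow> 1"
    by (rule second_eigenvalue_asymptotics) (rule concentration_bound_le[where a = 1], auto)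
qed

end
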